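(* Let $n\ge1$ be a fixed integer, and let $p>\frac{n-1}{2}$ and $p_1>\frac{n+3}{2}$ be real numbers. Then there exist real numbers $a=a(p,p_1)$ and $b=b(p,p_1)$ such that, for every real symmetric positive definite matrix $\sigma_1$ of order $n$, denoting by $\lambda(u)$ the density of the Wishart distribution $\gamma_{p_1,\sigma_1}$, $$\left(I_\lambda+\int_{E_+}I_p(u)\,\lambda(u)\,du\right)^{-1}=a\,\mathbb{P}(\sigma_1)+b\,\sigma_1\otimes\sigma_1 .$$
   Context: $E$ is the Euclidean space of real symmetric matrices of order $n$ with $\langle u,v\rangle=\operatorname{tr}(uv)$ and associated Lebesgue measure $du$; $E_+\subset E$ is the open cone of positive definite matrices. For $u\in E$, the endomorphisms $u\otimes u$ and $\mathbb{P}(u)$ of $E$ are defined by $(u\otimes u)(v)=u\operatorname{tr}(uv)$ and $\mathbb{P}(u)(v)=uvu$. For $q>(n-1)/2$ and $\sigma\in E_+$, the Wishart distribution $\gamma_{q,\sigma}$ is the probability measure on $E_+$ characterized by $\int_{E_+}e^{-\operatorname{tr}(su)}\gamma_{q,\sigma}(du)=\det(I_n+\sigma s)^{-q}$ for all $s\in E_+$; its density with respect to $du$ is proportional to $e^{-\operatorname{tr}(\sigma^{-1}u)}(\det u)^{q-\frac{n+1}{2}}\mathbf 1_{E_+}(u)$. For $u\in E_+$, $$I_p(u)=\frac{1}{2(2p+3)}\Big((2p+1)\mathbb{P}(u^{-1})-u^{-1}\otimes u^{-1}\Big)$$ (this is the Fisher information at $u$ of the model on $\mathbb{R}^n$ with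 density proportional to $(\det u)^{1/2}(1+\frac12x^tux)^{-p-\frac12}$, parametrized by $u\in E_+$). The density information of a strictly positive, continuously differentiable probability density $\lambda$ on $E_+$ is the symmetric endomorphism of $E$ $$I_\lambda=\int_{E_+}\big(g'(u)\otimes g'(u)\big)\lambda(u)\,du,\qquad g=\log\lambda,$$ where $g'(u)\in E$ is the gradient of $g$ for the scalar product of $E$. *)

theory Defs
  imports "HOL-Analysis.Analysis" "HOL-Probability.Probability"
begin

section \<open>The Euclidean space of real symmetric matrices\<close>

typedef (overloaded) 'n symmat = "{A :: real^'n^'n::finite. transpose A = A}"
  morphisms mat_of Abs_symmat
  by (rule exI[of _ "mat 1"]) simp

lemma transpose_mat_of [simp]: "transpose (mat_of u) = mat_of u"
  using mat_of[of u] by simp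

lemma mat_of_nth_commute: "mat_of u $ i $ j = mat_of u $ j $ i"
proof -
  have "mat_of u $ i $ j = transpose (mat_of u) $ i $ j" by simp
  also have "\<dots> = mat_of u $ j $ i" unfolding transpose_def by simp
  finally show ?thesis .
qed

lemma mat_of_Abs: "transpose A = A \<Longrightarrow> mat_of (Abs_symmat A) = A"
  by (simp add: Abs_symmat_inverse)

lemma symmat_eq_iff: "u = v \<longleftrightarrow> (\<forall>i j. mat_of u $ i $ j = mat_of v $ i $ j)"
  by (simp add: mat_of_inject[symmetric] vec_eq_iff)

instantiation symmat :: (finite) real_vector
begin

definition "0 = Abs_symmat 0"
definition "u + v = Abs_symmat (mat_of u + mat_of v)"
definition "u - v = Abs_symmat (mat_of u - mat_of v)"
definition "- u = Abs_symmat (- mat_of u)"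
definition "c *\<^sub>R u = Abs_symmat (c *\<^sub>R mat_of u)"

lemma mat_of_zero [simp]: "mat_of 0 = 0"
  unfolding zero_symmat_def by (rule mat_of_Abs) (simp add: transpose_def vec_eq_iff)

lemma mat_of_add [simp]: "mat_of (u + v) = mat_of u + mat_of v"
  unfolding plus_symmat_def
  by (rule mat_of_Abs) (simp add: transpose_def vec_eq_iff mat_of_nth_commute)

lemma mat_of_diff [simp]: "mat_of (u - v) = mat_of u - mat_of v"
  unfolding minus_symmat_def
  by (rule mat_of_Abs) (simp add: transpose_def vec_eq_iff mat_of_nth_commute)

lemma mat_of_uminus [simp]: "mat_of (- u) = - mat_of u"
  unfolding uminus_symmat_def
  by (rule mat_of_Abs) (simp add: transpose_def vec_eq_iff mat_of_nth_commute)

lemma mat_of_scaleR [simp]: "mat_of (c *\<^sub>R u) = c *\<^sub>R mat_of u"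
  unfolding scaleR_symmat_def
  by (rule mat_of_Abs) (simp add: transpose_def vec_eq_iff mat_of_nth_commute)

instance
  by standard (simp_all add: symmat_eq_iff algebra_simps)

end

instantiation symmat :: (finite) real_inner
begin

definition "inner u v = trace (mat_of u ** mat_of v)"
definition "norm (u :: 'a symmat) = sqrt (inner u u)"
definition "dist (u :: 'a symmat) v = norm (u - v)"
definition "sgn (u :: 'a symmat) = u /\<^sub>R norm u"
definition "uniformity = (INF e\<in>{0 <..}. principal {(u :: 'a symmat, v). dist u v < e})"
definition "open (U :: 'a symmat set) \<longleftrightarrow>
  (\<forall>u\<in>U. eventually (\<lambda>(u', v). u' = u \<longrightarrow> v \<in> U) uniformity)"

lemma inner_symmat_sum: "inner u v = (\<Sum>i\<in>UNIV. \<Sum>j\<in>UNIV. mat_of u $ i $ j * mat_of v $ i $ j)"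
  unfolding inner_symmat_def trace_def matrix_matrix_mult_def
  by (simp add: mat_of_nth_commute[of v])

instance
proof
  fix u v w :: "'a symmat" and r :: real
  show "inner u v = inner v u"
    by (simp add: inner_symmat_sum mult.commute)
  show "inner (u + v) w = inner u w + inner v w"
    by (simp add: inner_symmat_sum algebra_simps sum.distrib)
  show "inner (r *\<^sub>R u) v = r * inner u v"
    by (simp add: inner_symmat_sum sum_distrib_left mult.assoc)
  show "0 \<le> inner u u"
    by (simp add: inner_symmat_sum sum_nonneg)
  show "inner u u = 0 \<longleftrightarrow> u = 0"
    by (auto simp: inner_symmat_sum symmat_eq_iff sum_nonneg_eq_0_iff sum_nonneg)
qed (simp_all add: norm_symmat_def dist_symmat_def sgn_symmat_def uniformity_symmat_def
       open_symmat_def)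

end

text \<open>
  The orthonormal basis is indexed by the unordered pairs \<open>S = {i, j}\<close>, with \<open>i = j\<close> allowed:
  \<open>e\<^sub>i e\<^sub>i\<^sup>T\<close> for a singleton, \<open>(e\<^sub>i e\<^sub>j\<^sup>T + e\<^sub>j e\<^sub>i\<^sup>T) / sqrt 2\<close> for \<open>i \<noteq> j\<close>.
\<close>

definition symmat_unit :: "'n::finite set \<Rightarrow> 'n symmat"
  where "symmat_unit S = Abs_symmat (\<chi> i j. if {i, j} = S then 1 / sqrt (card S) else 0)"

lemma mat_of_symmat_unit:
  "mat_of (symmat_unit S) = (\<chi> i j. if {i, j} = S then 1 / sqrt (card S) else 0)"
  unfolding symmat_unit_def by (rule mat_of_Abs) (simp add: transpose_def vec_eq_iff insert_commute)

lemma inner_symmat_unit: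
  "inner u (symmat_unit {k, l}) = (if k = l then 1 else sqrt 2) * mat_of u $ k $ l"
proof -
  have "inner u (symmat_unit {k, l}) =
      (\<Sum>(i, j)\<in>UNIV \<times> UNIV. mat_of u $ i $ j * (if {i, j} = {k, l} then 1 / sqrt (card {k, l}) else 0))"
    unfolding inner_symmat_sum mat_of_symmat_unit by (simp add: sum.cartesian_product)
  also have "\<dots> = (\<Sum>(i, j)\<in>{(k, l), (l, k)}. mat_of u $ i $ j * (1 / sqrt (card {k, l})))"
    by (rule sum.mono_neutral_cong_right) (auto simp: doubleton_eq_iff split: if_splits)
  also have "\<dots> = (if k = l then 1 else sqrt 2) * mat_of u $ k $ l"
    by (auto simp: mat_of_nth_commute[of u l k] field_simps)
  finally show ?thesis .
qed

instantiation symmat :: (finite) euclidean_space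
begin

definition "Basis = {symmat_unit {i, j} | i j. True}"

instance
proof
  show "(Basis :: 'a symmat set) \<noteq> {}"
    by (auto simp: Basis_symmat_def)
  have "(Basis :: 'a symmat set) \<subseteq> range symmat_unit"
    by (auto simp: Basis_symmat_def)
  then show "finite (Basis :: 'a symmat set)"
    by (rule finite_subset) simp
  fix u v :: "'a symmat"
  show "inner u v = (if u = v then 1 else 0)" if uvB: "u \<in> Basis" "v \<in> Basis"
  proof -
    obtain i j k l where uv: "u = symmat_unit {i, j}" "v = symmat_unit {k, l}"
      using uvB unfolding Basis_symmat_def by blast
    have 1: "inner u v = (if {k, l} = {i, j} then 1 else 0)"
      unfolding uv inner_symmat_unit mat_of_symmat_unit
      by (auto simp: doubleton_eq_iff)
    have "u = v \<longleftrightarrow> {k, l} = {i, j}"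
    proof
      assume "u = v"
      moreover have "inner v v = 1"
        unfolding uv inner_symmat_unit mat_of_symmat_unit by auto
      ultimately have "inner u v \<noteq> 0" by simp
      with 1 show "{k, l} = {i, j}" by presburger
    qed (simp add: uv)
    with 1 show ?thesis by simp
  qed
  show "(\<forall>v\<in>Basis. inner u v = 0) \<longleftrightarrow> u = 0"
  proof
    assume *: "\<forall>v\<in>Basis. inner u v = 0"
    have "mat_of u $ i $ j = 0" for i j
    proof -
      have "inner u (symmat_unit {i, j}) = 0"
        using * by (auto simp: Basis_symmat_def)
      then show ?thesis
        by (simp add: inner_symmat_unit split: if_splits)
    qed
    then show "u = 0" by (simp add: symmat_eq_iff)
  qed simp
qed

end

text \<open>Needed for Bochner integrals of endomorphism-valued functions.\<close>

instance blinfun :: (euclidean_space, euclidean_space) second_countable_topology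
proof
  have "\<exists>k. finite k \<and> cball (0 :: 'a \<Rightarrow>\<^sub>L 'b) (real m) \<subseteq> (\<Union>x\<in>k. ball x (inverse (Suc r)))" for m r
    using compact_cball[of "0 :: 'a \<Rightarrow>\<^sub>L 'b" "real m"] unfolding compact_eq_totally_bounded by simp
  then obtain K where K: "\<And>m r. finite (K m r)"
    "\<And>m r. cball (0 :: 'a \<Rightarrow>\<^sub>L 'b) (real m) \<subseteq> (\<Union>x\<in>K m r. ball x (inverse (Suc r)))"
    by metis
  define B where "B = (\<Union>m r. (\<lambda>x. ball x (inverse (Suc r))) ` K m r)"
  have "countable B"
    unfolding B_def by (simp add: K(1) countable_finite)
  moreover have "topological_basis B"
  proof (rule topological_basisI)
    show "open b" if "b \<in> B" for b
      using that by (auto simp: B_def)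
    fix U and x :: "'a \<Rightarrow>\<^sub>L 'b"
    assume "open U" "x \<in> U"
    then obtain e where e: "e > 0" "ball x e \<subseteq> U"
      by (meson open_contains_ball)
    obtain r where r: "inverse (real (Suc r)) < e / 2"
      using reals_Archimedean[of "e / 2"] e by auto
    obtain m where "norm x \<le> real m"
      using real_arch_simple by blast
    then have "x \<in> cball 0 (real m)" by simp
    then obtain y where y: "y \<in> K m r" "x \<in> ball y (inverse (Suc r))"
      using K(2) by blast
    have "ball y (inverse (Suc r)) \<subseteq> ball x e"
    proof
      fix z assume "z \<in> ball y (inverse (Suc r))"
      then show "z \<in> ball x e"
        using y(2) r dist_triangle[of x z y] by (simp add: dist_commute)
    qed
    then show "\<exists>b\<in>B. x \<in> b \<and> b \<subseteq> U"
      using y e by (intro bexI[of _ "ball y (inverse (Suc r))"]) (auto simp: B_def)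
  qed
  ultimately show "\<exists>B::('a \<Rightarrow>\<^sub>L 'b) set set. countable B \<and> open = generate_topology B"
    using topological_basis_imp_subbasis by blast
qed

section \<open>The cone, the inverse, and the endomorphisms\<close>

definition pd_cone :: "'n::finite symmat set"
  where "pd_cone = {u. \<forall>x. x \<noteq> 0 \<longrightarrow> 0 < x \<bullet> (mat_of u *v x)}"

definition symmat_inv :: "'n::finite symmat \<Rightarrow> 'n symmat"
  where "symmat_inv u = Abs_symmat (matrix_inv (mat_of u))"

definition tensor_sq :: "'n::finite symmat \<Rightarrow> ('n symmat \<Rightarrow>\<^sub>L 'n symmat)"
  where "tensor_sq u = Blinfun (\<lambda>v. trace (mat_of u ** mat_of v) *\<^sub>R u)"

definition quad_rep :: "'n::finite symmat \<Rightarrow> ('n symmat \<Rightarrow>\<^sub>L 'n symmat)"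
  where "quad_rep u = Blinfun (\<lambda>v. Abs_symmat (mat_of u ** mat_of v ** mat_of u))"

text \<open>The constructors \<^const>\<open>Abs_symmat\<close> and \<^const>\<open>Blinfun\<close> are applied within their domains.\<close>

lemma mat_of_symmat_inv:
  assumes "u \<in> pd_cone"
  shows "mat_of (symmat_inv u) = matrix_inv (mat_of u)"
    and "mat_of u ** mat_of (symmat_inv u) = mat 1"
proof -
  have "mat_of u *v x \<noteq> 0" if "x \<noteq> 0" for x
    using assms that unfolding pd_cone_def by force
  then have "invertible (mat_of u)"
    by (metis invertible_left_inverse matrix_left_invertible_ker)
  then have inv: "mat_of u ** matrix_inv (mat_of u) = mat 1" "matrix_inv (mat_of u) ** mat_of u = mat 1"
    using someI_ex[of "\<lambda>B. mat_of u ** B = mat 1 \<and> B ** mat_of u = mat 1"]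
    unfolding matrix_inv_def invertible_def by blast+
  let ?B = "matrix_inv (mat_of u)"
  have "transpose ?B ** mat_of u = mat 1"
    using arg_cong[OF inv(1), of transpose] by (simp add: matrix_transpose_mul)
  then have "transpose ?B = ?B"
    by (metis inv(1) matrix_mul_assoc matrix_mul_lid matrix_mul_rid)
  then show "mat_of (symmat_inv u) = ?B"
    unfolding symmat_inv_def by (rule mat_of_Abs)
  with inv show "mat_of u ** mat_of (symmat_inv u) = mat 1" by simp
qed

lemma tensor_sq_apply: "blinfun_apply (tensor_sq u) v = inner u v *\<^sub>R u"
proof -
  have "bounded_linear (\<lambda>v. inner u v *\<^sub>R u)"
    by (intro bounded_linear_intros)
  then show ?thesis
    unfolding tensor_sq_def inner_symmat_def by (simp add: bounded_linear_Blinfun_apply)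
qed

lemma mat_of_quad_rep_apply:
  "mat_of (blinfun_apply (quad_rep u) v) = mat_of u ** mat_of v ** mat_of u"
proof -
  have *: "mat_of (Abs_symmat (mat_of u ** mat_of w ** mat_of u)) = mat_of u ** mat_of w ** mat_of u" for w
    by (rule mat_of_Abs) (simp add: matrix_transpose_mul matrix_mul_assoc)
  have **: "A ** (B + C) ** A = A ** B ** A + A ** C ** A"
      "A ** (c *\<^sub>R B) ** A = c *\<^sub>R (A ** B ** A)" for A B C :: "real^'a^'a" and c
    by (simp_all add: vec_eq_iff matrix_matrix_mult_def algebra_simps sum.distrib
        sum_distrib_left sum_distrib_right)
  have "linear (\<lambda>v. Abs_symmat (mat_of u ** mat_of v ** mat_of u))"
    by (rule linearI; simp only: mat_of_inject[symmetric] *; simp add: * **)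
  then show ?thesis
    unfolding quad_rep_def
    by (simp add: linear_conv_bounded_linear bounded_linear_Blinfun_apply *)
qed

section \<open>The Wishart distribution\<close>

definition is_wishart :: "real \<Rightarrow> 'n::finite symmat \<Rightarrow> 'n symmat measure \<Rightarrow> bool"
  where "is_wishart q \<sigma> \<gamma> \<longleftrightarrow>
    prob_space \<gamma> \<and> sets \<gamma> = sets borel \<and> measure \<gamma> pd_cone = 1 \<and>
    (\<forall>s\<in>pd_cone. (\<integral>u. exp (- trace (mat_of s ** mat_of u)) \<partial>\<gamma>) =
       det (mat 1 + mat_of \<sigma> ** mat_of s) powr (- q))"

definition wishart :: "real \<Rightarrow> 'n::finite symmat \<Rightarrow> 'n symmat measure"
  where "wishart q \<sigma> = (THE \<gamma>. is_wishart q \<sigma> \<gamma>)"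

text \<open>
  A density is determined only almost everywhere; the version meant is the one that is continuous
  on the cone, and it is extended by zero. The reference measure \<^const>\<open>lborel\<close> is the Lebesgue
  measure of the Euclidean structure given by the trace.
\<close>

definition wishart_density :: "real \<Rightarrow> 'n::finite symmat \<Rightarrow> 'n symmat \<Rightarrow> real"
  where "wishart_density q \<sigma> = (THE f.
    (\<forall>u. 0 \<le> f u) \<and> (\<forall>u. u \<notin> pd_cone \<longrightarrow> f u = 0) \<and> continuous_on pd_cone f \<and>
    wishart q \<sigma> = density lborel (\<lambda>u. ennreal (f u)))"

section \<open>Information\<close>

definition gradient :: "('a::real_inner \<Rightarrow> real) \<Rightarrow> 'a \<Rightarrow> 'a"
  where "gradient f x = (THE D. GDERIV f x :> D)"

definition density_info_integrand ::
    "('n::finite symmat \<Rightarrow> real) \<Rightarrow> 'n symmat \<Rightarrow> ('n symmat \<Rightarrow>\<^sub>L 'n symmat)"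
  where "density_info_integrand f u = f u *\<^sub>R tensor_sq (gradient (\<lambda>w. ln (f w)) u)"

definition density_info :: "('n::finite symmat \<Rightarrow> real) \<Rightarrow> ('n symmat \<Rightarrow>\<^sub>L 'n symmat)"
  where "density_info f = (LINT u:pd_cone|lborel. density_info_integrand f u)"

definition fisher_info :: "real \<Rightarrow> 'n::finite symmat \<Rightarrow> ('n symmat \<Rightarrow>\<^sub>L 'n symmat)"
  where "fisher_info p u = (1 / (2 * (2 * p + 3))) *\<^sub>R
    ((2 * p + 1) *\<^sub>R quad_rep (symmat_inv u) - tensor_sq (symmat_inv u))"

end

theory Submission
  imports Defs
begin

text \<open>
  Write \<open>r = u\<^sup>-\<^sup>1\<close>, \<open>t = \<sigma>\<^sup>-\<^sup>1\<close> and \<open>\<alpha> = p\<^sub>1 - (n + 1) / 2 > 1\<close>; the density is proportional to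
  \<open>f = (det u)\<^sup>\<alpha> exp (- tr (t u))\<close> on the cone. All moments come from integration by parts in a constant
  direction (translation invariance of Lebesgue measure), with no change of variables. The direction
  of the identity matrix, applied to \<open>f / det u\<close>, gives the integrability of \<open>r\<^sub>i\<^sub>j r\<^sub>k\<^sub>l f\<close>. The
  directions dual to the matrix entries give \<open>\<alpha> E r\<^sub>k\<^sub>l = t\<^sub>k\<^sub>l\<close> and
  \<open>\<alpha> E (r\<^sub>i\<^sub>j r\<^sub>k\<^sub>l) = (E (r\<^sub>i\<^sub>k r\<^sub>j\<^sub>l) + E (r\<^sub>i\<^sub>l r\<^sub>j\<^sub>k)) / 2 + t\<^sub>k\<^sub>l E r\<^sub>i\<^sub>j\<close>; permuting the indices
  yields a linear system for the second moments of \<open>r\<close>, so that both information matrices are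
  combinations of \<open>P(t)\<close> and \<open>t \<otimes> t\<close>, which are inverted explicitly. The same method gives
  \<open>E u = p\<^sub>1 \<sigma>\<close>, which integrates to the Laplace transform of \<open>f\<close>; that the Laplace transform
  determines the measure follows from the Stone-Weierstrass theorem.
\<close>

section \<open>Integration by parts on an open convex set\<close>

text \<open>The obstacle is the boundary of the cone, where the inverse r blows up. By Cramer's rule
  an entry of r times det^\<alpha> is a polynomial times det^(\<alpha> - 1): one factor r costs one
  power of the determinant, and the product still extends continuously by 0 because \<alpha> > 1. A
  second factor costs another power, and det^(\<alpha> - 2) may be unbounded. Growth estimates stop
  there and positivity takes over: the trace of r is nonnegative on the cone, and a function whose
  derivative is nonnegative up to a multiple of the function itself controls that derivative in the
  mean. The Wishart law and its density are given by definite descriptions, so existence and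
  uniqueness must be settled before the moments say anything about them; this is the reason for the
  Laplace transform and the Stone-Weierstrass argument.\<close>

lemma integral_diff_eq_iterated_integral:
  fixes w :: "real \<Rightarrow> 'a::euclidean_space \<Rightarrow> real"
  assumes int: "integrable (lborel \<Otimes>\<^sub>M lborel) (\<lambda>(t, u). indicator {0..1} t * w t u)"
    and ftc: "\<And>u. ((\<lambda>t. w t u) has_integral d u) {0..1}"
    and [measurable]: "d \<in> borel_measurable borel"
  shows "(\<integral>u. d u \<partial>lborel) = (\<integral>t. indicator {0..1} t * (\<integral>u. w t u \<partial>lborel) \<partial>lborel)"
proof -
  have "(\<integral>u. (\<integral>t. indicator {0..1} t * w t u \<partial>lborel) \<partial>lborel) =
      (\<integral>t. (\<integral>u. indicator {0..1} t * w t u \<partial>lborel) \<partial>lborel)"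
    using int by (rule lborel_pair.Fubini_integral)
  \<comment> \<open>\<open>ftc\<close> speaks of a gauge integral. It agrees with the Lebesgue
    integral where the slice is Lebesgue integrable, which Fubini guarantees for almost every
    u.\<close>
  moreover have "AE u in lborel. integrable lborel (\<lambda>t. indicator {0..1} t * w t u)"
    using lborel_pair.AE_integrable_snd[OF int] .
  then have "AE u in lborel. (\<integral>t. indicator {0..1} t * w t u \<partial>lborel) = d u"
  proof (rule AE_mp, intro AE_I2 impI)
    fix u assume *: "integrable lborel (\<lambda>t. indicator {0..1} t * w t u)"
    then have "set_integrable lborel {0..1} (\<lambda>t. w t u)"
      by (simp add: set_integrable_def)
    from set_borel_integral_eq_integral(2)[OF this] ftc[of u]
    show "(\<integral>t. indicator {0..1} t * w t u \<partial>lborel) = d u"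
      by (simp add: set_lebesgue_integral_def integral_unique)
  qed
  then have "(\<integral>u. (\<integral>t. indicator {0..1} t * w t u \<partial>lborel) \<partial>lborel) = (\<integral>u. d u \<partial>lborel)"
    by (intro integral_cong_AE) (use int in auto)
  ultimately show ?thesis
    by simp
qed

lemma finite_frontier_open_interval:
  fixes S :: "real set"
  assumes "open S" "convex S"
  shows "finite (frontier S)"
proof -
  obtain a b where "S = {} \<or> S = UNIV \<or> S = {..<b} \<or> S = {..b} \<or>
    S = {a<..} \<or> S = {a..} \<or> S = {a<..<b} \<or> S = {a<..b} \<or> S = {a..<b} \<or> S = {a..b}"
    using is_real_interval[OF iffD2[OF is_interval_convex_1 assms(2)]] by (elim exE that)
  \<comment> \<open>All shapes are treated alike: apart from the whole line, each lies in a closed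
    set exceeding it by at most the end points, and the frontier of an open set lies in that
    excess.\<close>
  then have "S = UNIV \<or> (\<exists>T. closed T \<and> S \<subseteq> T \<and> T - S \<subseteq> {a, b})"
  proof (elim disjE)
    assume "S = {..<b}" then show ?thesis by (intro disjI2 exI[of _ "{..b}"]) auto
  next
    assume "S = {a<..}" then show ?thesis by (intro disjI2 exI[of _ "{a..}"]) auto
  next
    assume "S = {a<..<b}" then show ?thesis by (intro disjI2 exI[of _ "{a..b}"]) auto
  next
    assume "S = {a<..b}" then show ?thesis by (intro disjI2 exI[of _ "{a..b}"]) auto
  next
    assume "S = {a..<b}" then show ?thesis by (intro disjI2 exI[of _ "{a..b}"]) auto
  next
    assume "S = {..b}" then show ?thesis by (intro disjI2 exI[of _ S]) auto
  next
    assume "S = {a..}" then show ?thesis by (intro disjI2 exI[of _ S]) auto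
  next
    assume "S = {a..b}" then show ?thesis by (intro disjI2 exI[of _ S]) auto
  qed auto
  moreover have "frontier S \<subseteq> T - S" if "closed T" "S \<subseteq> T" for T
    using closure_minimal[OF that(2,1)] assms(1) by (auto simp: frontier_def interior_open)
  ultimately show ?thesis
    by (metis finite.emptyI finite.insertI finite_subset frontier_UNIV order_trans)
qed

text \<open>The parameters at which a line meets the convex set form an open interval, so that only its two
  end points are exceptional for the fundamental theorem of calculus.\<close>

lemma has_integral_along_line:
  fixes g :: "'a::real_normed_vector \<Rightarrow> real"
  assumes C: "open C" "convex C"
    and g: "continuous_on UNIV g" "\<And>u. u \<notin> C \<Longrightarrow> g u = 0"
    and w: "\<And>u. u \<in> C \<Longrightarrow> ((\<lambda>t. g (u + t *\<^sub>R v)) has_real_derivative w u) (at 0)"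
      "\<And>u. u \<notin> C \<Longrightarrow> w u = 0"
  shows "((\<lambda>t. w (u + t *\<^sub>R v)) has_integral (g (u + v) - g u)) {0..1}"
proof -
  define A where "A = (\<lambda>t. u + t *\<^sub>R v) -` C"
  have contl: "continuous_on UNIV (\<lambda>t. u + t *\<^sub>R v)"
    by (intro continuous_intros)
  have "open A"
    unfolding A_def using contl C(1) by (intro open_vimage) auto
  moreover have "convex A"
  proof (rule convexI)
    fix x y a b :: real assume *: "x \<in> A" "y \<in> A" "0 \<le> a" "0 \<le> b" "a + b = 1"
    have "a *\<^sub>R (u + x *\<^sub>R v) + b *\<^sub>R (u + y *\<^sub>R v) \<in> C"
      using * C(2) by (auto simp: A_def intro: convexD)
    also have "a *\<^sub>R (u + x *\<^sub>R v) + b *\<^sub>R (u + y *\<^sub>R v) = (a + b) *\<^sub>R u + (a * x + b * y) *\<^sub>R v"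
      by (simp add: algebra_simps)
    finally show "a *\<^sub>R x + b *\<^sub>R y \<in> A"
      using * by (simp add: A_def)
  qed
  ultimately have fin: "finite (frontier A)"
    by (rule finite_frontier_open_interval)
  have "((\<lambda>t. w (u + t *\<^sub>R v)) has_integral (g (u + 1 *\<^sub>R v) - g (u + 0 *\<^sub>R v))) {0..1}"
  proof (rule fundamental_theorem_of_calculus_interior_strong[OF fin])
    show "continuous_on {0..1} (\<lambda>t. g (u + t *\<^sub>R v))"
      by (rule continuous_on_subset[OF continuous_on_compose2[OF g(1) contl]]) auto
    fix t assume t: "t \<in> {0<..<1} - frontier A"
    show "((\<lambda>t. g (u + t *\<^sub>R v)) has_vector_derivative w (u + t *\<^sub>R v)) (at t)"
    proof (cases "t \<in> A")
      case True
      then have "((\<lambda>x. g (u + t *\<^sub>R v + x *\<^sub>R v)) has_real_derivative w (u + t *\<^sub>R v)) (at 0)"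
        by (intro w) (simp add: A_def)
      then have "((\<lambda>x. g (u + (x + t) *\<^sub>R v)) has_real_derivative w (u + t *\<^sub>R v)) (at 0)"
        by (simp add: algebra_simps)
      then show ?thesis
        using DERIV_shift[of "\<lambda>t. g (u + t *\<^sub>R v)" "w (u + t *\<^sub>R v)" 0 t]
        by (simp add: has_real_derivative_iff_has_vector_derivative)
    next
      case False
      \<comment> \<open>Away from the end points, a parameter outside \<open>A\<close> has a
        neighbourhood outside \<open>A\<close>, where \<open>g\<close> vanishes along the
        line.\<close>
      with t have notin: "t \<in> - closure A"
        using \<open>open A\<close> by (auto simp: frontier_def interior_open)
      have zero: "0 = g (u + s *\<^sub>R v)" if "s \<in> - closure A" for s
      proof -
        have "s \<notin> A"
          using that closure_subset[of A] by auto
        then show ?thesis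
          using g(2)[of "u + s *\<^sub>R v"] by (simp add: A_def)
      qed
      have "((\<lambda>t. g (u + t *\<^sub>R v)) has_vector_derivative 0) (at t)"
        by (rule has_vector_derivative_transform_within_open[where f = "\<lambda>_. 0", OF _ _ notin zero])
          (simp_all add: open_Compl)
      moreover have "w (u + t *\<^sub>R v) = 0"
        using False w(2) by (simp add: A_def)
      ultimately show ?thesis
        by simp
    qed
  qed simp
  then show ?thesis
    by simp
qed

lemma integrable_translate_lborel:
  fixes f :: "'a::euclidean_space \<Rightarrow> real"
  assumes "integrable lborel f"
  shows "integrable lborel (\<lambda>u. f (u + c))" "(\<integral>u. f (u + c) \<partial>lborel) = (\<integral>u. f u \<partial>lborel)"
proof -
  have *: "lborel = distr lborel borel (\<lambda>u. u + c)"
    using lborel_distr_plus[of c] by (simp add: add.commute[of _ c])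
  have [measurable]: "f \<in> borel_measurable borel"
    using assms by auto
  show "integrable lborel (\<lambda>u. f (u + c))"
    using assms by (subst (asm) *) (simp add: integrable_distr_eq)
  show "(\<integral>u. f (u + c) \<partial>lborel) = (\<integral>u. f u \<partial>lborel)"
    by (subst (2) *) (simp add: integral_distr)
qed

lemma nn_integral_translate_lborel:
  fixes f :: "'a::euclidean_space \<Rightarrow> ennreal"
  assumes [measurable]: "f \<in> borel_measurable borel"
  shows "(\<integral>\<^sup>+u. f (u + c) \<partial>lborel) = (\<integral>\<^sup>+u. f u \<partial>lborel)"
proof -
  have *: "lborel = distr lborel borel (\<lambda>u. u + c)"
    using lborel_distr_plus[of c] by (simp add: add.commute[of _ c])
  show ?thesis
    by (subst (2) *) (simp add: nn_integral_distr)
qed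

text \<open>The increment g(u + v) - g(u) integrates to 0 by translation invariance, and it is also
  the integral of w along the segment. Fubini and translation invariance turn the latter into the
  integral of w. Continuity of g on the whole space, with value 0 off C, rules out boundary
  terms.\<close>

proposition integral_directional_derivative_eq_0:
  fixes g :: "'a::euclidean_space \<Rightarrow> real"
  assumes C: "open C" "convex C"
    and g: "continuous_on UNIV g" "\<And>u. u \<notin> C \<Longrightarrow> g u = 0" "integrable lborel g"
    and w: "\<And>u. u \<in> C \<Longrightarrow> ((\<lambda>t. g (u + t *\<^sub>R v)) has_real_derivative w u) (at 0)"
      "\<And>u. u \<notin> C \<Longrightarrow> w u = 0" "integrable lborel w"
  shows "(\<integral>u. w u \<partial>lborel) = 0"
proof -
  have [measurable]: "w \<in> borel_measurable borel" "g \<in> borel_measurable borel"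
    using w(3) g(3) by auto
  have "integrable (lborel \<Otimes>\<^sub>M lborel) (\<lambda>(t, u). indicator {0..1} t * w (u + t *\<^sub>R v))"
  proof (rule lborel_pair.Fubini_integrable)
    have "(\<integral>u. norm (indicator {0..1} t * w (u + t *\<^sub>R v)) \<partial>lborel) = indicator {0..1} t * (\<integral>u. \<bar>w u\<bar> \<partial>lborel)" for t
      using integrable_translate_lborel(2)[OF integrable_abs[OF w(3)], of "t *\<^sub>R v"] by (simp add: abs_mult)
    then show "integrable lborel (\<lambda>t. \<integral>u. norm (case (t, u) of (t, u) \<Rightarrow> indicator {0..1} t * w (u + t *\<^sub>R v)) \<partial>lborel)"
      by simp
    show "AE t in lborel. integrable lborel (\<lambda>u. case (t, u) of (t, u) \<Rightarrow> indicator {0..1} t * w (u + t *\<^sub>R v))"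
      by (simp add: integrable_translate_lborel(1)[OF w(3)])
  qed measurable
  then have "(\<integral>u. g (u + v) - g u \<partial>lborel) =
      (\<integral>t. indicator {0..1} t * (\<integral>u. w (u + t *\<^sub>R v) \<partial>lborel) \<partial>lborel)"
    by (rule integral_diff_eq_iterated_integral)
      (auto intro!: has_integral_along_line[OF C g(1,2) w(1,2)])
  moreover have "(\<integral>u. g (u + v) - g u \<partial>lborel) = 0"
    using integrable_translate_lborel[OF g(3), of v] g(3) by simp
  ultimately show ?thesis
    by (simp add: integrable_translate_lborel(2)[OF w(3)])
qed

text \<open>Here integrability of the derivative is the conclusion. As w \<ge> 0, the fundamental
  theorem bounds its integral over a segment by g(u + v) plus k times the integral of g over the
  segment; Tonelli then bounds the integral of w by (1 + k) times that of g.\<close>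

proposition integrable_directional_derivative:
  fixes g :: "'a::euclidean_space \<Rightarrow> real"
  assumes C: "open C" "convex C"
    and g: "continuous_on UNIV g" "\<And>u. u \<notin> C \<Longrightarrow> g u = 0" "integrable lborel g" "\<And>u. 0 \<le> g u"
    and w: "\<And>u. u \<in> C \<Longrightarrow> ((\<lambda>t. g (u + t *\<^sub>R v)) has_real_derivative w u - k * g u) (at 0)"
      "\<And>u. u \<notin> C \<Longrightarrow> w u = 0" "\<And>u. 0 \<le> w u"
    and [measurable]: "w \<in> borel_measurable borel" and "0 \<le> k"
  shows "integrable lborel w"
proof -
  have [measurable]: "g \<in> borel_measurable borel"
    using g(3) by auto
  have ind: "(\<lambda>t. indicator {0..1} t * h t) = (\<lambda>t. if t \<in> {0..1} then h t else 0)" for h :: "real \<Rightarrow> real"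
    by (auto simp: fun_eq_iff)
  define G where "G u = integral {0..1} (\<lambda>t. g (u + t *\<^sub>R v))" for u
  have contl: "continuous_on {0..1} (\<lambda>t. g (u + t *\<^sub>R v))" for u
    by (rule continuous_on_compose2[OF g(1)]) (auto intro!: continuous_intros)
  have G: "((\<lambda>t. g (u + t *\<^sub>R v)) has_integral G u) {0..1}" for u
    unfolding G_def using contl by (intro integrable_integral integrable_continuous_interval)
  have G0: "0 \<le> G u" for u
    using G by (rule has_integral_nonneg) (simp add: g)
  have nnG: "ennreal (G u) = (\<integral>\<^sup>+t. indicator {0..1} t * ennreal (g (u + t *\<^sub>R v)) \<partial>lborel)" for u
  proof -
    have "((\<lambda>t. indicator {0..1} t * g (u + t *\<^sub>R v)) has_integral G u) UNIV"
      using G[of u] unfolding ind by (subst has_integral_restrict_UNIV)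
    from nn_integral_has_integral_lborel[OF _ _ this] show ?thesis
      by (simp add: g ennreal_mult' ennreal_indicator)
  qed
  have nnw: "(\<integral>\<^sup>+t. indicator {0..1} t * ennreal (w (u + t *\<^sub>R v)) \<partial>lborel) \<le> ennreal (g (u + v)) + ennreal k * ennreal (G u)" for u
  proof -
    have "((\<lambda>t. w (u + t *\<^sub>R v) - k * g (u + t *\<^sub>R v)) has_integral (g (u + v) - g u)) {0..1}"
      by (rule has_integral_along_line[OF C g(1,2), of v "\<lambda>u. w u - k * g u"]) (simp_all add: w g)
    from has_integral_add[OF this has_integral_mult_right[OF G[of u], of k]]
    have "((\<lambda>t. w (u + t *\<^sub>R v)) has_integral (g (u + v) - g u + k * G u)) {0..1}"
      by simp
    then have "((\<lambda>t. indicator {0..1} t * w (u + t *\<^sub>R v)) has_integral (g (u + v) - g u + k * G u)) UNIV"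
      unfolding ind by (subst has_integral_restrict_UNIV)
    from nn_integral_has_integral_lborel[OF _ _ this]
    have "(\<integral>\<^sup>+t. indicator {0..1} t * ennreal (w (u + t *\<^sub>R v)) \<partial>lborel) = ennreal (g (u + v) - g u + k * G u)"
      by (simp add: w ennreal_mult' ennreal_indicator)
    also have "\<dots> \<le> ennreal (g (u + v) + k * G u)"
      by (rule ennreal_leI) (simp add: g)
    also have "\<dots> = ennreal (g (u + v)) + ennreal k * ennreal (G u)"
      using g G0 \<open>0 \<le> k\<close> by (simp add: ennreal_plus ennreal_mult)
    finally show ?thesis .
  qed
  have swap: "(\<integral>\<^sup>+u. \<integral>\<^sup>+t. indicator {0..1} t * ennreal (h (u + t *\<^sub>R v)) \<partial>lborel \<partial>lborel) = (\<integral>\<^sup>+u. ennreal (h u) \<partial>lborel)"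
    if [measurable]: "h \<in> borel_measurable borel" for h :: "'a \<Rightarrow> real"
  proof -
    have "(\<integral>\<^sup>+u. \<integral>\<^sup>+t. indicator {0..1} t * ennreal (h (u + t *\<^sub>R v)) \<partial>lborel \<partial>lborel) =
        (\<integral>\<^sup>+t. \<integral>\<^sup>+u. indicator {0..1::real} t * ennreal (h (u + t *\<^sub>R v)) \<partial>lborel \<partial>lborel)"
      by (rule lborel_pair.Fubini') measurable
    also have "\<dots> = (\<integral>\<^sup>+t. indicator {0..1::real} t * (\<integral>\<^sup>+u. ennreal (h u) \<partial>lborel) \<partial>lborel)"
      by (simp add: nn_integral_cmult nn_integral_translate_lborel[of "\<lambda>u. ennreal (h u)"])
    also have "\<dots> = (\<integral>\<^sup>+u. ennreal (h u) \<partial>lborel)"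
      by (simp add: nn_integral_multc)
    finally show ?thesis .
  qed
  \<comment> \<open>\<open>G\<close> is a gauge integral depending on a parameter; its measurability
    is read off the Lebesgue form \<open>nnG\<close>.\<close>
  have [measurable]: "(\<lambda>u. ennreal (G u)) \<in> borel_measurable borel"
    unfolding nnG by measurable
  have "(\<integral>\<^sup>+u. ennreal (w u) \<partial>lborel) \<le> (\<integral>\<^sup>+u. ennreal (g (u + v)) + ennreal k * ennreal (G u) \<partial>lborel)"
    unfolding swap[OF \<open>w \<in> borel_measurable borel\<close>, symmetric] by (intro nn_integral_mono nnw)
  also have "\<dots> = (\<integral>\<^sup>+u. ennreal (g u) \<partial>lborel) + ennreal k * (\<integral>\<^sup>+u. ennreal (g u) \<partial>lborel)"
    by (simp add: nn_integral_add nn_integral_cmult nn_integral_translate_lborel[of "\<lambda>u. ennreal (g u)"] nnG swap)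
  also have "\<dots> < \<infinity>"
    using g(3,4) by (simp add: nn_integral_eq_integral ennreal_mult_less_top)
  finally show ?thesis
    by (intro integrableI_nonneg) (auto simp: w)
qed

section \<open>Integrability of functions with exponential decay\<close>

lemma power_mult_exp_bounded:
  fixes \<epsilon> :: real
  assumes "0 < \<epsilon>"
  obtains B where "\<And>x. 0 \<le> x \<Longrightarrow> (1 + x) ^ m * exp (- \<epsilon> * x) \<le> B"
proof -
  \<comment> \<open>The inequality (1 + y / k)^k \<le> exp y requires k > 0, also when m = 0. With y
    = \<epsilon> (1 + x) it gives the constant \<open>B\<close>.\<close>
  define k where "k = Suc m"
  define B where "B = (real k / \<epsilon>) ^ k * exp \<epsilon>"
  have "0 < k"
    by (simp add: k_def)
  have B: "(1 + x) ^ k * exp (- \<epsilon> * x) \<le> B" if "0 \<le> x" for x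
  proof -
    have "(\<epsilon> * (1 + x) / k) ^ k \<le> (1 + \<epsilon> * (1 + x) / k) ^ k"
      using that assms by (intro power_mono) auto
    also have "\<dots> \<le> exp (\<epsilon> * (1 + x))"
      using that assms \<open>0 < k\<close> by (intro exp_ge_one_plus_x_over_n_power_n) (auto intro: order_trans[of _ 0])
    finally have "(real k / \<epsilon>) ^ k * (\<epsilon> * (1 + x) / k) ^ k \<le> (real k / \<epsilon>) ^ k * exp (\<epsilon> * (1 + x))"
      using assms by (intro mult_left_mono) auto
    then have "(1 + x) ^ k \<le> (real k / \<epsilon>) ^ k * exp (\<epsilon> * (1 + x))"
      using assms \<open>0 < k\<close> by (simp add: power_mult_distrib[symmetric])
    then have "(1 + x) ^ k * exp (- \<epsilon> * x) \<le> (real k / \<epsilon>) ^ k * exp (\<epsilon> * (1 + x)) * exp (- \<epsilon> * x)"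
      by (rule mult_right_mono) simp
    also have "\<dots> = B"
      by (simp add: B_def mult.assoc exp_add[symmetric] algebra_simps)
    finally show ?thesis .
  qed
  show thesis
  proof
    fix x :: real assume "0 \<le> x"
    then have "(1 + x) ^ m * exp (- \<epsilon> * x) \<le> (1 + x) ^ k * exp (- \<epsilon> * x)"
      by (intro mult_right_mono power_increasing) (auto simp: k_def)
    also have "\<dots> \<le> B"
      using \<open>0 \<le> x\<close> by (rule B)
    finally show "(1 + x) ^ m * exp (- \<epsilon> * x) \<le> B" .
  qed
qed

text \<open>The comparison function is a product of one-dimensional functions 1 / (1 + x^2), so its
  integral factorises over the basis.\<close>

lemma integrable_rapid_decay:
  fixes f :: "'a::euclidean_space \<Rightarrow> real"
  assumes [measurable]: "f \<in> borel_measurable borel"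
    and "0 < \<epsilon>" and bound: "\<And>u. \<bar>f u\<bar> \<le> K * (1 + norm u) ^ m * exp (- \<epsilon> * norm u)"
  shows "integrable lborel f"
proof -
  let ?P = "\<lambda>u::'a. \<Prod>b\<in>Basis. inverse (1 + (u \<bullet> b)\<^sup>2)"
  \<comment> \<open>Each factor 1 + (u \<bullet> b)^2 is at most (1 + norm u)^2, so inserting all of
    them costs twice the dimension in powers.\<close>
  define k where "k = m + 2 * DIM('a)"
  obtain B where B: "\<And>x. 0 \<le> x \<Longrightarrow> (1 + x) ^ k * exp (- \<epsilon> * x) \<le> B"
    using power_mult_exp_bounded[OF \<open>0 < \<epsilon>\<close>] by blast
  have one: "(\<integral>\<^sup>+x. ennreal (inverse (1 + x\<^sup>2)) \<partial>lborel) < \<infinity>"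
    using integrable_inverse_1_plus_square
    by (simp add: set_integrable_def integrable_iff_bounded)
  have "(\<integral>\<^sup>+u. ennreal (?P u) \<partial>lborel) = (\<Prod>b\<in>(Basis::'a set). \<integral>\<^sup>+x. ennreal (inverse (1 + x\<^sup>2)) \<partial>lborel)"
    by (subst nn_integral_lborel_prod[symmetric]) (simp_all add: prod_ennreal add_nonneg_nonneg)
  also have "\<dots> < \<infinity>"
    using one by (simp add: power_less_top_ennreal)
  finally have P: "integrable lborel ?P"
    by (intro integrableI_nonneg) (auto intro!: prod_nonneg)
  show ?thesis
  proof (rule Bochner_Integration.integrable_bound[OF integrable_mult_right[OF P, of "\<bar>K\<bar> * B"]], simp, intro AE_I2)
    fix u :: 'a
    have "(\<Prod>b\<in>Basis. 1 + (u \<bullet> b)\<^sup>2) \<le> (\<Prod>b\<in>(Basis::'a set). (1 + norm u)\<^sup>2)"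
    proof (rule prod_mono, safe)
      fix b :: 'a assume "b \<in> Basis"
      then have "(u \<bullet> b)\<^sup>2 \<le> (norm u)\<^sup>2"
        using Basis_le_norm[of b u] by (simp add: abs_le_square_iff[symmetric])
      then show "1 + (u \<bullet> b)\<^sup>2 \<le> (1 + norm u)\<^sup>2"
        by (simp add: power2_sum add_increasing2)
    qed (simp add: add_nonneg_nonneg)
    also have "\<dots> = (1 + norm u) ^ (2 * DIM('a))"
      by (simp add: power_mult)
    finally have *: "(1 + norm u) ^ m * exp (- \<epsilon> * norm u) * (\<Prod>b\<in>Basis. 1 + (u \<bullet> b)\<^sup>2) \<le>
        (1 + norm u) ^ m * exp (- \<epsilon> * norm u) * (1 + norm u) ^ (2 * DIM('a))"
      by (intro mult_left_mono) auto
    also have "\<dots> \<le> B"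
      using B[of "norm u"] by (simp add: k_def power_add mult_ac)
    finally have "(1 + norm u) ^ m * exp (- \<epsilon> * norm u) \<le> B * ?P u"
      by (subst (asm) pos_le_divide_eq[symmetric])
        (auto intro!: prod_pos simp: add_pos_nonneg prod_inversef[symmetric] divide_inverse)
    then have "\<bar>K\<bar> * ((1 + norm u) ^ m * exp (- \<epsilon> * norm u)) \<le> \<bar>K\<bar> * (B * ?P u)"
      by (intro mult_left_mono) auto
    moreover have "\<bar>f u\<bar> \<le> \<bar>K\<bar> * ((1 + norm u) ^ m * exp (- \<epsilon> * norm u))"
      using bound[of u] mult_right_mono[OF abs_ge_self[of K], of "(1 + norm u) ^ m * exp (- \<epsilon> * norm u)"]
      by (simp add: mult_ac)
    ultimately show "norm (f u) \<le> norm (\<bar>K\<bar> * B * ?P u)"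
      by (simp add: mult.assoc)
  qed
qed

section \<open>Cones of symmetric matrices\<close>

lemma bounded_linear_mat_of_nth [bounded_linear]: "bounded_linear (\<lambda>u. mat_of u $ i $ j)"
proof -
  have "(\<lambda>u::'a symmat. mat_of u $ i $ j) = (\<lambda>u. inner u (symmat_unit {i, j} /\<^sub>R (if i = j then 1 else sqrt 2)))"
    by (auto simp: fun_eq_iff inner_symmat_unit)
  then show ?thesis
    by (metis bounded_linear_inner_left)
qed

lemma continuous_on_mat_of_nth [continuous_intros]:
  "continuous_on S f \<Longrightarrow> continuous_on S (\<lambda>x. mat_of (f x) $ i $ j)"
  by (rule bounded_linear.continuous_on[OF bounded_linear_mat_of_nth])

lemma abs_mat_of_nth_le_norm: "\<bar>mat_of u $ i $ j\<bar> \<le> norm u"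
proof -
  have "(mat_of u $ i $ j)\<^sup>2 \<le> (\<Sum>j\<in>UNIV. mat_of u $ i $ j * mat_of u $ i $ j)"
    unfolding power2_eq_square by (rule member_le_sum) auto
  also have "\<dots> \<le> inner u u"
    unfolding inner_symmat_sum
    by (rule member_le_sum[where f = "\<lambda>i. \<Sum>j\<in>UNIV. mat_of u $ i $ j * mat_of u $ i $ j"]) (auto intro: sum_nonneg)
  finally show ?thesis
    by (metis norm_symmat_def real_le_rsqrt real_sqrt_abs real_sqrt_le_mono)
qed

section \<open>Quadratic forms and the closed cone\<close>

definition quad_form :: "'n::finite symmat \<Rightarrow> real^'n \<Rightarrow> real"
  where "quad_form u x = x \<bullet> (mat_of u *v x)"

lemma quad_form_sum: "quad_form u x = (\<Sum>i\<in>UNIV. \<Sum>j\<in>UNIV. mat_of u $ i $ j * x $ i * x $ j)"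
  by (simp add: quad_form_def inner_vec_def matrix_vector_mult_def sum_distrib_left mult_ac)

lemma quad_form_linear [simp]:
  "quad_form (u + v) x = quad_form u x + quad_form v x"
  "quad_form (u - v) x = quad_form u x - quad_form v x"
  "quad_form (c *\<^sub>R u) x = c * quad_form u x"
  by (simp_all add: quad_form_sum algebra_simps sum.distrib sum_subtractf sum_distrib_left)

lemma quad_form_scaleR: "quad_form u (c *\<^sub>R x) = c\<^sup>2 * quad_form u x"
  by (simp add: quad_form_sum sum_distrib_left power2_eq_square mult_ac)

lemma quad_form_add_axis: "quad_form u (x + c *\<^sub>R axis i 1) = quad_form u x + 2 * c * (mat_of u *v x) $ i + c\<^sup>2 * mat_of u $ i $ i"
proof -
  have sym: "(axis i 1 :: real^'a) \<bullet> (mat_of u *v x) = x \<bullet> (mat_of u *v axis i 1)"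
    by (metis dot_lmul_matrix inner_commute transpose_mat_of vector_transpose_matrix)
  have "(mat_of u *v axis i 1) $ i = mat_of u $ i $ i"
    by (simp add: matrix_vector_mult_basis column_def)
  then show ?thesis
    using sym
    by (simp add: quad_form_def matrix_vector_right_distrib matrix_vector_mult_scaleR inner_add_left inner_add_right
        inner_axis inner_axis' power2_eq_square algebra_simps)
qed

text \<open>A crude bound, entry by entry; its factor n^2 reappears in the shift of
  \<open>shifted_id\<close>.\<close>

lemma abs_quad_form_le: "\<bar>quad_form u x\<bar> \<le> real CARD('n) ^ 2 * norm u * (norm x)\<^sup>2"
  for u :: "'n::finite symmat"
proof -
  have "\<bar>quad_form u x\<bar> \<le> (\<Sum>i\<in>UNIV. \<Sum>j\<in>UNIV. \<bar>mat_of u $ i $ j * x $ i * x $ j\<bar>)"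
    unfolding quad_form_sum by (rule order_trans[OF sum_abs sum_mono]) (rule sum_abs)
  also have "\<dots> \<le> (\<Sum>i\<in>(UNIV::'n set). \<Sum>j\<in>(UNIV::'n set). norm u * norm x * norm x)"
    unfolding abs_mult
    by (intro sum_mono mult_mono abs_mat_of_nth_le_norm component_le_norm_cart) auto
  finally show ?thesis
    by (simp add: power2_eq_square mult_ac)
qed

text \<open>With the complement of \<open>pd_cone\<close> this covers the space by two closed sets,
  along which the weight is glued continuously to 0.\<close>

definition psd_cone :: "'n::finite symmat set"
  where "psd_cone = {u. \<forall>x. 0 \<le> quad_form u x}"

lemma pd_cone_iff: "u \<in> pd_cone \<longleftrightarrow> (\<forall>x. x \<noteq> 0 \<longrightarrow> 0 < quad_form u x)"
  by (simp add: pd_cone_def quad_form_def)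

lemma quad_form_0_right [simp]: "quad_form u 0 = 0"
  by (simp add: quad_form_def)

lemma pd_cone_subset_psd_cone: "pd_cone \<subseteq> psd_cone"
proof
  fix u :: "'a symmat" assume "u \<in> pd_cone"
  then have "0 \<le> quad_form u x" for x
    by (cases "x = 0") (auto simp: pd_cone_iff intro: less_imp_le)
  then show "u \<in> psd_cone"
    by (simp add: psd_cone_def)
qed

lemma continuous_on_quad_form: "continuous_on UNIV (\<lambda>u. quad_form u x)"
  unfolding quad_form_sum by (intro continuous_intros)

lemma closed_psd_cone: "closed psd_cone"
proof -
  have eq: "(psd_cone :: 'a symmat set) = (\<Inter>x. {u. 0 \<le> quad_form u x})"
    by (auto simp: psd_cone_def)
  show ?thesis
    unfolding eq by (intro closed_INT ballI closed_Collect_le continuous_on_const continuous_on_quad_form)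
qed

lemma psd_add_pd: "u \<in> psd_cone \<Longrightarrow> v \<in> pd_cone \<Longrightarrow> u + v \<in> pd_cone"
  by (auto simp: pd_cone_iff psd_cone_def add_nonneg_pos)

lemma pd_add_pd: "u \<in> pd_cone \<Longrightarrow> v \<in> pd_cone \<Longrightarrow> u + v \<in> pd_cone"
  using psd_add_pd pd_cone_subset_psd_cone by blast

lemma pd_scaleR: "u \<in> pd_cone \<Longrightarrow> 0 < c \<Longrightarrow> c *\<^sub>R u \<in> pd_cone"
  by (auto simp: pd_cone_iff)

lemma psd_scaleR: "u \<in> psd_cone \<Longrightarrow> 0 \<le> c \<Longrightarrow> c *\<^sub>R u \<in> psd_cone"
  by (auto simp: psd_cone_def)

lemma convex_pd_cone: "convex pd_cone"
proof (rule convexI)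
  fix u v :: "'a symmat" and a b :: real
  assume "u \<in> pd_cone" "v \<in> pd_cone" "0 \<le> a" "0 \<le> b" "a + b = 1"
  then show "a *\<^sub>R u + b *\<^sub>R v \<in> pd_cone"
    by (cases "a = 0"; cases "b = 0") (auto intro!: pd_add_pd pd_scaleR)
qed

lemma pd_cone_coercive:
  assumes "u \<in> pd_cone"
  obtains m where "0 < m" "\<And>x. m * (norm x)\<^sup>2 \<le> quad_form u x"
proof -
  have "continuous_on (sphere 0 1) (quad_form u)"
    unfolding quad_form_sum by (intro continuous_intros)
  moreover have "sphere (0::real^'a) 1 \<noteq> {}"
    by (metis norm_axis_1 mem_sphere_0 empty_iff)
  ultimately obtain y where y: "y \<in> sphere 0 1" "\<And>x. x \<in> sphere 0 1 \<Longrightarrow> quad_form u y \<le> quad_form u x"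
    using continuous_attains_inf[OF compact_sphere] by blast
  show thesis
  proof
    show "0 < quad_form u y"
      using assms y(1) unfolding pd_cone_iff by (metis mem_sphere_0 norm_zero zero_neq_one)
    show "quad_form u y * (norm x)\<^sup>2 \<le> quad_form u x" for x
    proof (cases "x = 0")
      case False
      then have "quad_form u y \<le> quad_form u (x /\<^sub>R norm x)"
        by (intro y) simp
      then show ?thesis
        using False by (simp add: quad_form_scaleR field_simps power2_eq_square)
    qed simp
  qed
qed

lemma open_pd_cone: "open pd_cone"
  unfolding open_dist
proof safe
  fix u :: "'a symmat" assume "u \<in> pd_cone"
  then obtain m where m: "0 < m" "\<And>x. m * (norm x)\<^sup>2 \<le> quad_form u x"
    using pd_cone_coercive by blast
  let ?n = "real CARD('a) ^ 2"
  have n: "0 < ?n" by simp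
  show "\<exists>e>0. \<forall>y. dist y u < e \<longrightarrow> y \<in> pd_cone"
  proof (intro exI[of _ "m / ?n"] conjI allI impI)
    fix y assume "dist y u < m / ?n"
    then have *: "?n * norm (y - u) < m"
      using n by (simp add: dist_norm field_simps)
    show "y \<in> pd_cone"
      unfolding pd_cone_iff
    proof safe
      fix x :: "real^'a" assume "x \<noteq> 0"
      then have "?n * norm (y - u) * (norm x)\<^sup>2 < m * (norm x)\<^sup>2"
        using * by (intro mult_strict_right_mono) auto
      with abs_quad_form_le[of "y - u" x] m(2)[of x] show "0 < quad_form y x"
        by simp
    qed
  qed (use m in simp)
qed

lemma borel_pd_cone [measurable]: "pd_cone \<in> sets borel"
  using open_pd_cone by (rule borel_open)

definition id_symmat :: "'n::finite symmat"
  where "id_symmat = Abs_symmat (mat 1)"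

lemma mat_of_id_symmat [simp]: "mat_of id_symmat = mat 1"
  unfolding id_symmat_def by (rule mat_of_Abs) simp

lemma id_symmat_pd [simp]: "id_symmat \<in> pd_cone"
  by (simp add: pd_cone_def)

lemma pd_cone_nonempty: "pd_cone \<noteq> {}"
  using id_symmat_pd by blast

lemma inner_id_symmat: "inner u id_symmat = trace (mat_of u)" "inner id_symmat u = trace (mat_of u)"
  by (simp_all add: inner_symmat_def)

lemma psd_diag_nonneg: "u \<in> psd_cone \<Longrightarrow> 0 \<le> mat_of u $ i $ i"
  using quad_form_add_axis[of u 0 1 i] by (simp add: psd_cone_def) (metis matrix_vector_mult_0_right)

lemma psd_nth_bound:
  assumes "u \<in> psd_cone"
  shows "\<bar>mat_of u $ i $ j\<bar> \<le> trace (mat_of u)"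
proof -
  have diag: "mat_of u $ k $ k \<le> trace (mat_of u)" for k
    unfolding trace_def by (rule member_le_sum) (auto intro: psd_diag_nonneg assms)
  have axis: "quad_form u (axis i 1) = mat_of u $ i $ i" "(mat_of u *v axis i 1) $ j = mat_of u $ j $ i" for i j
    by (simp_all add: quad_form_def inner_axis' matrix_vector_mult_basis column_def)
  have "0 \<le> mat_of u $ i $ i + 2 * c * mat_of u $ i $ j + c\<^sup>2 * mat_of u $ j $ j" for c
    using assms quad_form_add_axis[of u "axis i 1" c j]
    by (metis (mono_tags, lifting) axis mat_of_nth_commute mem_Collect_eq psd_cone_def)
  \<comment> \<open>Testing with e_i + e_j and e_i - e_j gives 2 |u_ij| \<le> u_ii + u_jj.\<close>
  from this[of 1] this[of "-1"] show ?thesis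
    using diag[of i] diag[of j] by (simp add: abs_le_iff)
qed

lemma psd_norm_le_trace:
  fixes u :: "'n::finite symmat"
  assumes "u \<in> psd_cone"
  shows "norm u \<le> real CARD('n) * trace (mat_of u)"
proof -
  have "0 \<le> trace (mat_of u)"
    unfolding trace_def by (intro sum_nonneg psd_diag_nonneg assms)
  have "inner u u \<le> (\<Sum>i\<in>(UNIV::'n set). \<Sum>j\<in>(UNIV::'n set). (trace (mat_of u))\<^sup>2)"
    unfolding inner_symmat_sum power2_eq_square[symmetric]
    by (intro sum_mono power2_le_iff_abs_le[THEN iffD2] psd_nth_bound assms \<open>0 \<le> trace _\<close>)
  also have "\<dots> = (real CARD('n) * trace (mat_of u))\<^sup>2"
    by (simp add: power2_eq_square)
  finally show ?thesis
    unfolding norm_symmat_def by (rule real_le_lsqrt[rotated]) (use \<open>0 \<le> trace _\<close> in simp)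
qed

lemma psd_quad_form_eq_0:
  assumes "u \<in> psd_cone" "quad_form u x = 0"
  shows "mat_of u *v x = 0"
proof -
  have "(mat_of u *v x) $ i = 0" for i
  proof (rule ccontr)
    let ?y = "(mat_of u *v x) $ i" and ?d = "mat_of u $ i $ i"
    assume "?y \<noteq> 0"
    have d: "0 \<le> ?d"
      using assms(1) by (rule psd_diag_nonneg)
    \<comment> \<open>A semidefinite form is minimal at its zeros, so no step along axis i can lower
      it. The exact minimiser is - \<open>?y\<close> / \<open>?d\<close>; the added 1 keeps the
      quotient meaningful for a zero diagonal entry and still lowers the form.\<close>
    define c where "c = - ?y / (1 + ?d)"
    have "0 \<le> 2 * c * ?y + c\<^sup>2 * ?d"
      using assms quad_form_add_axis[of u x c i] by (simp add: psd_cone_def) (metis)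
    also have "\<dots> = - (?y\<^sup>2 * (2 + ?d) / (1 + ?d)\<^sup>2)"
      using d by (simp add: c_def divide_simps power2_eq_square) algebra
    also have "\<dots> < 0"
      using d \<open>?y \<noteq> 0\<close> by simp
    finally show False by simp
  qed
  then show ?thesis
    by (simp add: vec_eq_iff)
qed

text \<open>Read contrapositively: the determinant vanishes on the boundary of the cone, so its
  positive powers extend continuously by 0.\<close>

lemma psd_det_nonzero_imp_pd:
  assumes "u \<in> psd_cone" "det (mat_of u) \<noteq> 0"
  shows "u \<in> pd_cone"
  unfolding pd_cone_iff
proof safe
  fix x :: "real^'a" assume "x \<noteq> 0"
  have "quad_form u x \<noteq> 0"
  proof
    assume "quad_form u x = 0"
    with assms(1) have "mat_of u *v x = 0"
      by (rule psd_quad_form_eq_0)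
    moreover have "invertible (mat_of u)"
      using assms(2) by (simp add: invertible_det_nz)
    ultimately show False
      using \<open>x \<noteq> 0\<close> by (metis invertible_left_inverse matrix_left_invertible_ker)
  qed
  with assms(1) show "0 < quad_form u x"
    by (auto simp: psd_cone_def order_less_le)
qed

lemma continuous_on_det_mat_of [continuous_intros]:
  "continuous_on S f \<Longrightarrow> continuous_on S (\<lambda>x. det (mat_of (f x)))"
  unfolding det_def by (intro continuous_intros)

lemma pd_det_nonzero: "u \<in> pd_cone \<Longrightarrow> det (mat_of u) \<noteq> 0"
  using mat_of_symmat_inv(2)[of u] by (metis det_I det_mul mult_zero_left zero_neq_one)

text \<open>The determinant has no zero on the cone, which is convex and hence connected, and it is
  1 at the identity.\<close>

lemma pd_det_pos:
  assumes "u \<in> pd_cone"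
  shows "0 < det (mat_of u)"
proof (rule ccontr)
  assume neg: "\<not> ?thesis"
  have "connected ((\<lambda>u. det (mat_of u)) ` (pd_cone :: 'a symmat set))"
    by (intro connected_continuous_image continuous_intros convex_connected convex_pd_cone)
  moreover have "1 \<in> (\<lambda>u. det (mat_of u)) ` (pd_cone :: 'a symmat set)"
    by (rule image_eqI[of _ _ id_symmat]) simp_all
  ultimately have "0 \<in> (\<lambda>u. det (mat_of u)) ` (pd_cone :: 'a symmat set)"
    using assms neg by (auto intro: connectedD_interval[of _ "det (mat_of u)" 1])
  then show False
    by (auto dest: pd_det_nonzero)
qed

text \<open>Pivoting: subtracting the rank one matrix of a row with positive diagonal entry clears that row.\<close>

lemma psd_inner_nonneg:
  assumes "t \<in> psd_cone" "u \<in> psd_cone"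
  shows "0 \<le> inner t u"
  using assms(2)
proof (induction "card {i. mat_of u $ i $ i \<noteq> 0}" arbitrary: u rule: less_induct)
  \<comment> \<open>This is the self-duality of the closed cone. The induction counts nonzero
    diagonal entries; if there are none, the trace is 0 and \<open>psd_norm_le_trace\<close> forces
    u = 0.\<close>
  case less
  show ?case
  proof (cases "\<exists>i. mat_of u $ i $ i \<noteq> 0")
    case False
    then have "trace (mat_of u) = 0"
      by (simp add: trace_def)
    then show ?thesis
      using psd_norm_le_trace[OF less.prems] by simp
  next
    case True
    then obtain i where i: "mat_of u $ i $ i \<noteq> 0" by blast
    let ?d = "mat_of u $ i $ i"
    have d: "0 < ?d"
      using psd_diag_nonneg[OF less.prems, of i] i by simp
    define y where "y = (\<chi> k. mat_of u $ i $ k)"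
    define z where "z = Abs_symmat (\<chi> k l. y $ k * y $ l / ?d)"
    have z: "mat_of z = (\<chi> k l. y $ k * y $ l / ?d)"
      unfolding z_def by (rule mat_of_Abs) (simp add: transpose_def mult.commute)
    have uy: "(mat_of u *v x) $ i = x \<bullet> y" for x
      by (simp add: y_def matrix_vector_mult_def inner_vec_def mult.commute)
    have qz: "quad_form z x = (x \<bullet> y)\<^sup>2 / ?d" for x
      by (simp add: quad_form_sum z inner_vec_def power2_eq_square sum_product sum_divide_distrib mult_ac)
    have "0 \<le> quad_form (u - z) x" for x
    proof -
      \<comment> \<open>Completing the square along axis i: the coefficient minimises the form, and
        the minimum is the form of the Schur complement u - z.\<close>
      have "0 \<le> quad_form u (x + (- (x \<bullet> y) / ?d) *\<^sub>R axis i 1)"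
        using less.prems by (simp add: psd_cone_def)
      also have "\<dots> = quad_form (u - z) x"
        using d by (simp only: quad_form_add_axis uy) (simp add: qz field_simps power2_eq_square)
      finally show ?thesis .
    qed
    then have psd: "u - z \<in> psd_cone"
      by (simp add: psd_cone_def del: quad_form_linear)
    have "{k. mat_of (u - z) $ k $ k \<noteq> 0} \<subset> {k. mat_of u $ k $ k \<noteq> 0}"
    proof
      show "{k. mat_of (u - z) $ k $ k \<noteq> 0} \<subseteq> {k. mat_of u $ k $ k \<noteq> 0}"
      proof safe
        fix k assume *: "mat_of (u - z) $ k $ k \<noteq> 0" "mat_of u $ k $ k = 0"
        have "0 \<le> (y $ k)\<^sup>2 / ?d" using d by simp
        moreover have "0 \<le> mat_of (u - z) $ k $ k"
          using psd by (rule psd_diag_nonneg)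
        ultimately show False
          using * by (simp add: z power2_eq_square)
      qed
      have "mat_of (u - z) $ i $ i = 0"
        using d by (simp add: z y_def)
      then show "{k. mat_of (u - z) $ k $ k \<noteq> 0} \<noteq> {k. mat_of u $ k $ k \<noteq> 0}"
        using i by blast
    qed
    then have "0 \<le> inner t (u - z)"
      by (intro less.hyps psd psubset_card_mono) auto
    moreover have "inner t z = quad_form t y / ?d"
      by (simp add: inner_symmat_sum z quad_form_sum sum_divide_distrib mult_ac)
    then have "0 \<le> inner t z"
      using assms(1) d by (simp add: psd_cone_def)
    ultimately show ?thesis
      by (simp add: inner_diff_right)
  qed
qed

text \<open>With m the coercivity constant, t - m I is semidefinite, so pairing t with u gives at
  least m times the trace of u, which controls the norm. Thus exp (- inner t u) decays exponentially
  on the cone.\<close>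

lemma pd_inner_ge_norm:
  assumes "t \<in> pd_cone"
  obtains \<epsilon> where "0 < \<epsilon>" "\<And>u. u \<in> psd_cone \<Longrightarrow> \<epsilon> * norm u \<le> inner t u"
proof -
  obtain m where m: "0 < m" "\<And>x. m * (norm x)\<^sup>2 \<le> quad_form t x"
    using pd_cone_coercive[OF assms] by blast
  have "quad_form id_symmat x = (norm x)\<^sup>2" for x :: "real^'a"
    by (simp add: quad_form_def power2_norm_eq_inner)
  then have psd: "t - m *\<^sub>R id_symmat \<in> psd_cone"
    using m(2) by (simp add: psd_cone_def)
  show thesis
  proof
    show "0 < m / CARD('a)"
      using m by simp
    fix u :: "'a symmat" assume u: "u \<in> psd_cone"
    have "0 \<le> inner (t - m *\<^sub>R id_symmat) u"
      using psd u by (rule psd_inner_nonneg)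
    then have "m * trace (mat_of u) \<le> inner t u"
      by (simp add: inner_diff_left inner_id_symmat)
    moreover have "m / CARD('a) * norm u \<le> m / CARD('a) * (CARD('a) * trace (mat_of u))"
      using m by (intro mult_left_mono psd_norm_le_trace u) auto
    ultimately show "m / CARD('a) * norm u \<le> inner t u"
      by simp
  qed
qed

section \<open>Determinant and inverse\<close>

text \<open>Only the identity permutation of the Leibniz expansion contributes: any other one moves
  at least two points, so a zero factor remains after one factor has been differentiated.\<close>

lemma has_derivative_det_at_id: "(det has_derivative trace) (at (mat 1 :: real^'n::finite^'n))"
proof -
  let ?P = "{p. p permutes (UNIV :: 'n set)}"
  let ?c = "\<lambda>p i. \<Prod>j\<in>UNIV - {i}. (mat 1 :: real^'n^'n) $ j $ p j"
  have fin: "finite ?P"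
    by (simp add: finite_permutations)
  have "((\<lambda>A. \<Prod>i\<in>UNIV. A $ i $ p i) has_derivative (\<lambda>h. \<Sum>i\<in>UNIV. h $ i $ p i * ?c p i)) (at (mat 1 :: real^'n^'n))" for p
    by (rule has_derivative_prod)
      (intro bounded_linear_imp_has_derivative bounded_linear_compose[OF bounded_linear_vec_nth bounded_linear_vec_nth])
  then have "(det has_derivative (\<lambda>h. \<Sum>p\<in>?P. of_int (sign p) * (\<Sum>i\<in>UNIV. h $ i $ p i * ?c p i))) (at (mat 1 :: real^'n^'n))"
    unfolding det_def[abs_def] by (intro has_derivative_sum has_derivative_mult_right)
  also have "(\<lambda>h. \<Sum>p\<in>?P. of_int (sign p) * (\<Sum>i\<in>UNIV. h $ i $ p i * ?c p i)) = trace"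
  proof
    fix h :: "real^'n^'n"
    have c0: "?c p i = 0" if p: "p \<in> ?P - {id}" for p i
    proof -
      obtain k where k: "p k \<noteq> k"
        using p by (auto simp: fun_eq_iff)
      have "p (p k) \<noteq> p k"
        using k p by (metis DiffD1 mem_Collect_eq permutes_inj injD)
      then obtain j where "j \<noteq> i" "p j \<noteq> j"
        using k by metis
      then show ?thesis
        by (intro prod_zero) (auto simp: mat_def intro!: bexI[of _ j])
    qed
    have "(\<Sum>p\<in>?P. of_int (sign p) * (\<Sum>i\<in>UNIV. h $ i $ p i * ?c p i)) =
        (\<Sum>p\<in>{id}. of_int (sign p) * (\<Sum>i\<in>UNIV. h $ i $ p i * ?c p i))"
    proof (intro sum.mono_neutral_right fin ballI)
      fix p assume "p \<in> ?P - {id}"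
      then show "of_int (sign p) * (\<Sum>i\<in>UNIV. h $ i $ p i * ?c p i) = 0"
        by (simp only: c0 mult_zero_right sum.neutral_const)
    qed (simp add: permutes_id)
    also have "\<dots> = trace h"
      by (simp add: trace_def sign_id mat_def)
    finally show "(\<Sum>p\<in>?P. of_int (sign p) * (\<Sum>i\<in>UNIV. h $ i $ p i * ?c p i)) = trace h" .
  qed
  finally show ?thesis .
qed

lemma symmat_inv_mult:
  assumes "u \<in> pd_cone"
  shows "mat_of u ** mat_of (symmat_inv u) = mat 1" "mat_of (symmat_inv u) ** mat_of u = mat 1"
  using mat_of_symmat_inv(2)[OF assms] by (simp_all add: matrix_left_right_inverse)

lemma symmat_inv_pd:
  assumes "u \<in> pd_cone"
  shows "symmat_inv u \<in> pd_cone"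
  unfolding pd_cone_def
proof safe
  fix x :: "real^'a" assume "x \<noteq> 0"
  let ?y = "mat_of (symmat_inv u) *v x"
  have x: "mat_of u *v ?y = x"
    using symmat_inv_mult(1)[OF assms] by (simp add: matrix_vector_mul_assoc)
  with \<open>x \<noteq> 0\<close> have "?y \<noteq> 0"
    by (metis matrix_vector_mult_0_right)
  then have "0 < ?y \<bullet> (mat_of u *v ?y)"
    using assms by (simp add: pd_cone_def)
  then show "0 < x \<bullet> ?y"
    unfolding x by (simp add: inner_commute)
qed

lemma symmat_inv_nth_bound: "u \<in> pd_cone \<Longrightarrow> \<bar>mat_of (symmat_inv u) $ i $ j\<bar> \<le> trace (mat_of (symmat_inv u))"
  using symmat_inv_pd pd_cone_subset_psd_cone psd_nth_bound by blast

text \<open>Jacobi's formula, reduced to the identity matrix by factoring w = u (u^-1 w).\<close>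

lemma has_derivative_det_mat_of:
  assumes "u \<in> pd_cone"
  shows "((\<lambda>w. det (mat_of w)) has_derivative (\<lambda>h. det (mat_of u) * inner (symmat_inv u) h)) (at u)"
proof -
  let ?L = "\<lambda>w. mat_of (symmat_inv u) ** mat_of w"
  have "linear ?L"
    by (rule linearI) (simp_all add: vec_eq_iff matrix_matrix_mult_def algebra_simps sum.distrib sum_distrib_left)
  then have "(?L has_derivative ?L) (at u)"
    by (simp add: linear_conv_bounded_linear bounded_linear_imp_has_derivative)
  moreover have "(det has_derivative trace) (at (?L u))"
    using has_derivative_det_at_id symmat_inv_mult(2)[OF assms] by simp
  ultimately have "((\<lambda>w. det (?L w)) has_derivative (\<lambda>h. trace (?L h))) (at u)"
    by (rule has_derivative_compose)
  then have "((\<lambda>w. det (mat_of u) * det (?L w)) has_derivative (\<lambda>h. det (mat_of u) * trace (?L h))) (at u)"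
    by (rule has_derivative_mult_right)
  moreover have "det (mat_of u) * det (?L w) = det (mat_of w)" for w
    unfolding det_mul[symmetric] using symmat_inv_mult(1)[OF assms] by (simp add: matrix_mul_assoc)
  ultimately show ?thesis
    by (simp add: inner_symmat_def)
qed

lemma has_real_derivative_det_line:
  assumes "u \<in> pd_cone"
  shows "((\<lambda>t. det (mat_of (u + t *\<^sub>R v))) has_real_derivative det (mat_of u) * inner (symmat_inv u) v) (at 0)"
proof -
  have "((\<lambda>t. u + t *\<^sub>R v) has_derivative (\<lambda>t. t *\<^sub>R v)) (at 0)"
    by (auto intro!: derivative_eq_intros)
  moreover have "((\<lambda>w. det (mat_of w)) has_derivative (\<lambda>h. det (mat_of u) * inner (symmat_inv u) h)) (at (u + 0 *\<^sub>R v))"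
    using has_derivative_det_mat_of[OF assms] by simp
  ultimately have "((\<lambda>t. det (mat_of (u + t *\<^sub>R v))) has_derivative (\<lambda>t. det (mat_of u) * inner (symmat_inv u) (t *\<^sub>R v))) (at 0)"
    by (rule has_derivative_compose)
  then show ?thesis
    by (rule has_derivative_imp_has_field_derivative) simp
qed

text \<open>The adjugate entry in the form of Cramer's rule: a polynomial in the entries, hence
  continuous and of polynomial growth on the whole space, while \<open>symmat_inv\<close> is
  controlled only on the cone.\<close>

definition adj_nth :: "'n::finite symmat \<Rightarrow> 'n \<Rightarrow> 'n \<Rightarrow> real"
  where "adj_nth u k l = det (\<chi> i j. if j = k then axis l 1 $ i else mat_of u $ i $ j)"

lemma adj_nth_eq:
  assumes "u \<in> pd_cone"
  shows "adj_nth u k l = det (mat_of u) * mat_of (symmat_inv u) $ k $ l"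
proof -
  let ?x = "mat_of (symmat_inv u) *v axis l 1"
  have "mat_of u *v ?x = axis l 1"
    using symmat_inv_mult(1)[OF assms] by (simp add: matrix_vector_mul_assoc)
  then have "?x = (\<chi> k. det (\<chi> i j. if j = k then axis l 1 $ i else mat_of u $ i $ j) / det (mat_of u))"
    by (subst (asm) cramer[OF pd_det_nonzero[OF assms]])
  then have "?x $ k = adj_nth u k l / det (mat_of u)"
    by (simp add: adj_nth_def)
  moreover have "?x $ k = mat_of (symmat_inv u) $ k $ l"
    by (simp add: matrix_vector_mult_basis column_def)
  ultimately show ?thesis
    using pd_det_nonzero[OF assms] by simp
qed

lemma symmat_inv_nth_eq:
  "u \<in> pd_cone \<Longrightarrow> mat_of (symmat_inv u) $ k $ l = adj_nth u k l / det (mat_of u)"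
  by (simp add: adj_nth_eq pd_det_nonzero)

lemma continuous_on_adj_nth: "continuous_on S (\<lambda>u. adj_nth u k l)"
proof -
  have *: "continuous_on S (\<lambda>u. if P then c else mat_of u $ i $ j)" for P c i j
    by (cases P) (auto intro!: continuous_intros)
  show ?thesis
    unfolding adj_nth_def det_def by (simp, intro continuous_intros *)
qed

lemma abs_det_le:
  fixes A :: "real^'n::finite^'n"
  assumes "\<And>i j. \<bar>A $ i $ j\<bar> \<le> K"
  shows "\<bar>det A\<bar> \<le> fact CARD('n) * K ^ CARD('n)"
proof -
  have "\<bar>det A\<bar> \<le> (\<Sum>p\<in>{p. p permutes (UNIV::'n set)}. \<bar>of_int (sign p) * (\<Prod>i\<in>UNIV. A $ i $ p i)\<bar>)"
    unfolding det_def by (rule sum_abs)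
  also have "\<dots> \<le> (\<Sum>p\<in>{p. p permutes (UNIV::'n set)}. K ^ CARD('n))"
  proof (rule sum_mono)
    fix p :: "'n \<Rightarrow> 'n"
    have "(\<Prod>i\<in>UNIV. \<bar>A $ i $ p i\<bar>) \<le> (\<Prod>i\<in>(UNIV::'n set). K)"
      by (intro prod_mono) (simp add: assms)
    then show "\<bar>of_int (sign p) * (\<Prod>i\<in>UNIV. A $ i $ p i)\<bar> \<le> K ^ CARD('n)"
      by (simp add: abs_mult abs_prod sign_def)
  qed
  also have "\<dots> = fact CARD('n) * K ^ CARD('n)"
    by (simp add: card_permutations[OF refl])
  finally show ?thesis .
qed

lemma abs_adj_nth_le: "\<bar>adj_nth u k l\<bar> \<le> fact CARD('n) * (1 + norm u) ^ CARD('n)"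
  for u :: "'n::finite symmat"
  unfolding adj_nth_def
  by (rule abs_det_le) (auto simp: axis_def intro: order_trans[OF abs_mat_of_nth_le_norm])

lemma abs_det_mat_of_le: "\<bar>det (mat_of u)\<bar> \<le> fact CARD('n) * (1 + norm u) ^ CARD('n)"
  for u :: "'n::finite symmat"
  by (rule abs_det_le) (auto intro: order_trans[OF abs_mat_of_nth_le_norm])

lemma continuous_on_symmat_inv_nth: "continuous_on pd_cone (\<lambda>u. mat_of (symmat_inv u) $ k $ l)"
proof -
  have "continuous_on pd_cone (\<lambda>u. adj_nth u k l / det (mat_of u))"
    by (intro continuous_intros continuous_on_adj_nth) (simp add: pd_det_nonzero)
  then show ?thesis
    by (simp cong: continuous_on_cong add: symmat_inv_nth_eq)
qed

text \<open>The identity w^-1 (w - u) u^-1 = u^-1 - w^-1 evaluates the difference quotient exactly;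
  continuity of the inverse gives the limit.\<close>

lemma has_real_derivative_symmat_inv_nth_line:
  assumes u: "u \<in> pd_cone"
  shows "((\<lambda>t. mat_of (symmat_inv (u + t *\<^sub>R v)) $ i $ j) has_real_derivative
    - (mat_of (symmat_inv u) ** mat_of v ** mat_of (symmat_inv u)) $ i $ j) (at 0)"
proof -
  let ?r = "\<lambda>u. mat_of (symmat_inv u)"
  have tend: "((\<lambda>h::real. u + h *\<^sub>R v) \<longlongrightarrow> u) (at 0)"
    by (auto intro!: tendsto_eq_intros)
  then have ev: "eventually (\<lambda>h. u + h *\<^sub>R v \<in> pd_cone) (at 0)"
    using topological_tendstoD[OF _ open_pd_cone u] by blast
  have r: "((\<lambda>h. ?r (u + h *\<^sub>R v) $ k $ l) \<longlongrightarrow> ?r u $ k $ l) (at 0)" for k l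
    by (rule isCont_tendsto_compose[OF _ tend])
      (use continuous_on_symmat_inv_nth u open_pd_cone continuous_on_eq_continuous_at in blast)
  have "((\<lambda>h. - (?r (u + h *\<^sub>R v) ** mat_of v ** ?r u) $ i $ j) \<longlongrightarrow> - (?r u ** mat_of v ** ?r u) $ i $ j) (at 0)"
    unfolding matrix_matrix_mult_def by (simp, intro tendsto_intros r)
  moreover have "eventually (\<lambda>h. - (?r (u + h *\<^sub>R v) ** mat_of v ** ?r u) $ i $ j =
      (?r (u + (0 + h) *\<^sub>R v) $ i $ j - ?r (u + 0 *\<^sub>R v) $ i $ j) / h) (at 0)"
    using ev eventually_neq_at_within[of 0 0 UNIV]
  proof eventually_elim
    case (elim h)
    let ?w = "u + h *\<^sub>R v"
    have diff: "A ** (B - C) ** E = A ** B ** E - A ** C ** E" for A B C E :: "real^'a^'a"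
      by (simp add: vec_eq_iff matrix_matrix_mult_def algebra_simps sum_subtractf sum_distrib_left sum_distrib_right)
    have "h *\<^sub>R (?r ?w ** mat_of v ** ?r u) = ?r ?w ** (mat_of ?w - mat_of u) ** ?r u"
      by (simp add: scalar_matrix_assoc[symmetric] matrix_scalar_ac)
    also have "\<dots> = ?r u - ?r ?w"
      unfolding diff symmat_inv_mult(2)[OF elim(1)]
      by (simp add: matrix_mul_assoc[symmetric] symmat_inv_mult[OF u])
    finally have "h * (?r ?w ** mat_of v ** ?r u) $ i $ j = ?r u $ i $ j - ?r ?w $ i $ j"
      by (metis vector_minus_component vector_scaleR_component real_scaleR_def)
    then show ?case
      using elim by (simp add: field_simps)
  qed
  ultimately show ?thesis
    unfolding DERIV_def by (rule Lim_transform_eventually)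
qed

section \<open>The Wishart weight\<close>

abbreviation inv_nth :: "'n::finite symmat \<Rightarrow> 'n \<Rightarrow> 'n \<Rightarrow> real"
  where "inv_nth u i j \<equiv> mat_of (symmat_inv u) $ i $ j"

text \<open>The parameter \<open>a\<close> is the exponent of the determinant, that is the shape
  minus (n + 1) / 2, and \<open>t\<close> is the inverse of the scale matrix. Extension by 0 lets
  every integral run over the whole space.\<close>

definition wishart_weight :: "real \<Rightarrow> 'n::finite symmat \<Rightarrow> 'n symmat \<Rightarrow> real"
  where "wishart_weight a t u = (if u \<in> pd_cone then det (mat_of u) powr a * exp (- inner t u) else 0)"

lemma wishart_weight_nonneg: "0 \<le> wishart_weight a t u"
  by (simp add: wishart_weight_def)

lemma wishart_weight_pos: "u \<in> pd_cone \<Longrightarrow> 0 < wishart_weight a t u"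
  using pd_det_pos[of u] by (simp add: wishart_weight_def)

lemma wishart_weight_outside: "u \<notin> pd_cone \<Longrightarrow> wishart_weight a t u = 0"
  by (simp add: wishart_weight_def)

text \<open>One factor of the inverse is traded for one power of the determinant. Both sides are 0
  off the cone, so the right side supplies measurability, growth bounds and, for a > 1, continuity
  on the whole space.\<close>

lemma inv_nth_mult_weight: "inv_nth u i j * wishart_weight a t u = adj_nth u i j * wishart_weight (a - 1) t u"
proof (cases "u \<in> pd_cone")
  case True
  with pd_det_pos[OF this] show ?thesis
    by (simp add: wishart_weight_def symmat_inv_nth_eq powr_diff)
qed (simp add: wishart_weight_def)

lemma borel_measurable_mat_of_nth [measurable]: "(\<lambda>u. mat_of u $ i $ j) \<in> borel_measurable borel"
  by (intro borel_measurable_continuous_onI continuous_intros)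

lemma borel_measurable_det_mat_of [measurable]: "(\<lambda>u. det (mat_of u)) \<in> borel_measurable borel"
  by (intro borel_measurable_continuous_onI continuous_intros)

lemma borel_measurable_adj_nth [measurable]: "(\<lambda>u. adj_nth u i j) \<in> borel_measurable borel"
  by (intro borel_measurable_continuous_onI continuous_on_adj_nth)

lemma borel_measurable_wishart_weight [measurable]: "wishart_weight a t \<in> borel_measurable borel"
  unfolding wishart_weight_def[abs_def] by measurable

text \<open>For a > 0 the formula gives 0 on semidefinite matrices outside the open cone, since 0
  powr a = 0; it therefore agrees with the zero extension where the two closed sets overlap.\<close>

lemma continuous_on_mult_wishart_weight:
  assumes "continuous_on UNIV \<phi>" "0 < a"
  shows "continuous_on UNIV (\<lambda>u. \<phi> u * wishart_weight a t u)"
proof -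
  have det0: "det (mat_of u) = 0" if "u \<in> psd_cone" "u \<notin> pd_cone" for u :: "'a symmat"
    using that psd_det_nonzero_imp_pd by blast
  have "continuous_on psd_cone (\<lambda>u. det (mat_of u) powr a * exp (- inner t u))"
    using pd_det_pos det0 \<open>0 < a\<close>
    by (intro continuous_intros continuous_on_powr') (fastforce intro: less_imp_le)+
  then have "continuous_on psd_cone (wishart_weight a t)"
    by (rule continuous_on_eq) (auto simp: wishart_weight_def det0)
  moreover have "continuous_on (- pd_cone) (\<lambda>u::'a symmat. 0::real)"
    by simp
  then have "continuous_on (- pd_cone) (wishart_weight a t)"
    by (rule continuous_on_eq) (simp add: wishart_weight_def)
  ultimately have "continuous_on (psd_cone \<union> - pd_cone) (wishart_weight a t)"
    by (intro continuous_on_closed_Un closed_psd_cone) (simp_all add: closed_Compl open_pd_cone)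
  also have "psd_cone \<union> - pd_cone = (UNIV :: 'a symmat set)"
    using pd_cone_subset_psd_cone by blast
  finally show ?thesis
    using assms by (intro continuous_intros)
qed

section \<open>Integrability against the weight\<close>

lemma abs_power_bound_mult:
  fixes f g :: "'a::real_normed_vector \<Rightarrow> real"
  assumes "\<bar>f u\<bar> \<le> K * (1 + norm u) ^ m" "\<bar>g u\<bar> \<le> L * (1 + norm u) ^ k"
  shows "\<bar>f u * g u\<bar> \<le> K * L * (1 + norm u) ^ (m + k)"
proof -
  have "\<bar>f u\<bar> * \<bar>g u\<bar> \<le> (K * (1 + norm u) ^ m) * (L * (1 + norm u) ^ k)"
    using assms by (intro mult_mono) (auto intro: order_trans[OF abs_ge_zero])
  then show ?thesis
    by (simp add: abs_mult power_add mult_ac)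
qed

lemma integrable_mult_wishart_weight:
  fixes \<phi> :: "'n::finite symmat \<Rightarrow> real"
  assumes [measurable]: "\<phi> \<in> borel_measurable borel"
    and \<phi>: "\<And>u. \<bar>\<phi> u\<bar> \<le> K * (1 + norm u) ^ m" and "0 \<le> a" and t: "t \<in> pd_cone"
  shows "integrable lborel (\<lambda>u. \<phi> u * wishart_weight a t u)"
proof -
  obtain \<epsilon> where \<epsilon>: "0 < \<epsilon>" "\<And>u. u \<in> psd_cone \<Longrightarrow> \<epsilon> * norm u \<le> inner t u"
    using pd_inner_ge_norm[OF t] by blast
  let ?F = "fact CARD('n) :: real" and ?k = "nat \<lceil>a\<rceil>"
  have "0 \<le> K"
    using \<phi>[of 0] by simp
  have bound: "\<bar>\<phi> u * wishart_weight a t u\<bar> \<le> K * ?F ^ ?k * (1 + norm u) ^ (m + CARD('n) * ?k) * exp (- \<epsilon> * norm u)" for u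
  proof (cases "u \<in> pd_cone")
    case True
    \<comment> \<open>The bound for the determinant is at least 1, so its exponent may be rounded up
      from a to the integer \<open>?k\<close>.\<close>
    have "1 \<le> ?F * (1 + norm u) ^ CARD('n)"
      using mult_mono[of 1 ?F 1 "(1 + norm u) ^ CARD('n)"] by (simp add: fact_ge_1)
    then have "det (mat_of u) powr a \<le> (?F * (1 + norm u) ^ CARD('n)) ^ ?k"
      using \<open>0 \<le> a\<close> pd_det_pos[OF True] abs_det_mat_of_le[of u]
      by (subst powr_realpow[symmetric], simp)
        (rule order_trans[OF powr_mono2 powr_mono], auto)
    also have "\<dots> = ?F ^ ?k * (1 + norm u) ^ (CARD('n) * ?k)"
      by (simp add: power_mult_distrib power_mult)
    finally have d: "\<bar>det (mat_of u) powr a\<bar> \<le> ?F ^ ?k * (1 + norm u) ^ (CARD('n) * ?k)"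
      by simp
    have "\<bar>\<phi> u * det (mat_of u) powr a\<bar> * exp (- inner t u) \<le>
        (K * ?F ^ ?k * (1 + norm u) ^ (m + CARD('n) * ?k)) * exp (- \<epsilon> * norm u)"
      using abs_power_bound_mult[of \<phi> u K m "\<lambda>u. det (mat_of u) powr a", OF \<phi> d] \<epsilon>(2)[of u] True pd_cone_subset_psd_cone \<open>0 \<le> K\<close>
      by (intro mult_mono) auto
    then show ?thesis
      using True by (simp add: wishart_weight_def abs_mult mult_ac)
  next
    case False
    then show ?thesis
      using \<open>0 \<le> K\<close> by (simp add: wishart_weight_def)
  qed
  show ?thesis
    by (rule integrable_rapid_decay[OF _ \<epsilon>(1) bound]) measurable
qed

lemma has_real_derivative_wishart_weight_line:
  assumes u: "u \<in> pd_cone"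
  shows "((\<lambda>s. wishart_weight a t (u + s *\<^sub>R v)) has_real_derivative
    (a * inner (symmat_inv u) v - inner t v) * wishart_weight a t u) (at 0)"
proof -
  let ?D = "det (mat_of u)"
  have D: "0 < ?D" using u by (rule pd_det_pos)
  have "((\<lambda>s. det (mat_of (u + s *\<^sub>R v)) powr a) has_real_derivative
      a * ?D powr (a - 1) * (?D * inner (symmat_inv u) v)) (at 0)"
    using DERIV_fun_powr[OF has_real_derivative_det_line[OF u, of v], of a] D by simp
  moreover have "((\<lambda>s. exp (- inner t (u + s *\<^sub>R v))) has_real_derivative exp (- inner t u) * - inner t v) (at 0)"
    by (auto intro!: derivative_eq_intros simp: inner_add_right)
  ultimately have "((\<lambda>s. det (mat_of (u + s *\<^sub>R v)) powr a * exp (- inner t (u + s *\<^sub>R v))) has_real_derivative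
      a * ?D powr (a - 1) * (?D * inner (symmat_inv u) v) * exp (- inner t u) + exp (- inner t u) * - inner t v * ?D powr a) (at 0)"
    by (rule DERIV_mult'[THEN DERIV_cong]) simp
  moreover have "?D powr a = ?D powr (a - 1) * ?D"
    using D by (simp add: powr_diff)
  then have "a * ?D powr (a - 1) * (?D * inner (symmat_inv u) v) * exp (- inner t u) + exp (- inner t u) * - inner t v * ?D powr a =
      (a * inner (symmat_inv u) v - inner t v) * wishart_weight a t u"
    using u by (simp add: wishart_weight_def algebra_simps)
  ultimately have "((\<lambda>s. det (mat_of (u + s *\<^sub>R v)) powr a * exp (- inner t (u + s *\<^sub>R v))) has_real_derivative
      (a * inner (symmat_inv u) v - inner t v) * wishart_weight a t u) (at 0)"
    by simp
  then show ?thesis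
  proof (rule has_field_derivative_transform_within_open)
    show "open ((\<lambda>s. u + s *\<^sub>R v) -` pd_cone)"
      by (intro open_vimage open_pd_cone continuous_intros)
  qed (use u in \<open>auto simp: wishart_weight_def\<close>)
qed

text \<open>For a < 1 the factor det^(a - 1) hidden in the integrand is unbounded near the boundary,
  and growth estimates do not apply. The trace of the inverse is nonnegative, so the sign argument
  of \<open>integrable_directional_derivative\<close> does, with k the trace of t.\<close>

lemma integrable_trace_inv_mult_weight:
  fixes t :: "'n::finite symmat"
  assumes "0 < a" and t: "t \<in> pd_cone"
  shows "integrable lborel (\<lambda>u. trace (mat_of (symmat_inv u)) * wishart_weight a t u)"
proof -
  have eq: "a * trace (mat_of (symmat_inv u)) * wishart_weight a t u =
      a * (\<Sum>i\<in>UNIV. adj_nth u i i * wishart_weight (a - 1) t u)" for u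
    by (simp add: trace_def sum_distrib_right mult.assoc inv_nth_mult_weight)
  have psd: "psd_cone \<supseteq> (pd_cone :: 'n symmat set)"
    by (rule pd_cone_subset_psd_cone)
  have nonneg: "0 \<le> inner x id_symmat" if "x \<in> pd_cone" for x :: "'n symmat"
    using that psd by (intro psd_inner_nonneg) auto
  have "integrable lborel (\<lambda>u. a * trace (mat_of (symmat_inv u)) * wishart_weight a t u)"
  proof (rule integrable_directional_derivative[OF open_pd_cone convex_pd_cone, of "wishart_weight a t"])
    show "continuous_on UNIV (wishart_weight a t)"
      using continuous_on_mult_wishart_weight[of "\<lambda>_. 1" a t] \<open>0 < a\<close> by simp
    show "integrable lborel (wishart_weight a t)"
      using integrable_mult_wishart_weight[of "\<lambda>_. 1" 1 0 a t] assms by simp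
    show "((\<lambda>s. wishart_weight a t (u + s *\<^sub>R id_symmat)) has_real_derivative
        a * trace (mat_of (symmat_inv u)) * wishart_weight a t u - inner t id_symmat * wishart_weight a t u) (at 0)"
      if "u \<in> pd_cone" for u
      using has_real_derivative_wishart_weight_line[OF that, of a t id_symmat]
      by (simp add: inner_id_symmat algebra_simps)
    show "0 \<le> inner t id_symmat"
      using t by (rule nonneg)
    show "0 \<le> a * trace (mat_of (symmat_inv u)) * wishart_weight a t u" for u
      using nonneg[OF symmat_inv_pd, of u] \<open>0 < a\<close>
      by (cases "u \<in> pd_cone") (auto simp: inner_id_symmat wishart_weight_nonneg wishart_weight_outside)
    show "(\<lambda>u. a * trace (mat_of (symmat_inv u)) * wishart_weight a t u) \<in> borel_measurable borel"
      unfolding eq by measurable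
  qed (auto simp: wishart_weight_outside wishart_weight_nonneg)
  then have "integrable lborel (\<lambda>u. (1 / a) * (a * trace (mat_of (symmat_inv u)) * wishart_weight a t u))"
    by (rule integrable_mult_right)
  then show ?thesis
    using \<open>0 < a\<close> by (simp add: mult.assoc)
qed

lemma integrable_mult_inv_nth_weight:
  fixes \<phi> :: "'n::finite symmat \<Rightarrow> real"
  assumes [measurable]: "\<phi> \<in> borel_measurable borel"
    and \<phi>: "\<And>u. \<bar>\<phi> u\<bar> \<le> K * (1 + norm u) ^ m" and "1 \<le> a" and t: "t \<in> pd_cone"
  shows "integrable lborel (\<lambda>u. \<phi> u * inv_nth u i j * wishart_weight a t u)"
proof -
  have "integrable lborel (\<lambda>u. \<phi> u * adj_nth u i j * wishart_weight (a - 1) t u)"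
    by (rule integrable_mult_wishart_weight[OF _ abs_power_bound_mult[of \<phi> _ K m "\<lambda>u. adj_nth u i j", OF \<phi> abs_adj_nth_le]])
      (use assms in auto)
  then show ?thesis
    by (simp add: mult.assoc inv_nth_mult_weight)
qed

text \<open>Half of the exponential absorbs the polynomial growth of \<phi>; the other half leaves
  the weight with parameter t / 2, to which the trace bound applies.\<close>

lemma integrable_mult_inv_nth_weight_strict:
  fixes \<phi> :: "'n::finite symmat \<Rightarrow> real"
  assumes [measurable]: "\<phi> \<in> borel_measurable borel"
    and \<phi>: "\<And>u. \<bar>\<phi> u\<bar> \<le> K * (1 + norm u) ^ m" and "0 < a" and t: "t \<in> pd_cone"
  shows "integrable lborel (\<lambda>u. \<phi> u * inv_nth u i j * wishart_weight a t u)"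
proof -
  obtain \<epsilon> where \<epsilon>: "0 < \<epsilon>" "\<And>u. u \<in> psd_cone \<Longrightarrow> \<epsilon> * norm u \<le> inner ((1/2) *\<^sub>R t) u"
    using pd_inner_ge_norm[OF pd_scaleR[OF t, of "1/2"]] by auto
  obtain B where B: "\<And>x. 0 \<le> x \<Longrightarrow> (1 + x) ^ m * exp (- \<epsilon> * x) \<le> B"
    using power_mult_exp_bounded[OF \<epsilon>(1)] by blast
  have "0 \<le> K"
    using \<phi>[of 0] by simp
  have "integrable lborel (\<lambda>u. K * B * (trace (mat_of (symmat_inv u)) * wishart_weight a ((1/2) *\<^sub>R t) u))"
    using \<open>0 < a\<close> by (intro integrable_mult_right integrable_trace_inv_mult_weight pd_scaleR t) auto
  then show ?thesis
  proof (rule Bochner_Integration.integrable_bound, goal_cases)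
    case 1
    show ?case
      by (simp add: mult.assoc inv_nth_mult_weight)
  next
    case 2
    show ?case
    proof (rule AE_I2)
      fix u :: "'n symmat"
      show "norm (\<phi> u * inv_nth u i j * wishart_weight a t u) \<le>
          norm (K * B * (trace (mat_of (symmat_inv u)) * wishart_weight a ((1/2) *\<^sub>R t) u))"
      proof (cases "u \<in> pd_cone")
        case True
        then have "\<bar>\<phi> u\<bar> * exp (- inner ((1/2) *\<^sub>R t) u) \<le> K * (1 + norm u) ^ m * exp (- \<epsilon> * norm u)"
          using \<epsilon>(2)[of u] pd_cone_subset_psd_cone \<phi>[of u] \<open>0 \<le> K\<close> by (intro mult_mono) auto
        also have "\<dots> \<le> K * B"
          using mult_left_mono[OF B[of "norm u"] \<open>0 \<le> K\<close>] by (simp add: mult.assoc)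
        finally have 1: "\<bar>\<phi> u\<bar> * exp (- inner ((1/2) *\<^sub>R t) u) \<le> K * B" .
        have "\<bar>\<phi> u\<bar> * exp (- inner ((1/2) *\<^sub>R t) u) * (\<bar>inv_nth u i j\<bar> * wishart_weight a ((1/2) *\<^sub>R t) u) \<le>
            K * B * (trace (mat_of (symmat_inv u)) * wishart_weight a ((1/2) *\<^sub>R t) u)"
          by (rule mult_mono[OF 1 mult_right_mono[OF symmat_inv_nth_bound[OF True] wishart_weight_nonneg]])
            (auto simp: wishart_weight_nonneg intro: order_trans[OF _ 1])
        moreover have "wishart_weight a t u = exp (- inner ((1/2) *\<^sub>R t) u) * wishart_weight a ((1/2) *\<^sub>R t) u"
          by (simp add: wishart_weight_def exp_add[symmetric])
        then have "\<bar>\<phi> u * inv_nth u i j * wishart_weight a t u\<bar> =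
            \<bar>\<phi> u\<bar> * exp (- inner ((1/2) *\<^sub>R t) u) * (\<bar>inv_nth u i j\<bar> * wishart_weight a ((1/2) *\<^sub>R t) u)"
          by (simp add: abs_mult wishart_weight_nonneg)
        ultimately show ?thesis
          unfolding real_norm_def by linarith
      next
        case False
        then show ?thesis
          by (simp add: wishart_weight_outside)
      qed
    qed
  qed
qed

text \<open>The first inverse entry becomes an adjugate entry, lowering the exponent to a - 1; the
  second is left to the trace bound, which asks for a - 1 > 0. For the Wishart exponent this is q >
  (n + 3) / 2.\<close>

lemma integrable_inv_nth_mult_inv_nth_weight:
  fixes t :: "'n::finite symmat"
  assumes "1 < a" and t: "t \<in> pd_cone"
  shows "integrable lborel (\<lambda>u. inv_nth u i j * inv_nth u k l * wishart_weight a t u)"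
proof -
  have "integrable lborel (\<lambda>u. adj_nth u i j * inv_nth u k l * wishart_weight (a - 1) t u)"
    by (rule integrable_mult_inv_nth_weight_strict[OF _ abs_adj_nth_le]) (use assms in auto)
  moreover have "adj_nth u i j * inv_nth u k l * wishart_weight (a - 1) t u = inv_nth u i j * inv_nth u k l * wishart_weight a t u" for u
    using inv_nth_mult_weight[of u i j a t] by (simp add: mult_ac)
  ultimately show ?thesis
    by simp
qed

text \<open>Stein's identity for the weight. The function \<psi> is differentiated only inside the
  cone and may blow up towards the boundary; what must extend continuously is its product with the
  weight.\<close>

lemma wishart_weight_stein:
  fixes t :: "'n::finite symmat"
  assumes "continuous_on UNIV (\<lambda>u. \<psi> u * wishart_weight a t u)"
    and "integrable lborel (\<lambda>u. \<psi> u * wishart_weight a t u)"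
    and "\<And>u. u \<in> pd_cone \<Longrightarrow> ((\<lambda>s. \<psi> (u + s *\<^sub>R v)) has_real_derivative d u) (at 0)"
    and "integrable lborel (\<lambda>u. (d u + \<psi> u * (a * inner (symmat_inv u) v - inner t v)) * wishart_weight a t u)"
  shows "(LBINT u. (d u + \<psi> u * (a * inner (symmat_inv u) v - inner t v)) * wishart_weight a t u) = 0"
proof (rule integral_directional_derivative_eq_0[OF open_pd_cone convex_pd_cone assms(1) _ assms(2)])
  fix u :: "'n symmat" assume u: "u \<in> pd_cone"
  show "((\<lambda>s. \<psi> (u + s *\<^sub>R v) * wishart_weight a t (u + s *\<^sub>R v)) has_real_derivative
      (d u + \<psi> u * (a * inner (symmat_inv u) v - inner t v)) * wishart_weight a t u) (at 0)"
    using DERIV_mult'[OF assms(3)[OF u] has_real_derivative_wishart_weight_line[OF u, of a t v]]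
    by (simp add: algebra_simps)
qed (use assms(4) in \<open>auto simp: wishart_weight_outside\<close>)

text \<open>The symmetrised matrix unit (E_kl + E_lk) / 2: the factor undoes the normalisation of
  the basis, so that pairing with it is exactly an entry.\<close>

definition nth_dir :: "'n::finite \<Rightarrow> 'n \<Rightarrow> 'n symmat"
  where "nth_dir k l = symmat_unit {k, l} /\<^sub>R (if k = l then 1 else sqrt 2)"

lemma inner_nth_dir: "inner u (nth_dir k l) = mat_of u $ k $ l"
  by (simp add: nth_dir_def inner_symmat_unit)

lemma mat_of_nth_dir:
  "mat_of (nth_dir k l) $ i $ j = ((if i = k \<and> j = l then 1 else 0) + (if i = l \<and> j = k then 1 else 0)) / 2"
  by (auto simp: nth_dir_def mat_of_symmat_unit doubleton_eq_iff divide_simps)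

text \<open>Up to sign this is the derivative of the inverse in a coordinate direction, the source
  of the two permuted index pairings in the second moments.\<close>

lemma conj_nth_dir:
  "(mat_of u ** mat_of (nth_dir k l) ** mat_of u) $ i $ j =
    (mat_of u $ i $ k * mat_of u $ j $ l + mat_of u $ i $ l * mat_of u $ j $ k) / 2"
proof -
  have mult_nth: "(A ** B) $ i $ j = (\<Sum>b\<in>UNIV. A $ i $ b * B $ b $ j)" for A B :: "real^'a^'a" and i j
    by (simp add: matrix_matrix_mult_def)
  have row: "(mat_of u ** mat_of (nth_dir k l)) $ i $ b =
      ((if b = l then mat_of u $ i $ k else 0) + (if b = k then mat_of u $ i $ l else 0)) / 2" for b
  proof -
    have "(mat_of u ** mat_of (nth_dir k l)) $ i $ b =
      (\<Sum>a\<in>UNIV. (if a = k then (if b = l then mat_of u $ i $ k else 0) / 2 else 0) + (if a = l then (if b = k then mat_of u $ i $ l else 0) / 2 else 0))"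
      unfolding mult_nth mat_of_nth_dir by (rule sum.cong) auto
    then show ?thesis
      by (simp only: sum.distrib sum.delta finite UNIV_I if_True add_divide_distrib)
  qed
  have "(mat_of u ** mat_of (nth_dir k l) ** mat_of u) $ i $ j =
      (\<Sum>b\<in>UNIV. (if b = l then mat_of u $ i $ k * mat_of u $ b $ j / 2 else 0) + (if b = k then mat_of u $ i $ l * mat_of u $ b $ j / 2 else 0))"
    unfolding mult_nth[of "mat_of u ** mat_of (nth_dir k l)"] row by (rule sum.cong) (auto simp: add_divide_distrib)
  then show ?thesis
    by (simp only: sum.distrib sum.delta finite UNIV_I if_True add_divide_distrib mat_of_nth_commute[of u _ j])
qed

section \<open>First and second moments of the weight\<close>

context
  fixes a :: real and t :: "'n::finite symmat"
  assumes a: "1 < a" and t: "t \<in> pd_cone"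
begin

abbreviation weight_integral :: "('n symmat \<Rightarrow> real) \<Rightarrow> real"
  where "weight_integral \<phi> \<equiv> (LBINT u. \<phi> u * wishart_weight a t u)"

lemma integrable_weight: "integrable lborel (wishart_weight a t)"
  using integrable_mult_wishart_weight[of "\<lambda>_. 1" 1 0 a t] a t by simp

lemma integrable_nth_weight: "integrable lborel (\<lambda>u. mat_of u $ i $ j * wishart_weight a t u)"
  by (rule integrable_mult_wishart_weight[of _ 1 1])
    (use a t in \<open>auto intro: order_trans[OF abs_mat_of_nth_le_norm]\<close>)

lemma integrable_inv_nth_weight: "integrable lborel (\<lambda>u. inv_nth u i j * wishart_weight a t u)"
  using integrable_mult_inv_nth_weight[of "\<lambda>_. 1" 1 0 a t i j] a t by simp

lemma integrable_nth_inv_nth_weight: "integrable lborel (\<lambda>u. mat_of u $ i $ j * inv_nth u k l * wishart_weight a t u)"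
  by (rule integrable_mult_inv_nth_weight[of _ 1 1])
    (use a t in \<open>auto intro: order_trans[OF abs_mat_of_nth_le_norm]\<close>)

lemmas integrable_inv_inv_weight = integrable_inv_nth_mult_inv_nth_weight[OF a t]

lemma weight_integral_pos: "0 < weight_integral (\<lambda>_. 1)"
proof -
  have "emeasure lborel (pd_cone :: 'n symmat set) \<noteq> 0"
    using open_not_negligible[OF open_pd_cone pd_cone_nonempty]
    by (auto simp: negligible_iff_emeasure0 emeasure_completion)
  moreover have "pd_cone = {u \<in> space lborel. \<not> wishart_weight a t u = 0}"
    using wishart_weight_pos[of _ a t] wishart_weight_outside[of _ a t] by force
  ultimately have "\<not> (AE u in lborel. wishart_weight a t u = 0)"
    using borel_pd_cone by (subst AE_iff_measurable) auto
  then show ?thesis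
    using integral_nonneg_eq_0_iff_AE[OF integrable_weight] wishart_weight_nonneg[of a t]
    by (simp add: less_le integral_nonneg_AE)
qed

lemma weight_integral_inv_nth: "a * weight_integral (\<lambda>u. inv_nth u k l) = mat_of t $ k $ l * weight_integral (\<lambda>_. 1)"
proof -
  have *: "(0 + 1 * (a * inner (symmat_inv u) (nth_dir k l) - inner t (nth_dir k l))) * wishart_weight a t u =
      a * (inv_nth u k l * wishart_weight a t u) - mat_of t $ k $ l * wishart_weight a t u" for u
    by (simp add: inner_nth_dir algebra_simps)
  have "(LBINT u. (0 + 1 * (a * inner (symmat_inv u) (nth_dir k l) - inner t (nth_dir k l))) * wishart_weight a t u) = 0"
    by (rule wishart_weight_stein; (unfold * )?)
      (use a continuous_on_mult_wishart_weight[of "\<lambda>_. 1" a t] integrable_weight integrable_inv_nth_weight in auto)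
  then show ?thesis
    unfolding * by (simp add: integrable_weight integrable_inv_nth_weight)
qed

lemma weight_integral_inv_nth_inv_nth:
  "a * weight_integral (\<lambda>u. inv_nth u i j * inv_nth u k l) =
    (weight_integral (\<lambda>u. inv_nth u i k * inv_nth u j l) + weight_integral (\<lambda>u. inv_nth u i l * inv_nth u j k)) / 2 +
    mat_of t $ k $ l * weight_integral (\<lambda>u. inv_nth u i j)"
proof -
  have *: "(- (mat_of (symmat_inv u) ** mat_of (nth_dir k l) ** mat_of (symmat_inv u)) $ i $ j +
      inv_nth u i j * (a * inner (symmat_inv u) (nth_dir k l) - inner t (nth_dir k l))) * wishart_weight a t u =
    a * (inv_nth u i j * inv_nth u k l * wishart_weight a t u) - (1 / 2) * (inv_nth u i k * inv_nth u j l * wishart_weight a t u)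
     - (1 / 2) * (inv_nth u i l * inv_nth u j k * wishart_weight a t u) - mat_of t $ k $ l * (inv_nth u i j * wishart_weight a t u)" for u
    by (simp add: inner_nth_dir conj_nth_dir algebra_simps add_divide_distrib)
  have "(LBINT u. (- (mat_of (symmat_inv u) ** mat_of (nth_dir k l) ** mat_of (symmat_inv u)) $ i $ j +
      inv_nth u i j * (a * inner (symmat_inv u) (nth_dir k l) - inner t (nth_dir k l))) * wishart_weight a t u) = 0"
  proof (rule wishart_weight_stein)
    \<comment> \<open>Here a > 1 matters: the product is an adjugate entry times the weight of
      exponent a - 1 > 0.\<close>
    show "continuous_on UNIV (\<lambda>u. inv_nth u i j * wishart_weight a t u)"
      unfolding inv_nth_mult_weight using a by (intro continuous_on_mult_wishart_weight continuous_on_adj_nth) simp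
    show "integrable lborel (\<lambda>u. (- (mat_of (symmat_inv u) ** mat_of (nth_dir k l) ** mat_of (symmat_inv u)) $ i $ j +
        inv_nth u i j * (a * inner (symmat_inv u) (nth_dir k l) - inner t (nth_dir k l))) * wishart_weight a t u)"
      unfolding * by (intro Bochner_Integration.integrable_diff
          integrable_mult_right integrable_inv_nth_weight integrable_inv_inv_weight)
  qed (auto intro!: has_real_derivative_symmat_inv_nth_line integrable_inv_nth_weight)
  then show ?thesis
    unfolding * by (simp add: integrable_inv_inv_weight integrable_inv_nth_weight add_divide_distrib)
qed

text \<open>Stein's identity with the entry u_ij as \<psi>; summing over a common index will turn
  the last integrand into an entry of the identity matrix.\<close>

lemma weight_integral_nth_inv_nth:
  "mat_of t $ k $ l * weight_integral (\<lambda>u. mat_of u $ i $ j) =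
    mat_of (nth_dir k l) $ i $ j * weight_integral (\<lambda>_. 1) + a * weight_integral (\<lambda>u. mat_of u $ i $ j * inv_nth u k l)"
proof -
  have *: "(mat_of (nth_dir k l) $ i $ j +
      mat_of u $ i $ j * (a * inner (symmat_inv u) (nth_dir k l) - inner t (nth_dir k l))) * wishart_weight a t u =
    mat_of (nth_dir k l) $ i $ j * wishart_weight a t u + a * (mat_of u $ i $ j * inv_nth u k l * wishart_weight a t u)
     - mat_of t $ k $ l * (mat_of u $ i $ j * wishart_weight a t u)" for u
    by (simp add: inner_nth_dir algebra_simps)
  have "(LBINT u. (mat_of (nth_dir k l) $ i $ j +
      mat_of u $ i $ j * (a * inner (symmat_inv u) (nth_dir k l) - inner t (nth_dir k l))) * wishart_weight a t u) = 0"
  proof (rule wishart_weight_stein)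
    show "continuous_on UNIV (\<lambda>u. mat_of u $ i $ j * wishart_weight a t u)"
      using a by (intro continuous_on_mult_wishart_weight continuous_intros) simp
    show "integrable lborel (\<lambda>u. (mat_of (nth_dir k l) $ i $ j +
        mat_of u $ i $ j * (a * inner (symmat_inv u) (nth_dir k l) - inner t (nth_dir k l))) * wishart_weight a t u)"
      unfolding * by (intro Bochner_Integration.integrable_diff Bochner_Integration.integrable_add
          integrable_mult_right integrable_weight integrable_nth_weight integrable_nth_inv_nth_weight)
  qed (auto intro!: derivative_eq_intros integrable_nth_weight)
  then show ?thesis
    unfolding * by (simp add: integrable_weight integrable_nth_weight integrable_nth_inv_nth_weight)
qed

end

text \<open>The three pairings of i, j, k, l give a closed system. Adding its equations isolates the
  sum of the unknowns with factor a - 1; then each unknown comes with factor a + 1/2. The remaining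
  a in the denominator stems from the first moment.\<close>

lemma weight_integral_inv_nth_inv_nth_eq:
  fixes t :: "'n::finite symmat"
  assumes a: "1 < a" and t: "t \<in> pd_cone"
  shows "weight_integral a t (\<lambda>u. inv_nth u i j * inv_nth u k l) =
    weight_integral a t (\<lambda>_. 1) / ((a - 1) * a * (a + 1 / 2)) *
    ((a - 1 / 2) * (mat_of t $ i $ j * mat_of t $ k $ l) +
      (mat_of t $ i $ k * mat_of t $ j $ l + mat_of t $ i $ l * mat_of t $ j $ k) / 2)"
proof -
  define T where "T i j k l = weight_integral a t (\<lambda>u. inv_nth u i j * inv_nth u k l)" for i j k l
  define Z where "Z = weight_integral a t (\<lambda>_. 1)"
  let ?s = "\<lambda>i j. mat_of t $ i $ j"
  have T: "a * T i j k l = (T i k j l + T i l j k) / 2 + ?s k l * (?s i j * Z / a)" for i j k l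
  proof -
    have "weight_integral a t (\<lambda>u. inv_nth u i j) = ?s i j * Z / a"
      using weight_integral_inv_nth[OF a t, of i j] a by (simp add: Z_def field_simps)
    then show ?thesis
      unfolding T_def using weight_integral_inv_nth_inv_nth[OF a t, of i j k l] by simp
  qed
  have sym: "T i j k l = T i j l k" for i j k l
    by (simp add: T_def mat_of_nth_commute[of _ k l])
  define X Y W where "X = T i j k l" and "Y = T i k j l" and "W = T i l j k"
  define x y w where "x = ?s i j * ?s k l * Z / a" and "y = ?s i k * ?s j l * Z / a" and "w = ?s i l * ?s j k * Z / a"
  have X: "a * X = (Y + W) / 2 + x"
    unfolding X_def Y_def W_def x_def using T[of i j k l] by (simp add: mult_ac)
  have Y: "a * Y = (X + W) / 2 + y"
    unfolding X_def Y_def W_def y_def using T[of i k j l] sym[of i l k j] by (simp add: mult_ac)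
  have W: "a * W = (X + Y) / 2 + w"
    unfolding X_def Y_def W_def w_def using T[of i l j k] sym[of i j l k] sym[of i k l j] by (simp add: mult_ac)
  define S where "S = X + Y + W"
  have "(a - 1) * S = x + y + w"
    using X Y W by (simp add: S_def algebra_simps add_divide_distrib)
  then have S: "S = (x + y + w) / (a - 1)"
    using a by (simp add: field_simps)
  have "(a + 1 / 2) * X = S / 2 + x"
    using X by (simp add: S_def algebra_simps add_divide_distrib)
  then have "X = (S / 2 + x) / (a + 1 / 2)"
    using a by (simp add: eq_divide_eq mult.commute)
  also have "S / 2 + x = ((a - 1 / 2) * x + (y + w) / 2) / (a - 1)"
    unfolding S using a by (simp add: field_simps)
  also have "(a - 1 / 2) * x + (y + w) / 2 =
      Z / a * ((a - 1 / 2) * (?s i j * ?s k l) + (?s i k * ?s j l + ?s i l * ?s j k) / 2)"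
    using a by (simp add: x_def y_def w_def field_simps)
  finally show ?thesis
    unfolding X_def T_def Z_def by (simp add: mult_ac)
qed

section \<open>The mean of the weight and its normalising constant\<close>

lemma sum_mat_of_nth_dir:
  fixes i l :: "'n::finite"
  shows "(\<Sum>k\<in>UNIV. mat_of (nth_dir k l) $ i $ k) = (if i = l then (real CARD('n) + 1) / 2 else 0)"
proof -
  \<comment> \<open>For i = l each of the n summands contributes 1/2, and k = i another 1/2. This is
    the origin of (n + 1) / 2, the difference between shape and exponent.\<close>
  have "mat_of (nth_dir k l) $ i $ k = (if k = i then (if i = l then 1 / 2 else 0) else 0) + (if i = l then 1 / 2 else 0)" for k
    unfolding mat_of_nth_dir by (cases "i = k"; cases "i = l"; cases "k = l") simp_all
  then have "(\<Sum>k\<in>UNIV. mat_of (nth_dir k l) $ i $ k) =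
      (\<Sum>k\<in>UNIV. if k = i then (if i = l then 1 / 2 else 0) else 0) + (\<Sum>k\<in>(UNIV::'n set). if i = l then 1 / 2 else 0)"
    by (simp only: sum.distrib)
  then show ?thesis
    by (simp add: add_divide_distrib)
qed

text \<open>Summing \<open>weight_integral_nth_inv_nth\<close> over a common index uses u u^-1 = I:
  the matrix of first moments times t is a multiple of the identity, and the inverse of t then gives
  the mean.\<close>

lemma weight_integral_inner:
  fixes t v :: "'n::finite symmat"
  assumes a: "1 < a" and t: "t \<in> pd_cone"
  shows "weight_integral a t (\<lambda>u. inner v u) =
    (a + (real CARD('n) + 1) / 2) * inner (symmat_inv t) v * weight_integral a t (\<lambda>_. 1)"
proof -
  define Z where "Z = weight_integral a t (\<lambda>_. 1)"
  define m where "m = (\<chi> i j. weight_integral a t (\<lambda>u. mat_of u $ i $ j))"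
  define q where "q = a + (real CARD('n) + 1) / 2"
  have "m ** mat_of t = (q * Z) *\<^sub>R mat 1"
  proof -
    have "(m ** mat_of t) $ i $ l = ((q * Z) *\<^sub>R mat 1) $ i $ l" for i l
    proof -
      have "(m ** mat_of t) $ i $ l = (\<Sum>k\<in>UNIV. mat_of t $ k $ l * weight_integral a t (\<lambda>u. mat_of u $ i $ k))"
        by (simp add: matrix_matrix_mult_def m_def mult.commute)
      also have "\<dots> = (\<Sum>k\<in>UNIV. mat_of (nth_dir k l) $ i $ k) * Z +
          a * (\<Sum>k\<in>UNIV. weight_integral a t (\<lambda>u. mat_of u $ i $ k * inv_nth u k l))"
        by (simp only: weight_integral_nth_inv_nth[OF a t] Z_def sum.distrib sum_distrib_left[symmetric] sum_distrib_right[symmetric])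
      also note sum_mat_of_nth_dir
      also have "(\<Sum>k\<in>UNIV. weight_integral a t (\<lambda>u. mat_of u $ i $ k * inv_nth u k l)) =
          (LBINT u. \<Sum>k\<in>UNIV. mat_of u $ i $ k * inv_nth u k l * wishart_weight a t u)"
        by (intro Bochner_Integration.integral_sum[symmetric] integrable_nth_inv_nth_weight a t)
      also have "\<dots> = (LBINT u. (if i = l then 1 else 0) * wishart_weight a t u)"
      proof (rule Bochner_Integration.integral_cong[OF refl])
        fix u :: "'n symmat"
        have "(\<Sum>k\<in>UNIV. mat_of u $ i $ k * inv_nth u k l) = (if i = l then 1 else 0)" if "u \<in> pd_cone"
        proof -
          have "(mat_of u ** mat_of (symmat_inv u)) $ i $ l = mat 1 $ i $ l"
            using symmat_inv_mult(1)[OF that] by simp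
          then show ?thesis
            by (simp add: matrix_matrix_mult_def mat_def)
        qed
        then show "(\<Sum>k\<in>UNIV. mat_of u $ i $ k * inv_nth u k l * wishart_weight a t u) = (if i = l then 1 else 0) * wishart_weight a t u"
          unfolding sum_distrib_right[symmetric] by (cases "u \<in> pd_cone") (simp_all add: wishart_weight_outside)
      qed
      also have "\<dots> = (if i = l then 1 else 0) * Z"
        by (simp add: Z_def)
      finally show ?thesis
        by (simp add: mat_def q_def algebra_simps)
    qed
    then show ?thesis
      by (simp add: vec_eq_iff)
  qed
  then have "m ** mat_of t ** mat_of (symmat_inv t) = (q * Z) *\<^sub>R mat_of (symmat_inv t)"
    by (simp add: scalar_matrix_assoc[symmetric])
  then have "m = (q * Z) *\<^sub>R mat_of (symmat_inv t)"
    using symmat_inv_mult(1)[OF t] by (simp add: matrix_mul_assoc[symmetric])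
  then have m: "weight_integral a t (\<lambda>u. mat_of u $ i $ j) = q * Z * inv_nth t i j" for i j
    by (simp add: vec_eq_iff m_def)
  have "weight_integral a t (\<lambda>u. inner v u) =
      (LBINT u. \<Sum>i\<in>UNIV. \<Sum>j\<in>UNIV. mat_of v $ i $ j * (mat_of u $ i $ j * wishart_weight a t u))"
    by (simp add: inner_symmat_sum sum_distrib_right mult.assoc)
  also have "\<dots> = (\<Sum>i\<in>UNIV. \<Sum>j\<in>UNIV. mat_of v $ i $ j * weight_integral a t (\<lambda>u. mat_of u $ i $ j))"
    by (simp add: Bochner_Integration.integral_sum integrable_nth_weight[OF a t])
  also have "\<dots> = q * inner (symmat_inv t) v * Z"
    unfolding m by (simp add: inner_symmat_sum sum_distrib_left sum_distrib_right mult_ac)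
  finally show ?thesis
    by (simp add: q_def Z_def)
qed

lemma integrable_inner_weight:
  fixes t v :: "'n::finite symmat"
  assumes a: "1 < a" and t: "t \<in> pd_cone"
  shows "integrable lborel (\<lambda>u. inner v u * wishart_weight a t u)"
proof -
  have "\<bar>inner v u\<bar> \<le> norm v * (1 + norm u) ^ 1" for u
    using Cauchy_Schwarz_ineq2[of v u] by (simp add: algebra_simps add_increasing)
  then show ?thesis
    by (intro integrable_mult_wishart_weight[of _ "norm v" 1] t) (use a in auto)
qed

lemma continuous_on_inner_symmat_inv: "continuous_on pd_cone (\<lambda>u. inner (symmat_inv u) v)"
  unfolding inner_symmat_sum by (intro continuous_intros continuous_on_symmat_inv_nth)

text \<open>The derivative of the normalised weight along a segment of parameters has integral zero,
  by the formula for the mean.\<close>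

lemma weight_integral_mult_det_powr:
  fixes t s :: "'n::finite symmat"
  assumes a: "1 < a" and t: "t \<in> pd_cone" and s: "s \<in> pd_cone"
    and q: "q = a + (real CARD('n) + 1) / 2"
  shows "weight_integral a (t + s) (\<lambda>_. 1) * det (mat_of (t + s)) powr q =
    weight_integral a t (\<lambda>_. 1) * det (mat_of t) powr q"
proof -
  define \<tau> where "\<tau> x = t + x *\<^sub>R s" for x :: real
  define l where "l x = inner (symmat_inv (\<tau> x)) s" for x
  have \<tau>: "\<tau> x \<in> pd_cone" if "0 \<le> x" for x
    unfolding \<tau>_def add.commute[of t] using that s t pd_cone_subset_psd_cone by (intro psd_add_pd psd_scaleR) auto
  have cont\<tau>: "continuous_on {0..1} \<tau>"
    unfolding \<tau>_def by (intro continuous_intros)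
  have contl: "continuous_on {0..1} l"
    unfolding l_def by (rule continuous_on_compose2[OF continuous_on_inner_symmat_inv cont\<tau>]) (auto intro: \<tau>)
  have contd: "continuous_on {0..1} (\<lambda>x. det (mat_of (\<tau> x)) powr q)"
    by (intro continuous_intros cont\<tau>) (use pd_det_nonzero[OF \<tau>] in auto)
  define w where "w x u = det (mat_of (\<tau> x)) powr q * (q * l x - inner u s) * wishart_weight a (\<tau> x) u" for x u
  \<comment> \<open>The point and the parameter play symmetric roles: up to a factor in u alone, the
    product is a weight with exponent q and parameter u, evaluated at \<open>\<tau> x\<close>. So
    its derivative in x is the known derivative of a weight along a line.\<close>
  have swap: "det (mat_of (\<tau> x)) powr q * wishart_weight a (\<tau> x) u =
      (if u \<in> pd_cone then det (mat_of u) powr a * wishart_weight q u (\<tau> x) else 0)" if "0 \<le> x" for x u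
    using \<tau>[OF that] by (simp add: wishart_weight_def inner_commute)
  define d where "d u = det (mat_of (\<tau> 1)) powr q * wishart_weight a (\<tau> 1) u - det (mat_of (\<tau> 0)) powr q * wishart_weight a (\<tau> 0) u" for u
  have [measurable]: "d \<in> borel_measurable borel"
    unfolding d_def by measurable
  have ftc: "((\<lambda>x. w x u) has_integral d u) {0..1}" for u
  proof (cases "u \<in> pd_cone")
    case True
    have "((\<lambda>x. w x u) has_integral (det (mat_of u) powr a * wishart_weight q u (\<tau> 1) - det (mat_of u) powr a * wishart_weight q u (\<tau> 0))) {0..1}"
    proof (rule fundamental_theorem_of_calculus)
      fix x :: real assume x: "x \<in> {0..1}"
      then have "\<tau> x \<in> pd_cone" by (intro \<tau>) simp
      from has_real_derivative_wishart_weight_line[OF this, of q u s]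
      have "((\<lambda>y. wishart_weight q u (\<tau> (y + x))) has_real_derivative (q * l x - inner u s) * wishart_weight q u (\<tau> x)) (at 0)"
        by (simp add: l_def \<tau>_def algebra_simps)
      then have "((\<lambda>y. wishart_weight q u (\<tau> y)) has_real_derivative (q * l x - inner u s) * wishart_weight q u (\<tau> x)) (at x)"
        using DERIV_shift[of "\<lambda>y. wishart_weight q u (\<tau> y)" _ 0 x] by simp
      from DERIV_cmult[OF this, of "det (mat_of u) powr a"]
      moreover have "w x u = det (mat_of u) powr a * ((q * l x - inner u s) * wishart_weight q u (\<tau> x))"
      proof -
        have "w x u = (q * l x - inner u s) * (det (mat_of (\<tau> x)) powr q * wishart_weight a (\<tau> x) u)"
          by (simp add: w_def)
        then show ?thesis
          using swap[of x u] x True by simp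
      qed
      ultimately have "((\<lambda>y. det (mat_of u) powr a * wishart_weight q u (\<tau> y)) has_real_derivative w x u) (at x)"
        by simp
      then show "((\<lambda>y. det (mat_of u) powr a * wishart_weight q u (\<tau> y)) has_vector_derivative w x u) (at x within {0..1})"
        by (auto simp: has_real_derivative_iff_has_vector_derivative intro: has_vector_derivative_at_within)
    qed simp
    then show ?thesis
      using True by (simp add: d_def swap)
  next
    case False
    then show ?thesis
      by (simp add: d_def w_def wishart_weight_outside)
  qed
  have int_w: "integrable lborel (w x)" and w0: "(LBINT u. w x u) = 0" if x: "x \<in> {0..1}" for x
  proof -
    have w: "w x = (\<lambda>u. det (mat_of (\<tau> x)) powr q * (q * l x * wishart_weight a (\<tau> x) u - inner s u * wishart_weight a (\<tau> x) u))"
      by (simp add: w_def fun_eq_iff inner_commute algebra_simps)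
    have \<tau>x: "\<tau> x \<in> pd_cone" using x \<tau> by simp
    note int = integrable_weight[OF a \<tau>x] integrable_inner_weight[OF a \<tau>x, of s]
    show "integrable lborel (w x)"
      unfolding w by (intro integrable_mult_right Bochner_Integration.integrable_diff int)
    show "(LBINT u. w x u) = 0"
      unfolding w using int weight_integral_inner[OF a \<tau>x, of s] by (simp add: q l_def)
  qed
  obtain L where L: "\<And>x. x \<in> {0..1} \<Longrightarrow> \<bar>l x\<bar> \<le> L"
    using compact_imp_bounded[OF compact_continuous_image[OF contl compact_Icc]]
    by (auto simp: bounded_iff simp del: atLeastAtMost_iff)
  obtain B where B: "\<And>x. x \<in> {0..1} \<Longrightarrow> \<bar>det (mat_of (\<tau> x)) powr q\<bar> \<le> B"
    using compact_imp_bounded[OF compact_continuous_image[OF contd compact_Icc]]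
    by (auto simp: bounded_iff simp del: atLeastAtMost_iff)
  \<comment> \<open>Dominating function: as inner s u \<ge> 0 on the cone, the weight at
    \<open>\<tau> x\<close> is at most the one at t, while the remaining factors in x are bounded by
    compactness.\<close>
  define H where "H u = B * ((\<bar>q\<bar> * L) * wishart_weight a t u + inner s u * wishart_weight a t u)" for u
  have intH: "integrable lborel H"
    unfolding H_def by (intro integrable_mult_right Bochner_Integration.integrable_add integrable_weight[OF a t] integrable_inner_weight[OF a t])
  have wH: "\<bar>w x u\<bar> \<le> H u" if x: "x \<in> {0..1}" for x u
  proof (cases "u \<in> pd_cone")
    case True
    have su: "0 \<le> inner s u"
      using True s pd_cone_subset_psd_cone by (intro psd_inner_nonneg) auto
    have "wishart_weight a (\<tau> x) u \<le> wishart_weight a t u"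
      using True x su by (auto simp: wishart_weight_def \<tau>_def inner_add_left intro!: mult_left_mono)
    moreover have "\<bar>q * l x - inner u s\<bar> \<le> \<bar>q\<bar> * L + inner s u"
      using su mult_left_mono[OF L[OF x], of "\<bar>q\<bar>"] abs_triangle_ineq4[of "q * l x" "inner u s"]
      by (simp add: abs_mult inner_commute)
    ultimately have "\<bar>det (mat_of (\<tau> x)) powr q\<bar> * (\<bar>q * l x - inner u s\<bar> * wishart_weight a (\<tau> x) u) \<le>
        B * ((\<bar>q\<bar> * L + inner s u) * wishart_weight a t u)"
      using order_trans[OF abs_ge_zero B[OF x]]
      by (intro mult_mono B x) (auto simp: wishart_weight_nonneg intro: order_trans[OF abs_ge_zero])
    then show ?thesis
      by (simp only: w_def H_def abs_mult abs_of_nonneg[OF wishart_weight_nonneg] mult.assoc distrib_right)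
  next
    case False
    then show ?thesis
      by (simp add: w_def H_def wishart_weight_outside)
  qed
  have "integrable (lborel \<Otimes>\<^sub>M lborel) (\<lambda>(x, u). indicator {0..1} x * w x u)"
  proof (rule lborel_pair.Fubini_integrable)
    have [measurable]: "\<tau> \<in> borel_measurable borel"
      unfolding \<tau>_def by measurable
    \<comment> \<open>\<open>l\<close> is known to be continuous only on the unit interval, hence
      the indicator.\<close>
    have [measurable]: "(\<lambda>x. indicator {0..1} x * l x) \<in> borel_measurable borel"
      using borel_measurable_continuous_on_indicator[OF _ contl] by simp
    have "(\<lambda>(x, u). indicator {0..1} x * w x u) =
       (\<lambda>(x, u). det (mat_of (\<tau> x)) powr q * (q * (indicator {0..1} x * l x) - indicator {0..1} x * inner u s) *
         (if u \<in> pd_cone then det (mat_of u) powr a * exp (- inner (\<tau> x) u) else 0))"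
      by (auto simp: fun_eq_iff w_def wishart_weight_def algebra_simps)
    also have "\<dots> \<in> borel_measurable (lborel \<Otimes>\<^sub>M lborel)"
      by measurable
    finally show meas: "(\<lambda>(x, u). indicator {0..1} x * w x u) \<in> borel_measurable (lborel \<Otimes>\<^sub>M lborel)" .
    have bound: "(LBINT u. \<bar>indicator {0..1} x * w x u\<bar>) \<le> indicator {0..1} x * (LBINT u. H u)" for x
    proof (cases "x \<in> {0..1}")
      case True
      then show ?thesis
        using integral_mono[OF integrable_abs[OF int_w[OF True]] intH wH[OF True]] by simp
    qed simp
    have le: "norm (LBINT u. \<bar>indicator {0..1} x * w x u\<bar>) \<le> norm (indicator {0..1} x * (LBINT u. H u))" for x
    proof -
      have "0 \<le> (LBINT u. \<bar>indicator {0..1} x * w x u\<bar>)"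
        by (rule Bochner_Integration.integral_nonneg) simp
      with bound[of x] show ?thesis
        unfolding real_norm_def by linarith
    qed
    have "(\<lambda>x. LBINT u. \<bar>indicator {0..1} x * w x u\<bar>) \<in> borel_measurable lborel"
      using meas by measurable
    moreover have "integrable lborel (\<lambda>x. indicator {0..1::real} x * (LBINT u. H u))"
      by (intro integrable_mult_left) simp
    ultimately have "integrable lborel (\<lambda>x. LBINT u. \<bar>indicator {0..1} x * w x u\<bar>)"
      by (rule Bochner_Integration.integrable_bound[rotated, OF _ AE_I2, OF _ le])
    then show "integrable lborel (\<lambda>x. LBINT u. norm (case (x, u) of (x, u) \<Rightarrow> indicator {0..1} x * w x u))"
      by simp
    show "AE x in lborel. integrable lborel (\<lambda>u. case (x, u) of (x, u) \<Rightarrow> indicator {0..1} x * w x u)"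
    proof (rule AE_I2)
      fix x :: real
      show "integrable lborel (\<lambda>u. case (x, u) of (x, u) \<Rightarrow> indicator {0..1} x * w x u)"
        using int_w[of x] by (cases "x \<in> {0..1}") simp_all
    qed
  qed
  then have "(LBINT u. d u) = (LBINT x. indicator {0..1} x * (LBINT u. w x u))"
    by (rule integral_diff_eq_iterated_integral[OF _ ftc]) measurable
  also have "\<dots> = (LBINT x::real. 0)"
    by (rule Bochner_Integration.integral_cong[OF refl]) (use w0 in \<open>auto simp: indicator_def simp del: atLeastAtMost_iff\<close>)
  finally have "(LBINT u. d u) = 0"
    by simp
  moreover have "integrable lborel (wishart_weight a (\<tau> 1))" "integrable lborel (wishart_weight a (\<tau> 0))"
    by (intro integrable_weight[OF a] \<tau>; simp)+
  ultimately have "det (mat_of (\<tau> 1)) powr q * weight_integral a (\<tau> 1) (\<lambda>_. 1) = det (mat_of (\<tau> 0)) powr q * weight_integral a (\<tau> 0) (\<lambda>_. 1)"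
    by (simp add: d_def)
  then show ?thesis
    by (simp add: \<tau>_def mult.commute del: mat_of_add)
qed

section \<open>The normalised density and its Laplace transform\<close>

definition wishart_pdf :: "real \<Rightarrow> 'n::finite symmat \<Rightarrow> 'n symmat \<Rightarrow> real"
  where "wishart_pdf q \<sigma> u = wishart_weight (q - (real CARD('n) + 1) / 2) (symmat_inv \<sigma>) u /
    weight_integral (q - (real CARD('n) + 1) / 2) (symmat_inv \<sigma>) (\<lambda>_. 1)"

text \<open>Multiplying the weight by exp (- inner s u) replaces t by t + s. The Laplace transform
  is thus a quotient of two normalising constants, hence a power of det (t + s) / det t, which
  equals det (I + \<sigma> s).\<close>

lemma wishart_exists:
  fixes \<sigma> :: "'n::finite symmat"
  assumes q: "q > (real CARD('n) + 3) / 2" and \<sigma>: "\<sigma> \<in> pd_cone"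
  shows "is_wishart q \<sigma> (density lborel (\<lambda>u. ennreal (wishart_pdf q \<sigma> u)))"
proof -
  define a where "a = q - (real CARD('n) + 1) / 2"
  have a: "1 < a"
    using q by (simp add: a_def field_simps)
  define t where "t = symmat_inv \<sigma>"
  have t: "t \<in> pd_cone"
    using \<sigma> by (simp add: t_def symmat_inv_pd)
  define Z where "Z = weight_integral a t (\<lambda>_. 1)"
  have Z: "0 < Z"
    unfolding Z_def by (rule weight_integral_pos[OF a t])
  have pdf: "wishart_pdf q \<sigma> = (\<lambda>u. wishart_weight a t u / Z)"
    by (simp add: wishart_pdf_def fun_eq_iff a_def t_def Z_def)
  let ?\<gamma> = "density lborel (\<lambda>u. ennreal (wishart_pdf q \<sigma> u))"
  have [measurable]: "wishart_pdf q \<sigma> \<in> borel_measurable borel"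
    unfolding pdf by measurable
  have nonneg: "0 \<le> wishart_pdf q \<sigma> u" for u
    unfolding pdf using Z by (simp add: wishart_weight_nonneg)
  have int: "integrable lborel (wishart_pdf q \<sigma>)"
    unfolding pdf by (intro integrable_divide_zero integrable_weight a t) 
  have one: "(LBINT u. wishart_pdf q \<sigma> u) = 1"
    unfolding pdf using Z by (simp add: Z_def)
  have nn: "(\<integral>\<^sup>+u. ennreal (wishart_pdf q \<sigma> u) \<partial>lborel) = 1"
    using nn_integral_eq_integral[OF int] nonneg one by simp
  then have "emeasure ?\<gamma> (space ?\<gamma>) = 1"
    by (simp add: emeasure_density)
  then have prob: "prob_space ?\<gamma>"
    by (rule prob_spaceI)
  have "emeasure ?\<gamma> pd_cone = (\<integral>\<^sup>+u. ennreal (wishart_pdf q \<sigma> u) * indicator pd_cone u \<partial>lborel)"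
    by (intro emeasure_density) auto
  also have "\<dots> = (\<integral>\<^sup>+u. ennreal (wishart_pdf q \<sigma> u) \<partial>lborel)"
    by (intro nn_integral_cong) (auto simp: pdf indicator_def wishart_weight_outside)
  finally have "measure ?\<gamma> pd_cone = 1"
    using nn by (simp add: measure_def)
  moreover have "(\<integral>u. exp (- trace (mat_of s ** mat_of u)) \<partial>?\<gamma>) = det (mat 1 + mat_of \<sigma> ** mat_of s) powr (- q)"
    if s: "s \<in> pd_cone" for s
  proof -
    have "(\<integral>u. exp (- trace (mat_of s ** mat_of u)) \<partial>?\<gamma>) = (LBINT u. wishart_pdf q \<sigma> u * exp (- inner s u))"
      unfolding inner_symmat_def[symmetric] using nonneg by (subst integral_density) auto
    also have "\<dots> = (LBINT u. (1 * wishart_weight a (t + s) u) / Z)"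
      by (intro Bochner_Integration.integral_cong)
        (auto simp: pdf wishart_weight_def inner_add_left exp_add[symmetric])
    also have "\<dots> = weight_integral a (t + s) (\<lambda>_. 1) / Z"
      by simp
    also have "\<dots> = (det (mat_of (t + s)) / det (mat_of t)) powr (- q)"
    proof -
      have "0 < det (mat_of (t + s))" "0 < det (mat_of t)"
        by (intro pd_det_pos pd_add_pd t s)+
      moreover have "weight_integral a (t + s) (\<lambda>_. 1) * det (mat_of (t + s)) powr q = Z * det (mat_of t) powr q"
        unfolding Z_def by (rule weight_integral_mult_det_powr[OF a t s]) (simp add: a_def)
      ultimately show ?thesis
        using Z by (simp add: powr_minus powr_divide field_simps)
    qed
    also have "det (mat_of (t + s)) / det (mat_of t) = det (mat 1 + mat_of \<sigma> ** mat_of s)"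
    proof -
      have "mat 1 + mat_of \<sigma> ** mat_of s = mat_of \<sigma> ** mat_of (t + s)"
        using symmat_inv_mult(1)[OF \<sigma>] by (simp add: t_def matrix_add_ldistrib)
      moreover have "det (mat_of \<sigma>) * det (mat_of t) = 1"
        using symmat_inv_mult(1)[OF \<sigma>] by (simp add: t_def flip: det_mul)
      ultimately show ?thesis
        using pd_det_nonzero[OF t] by (simp add: det_mul field_simps del: mat_of_add)
    qed
    finally show ?thesis .
  qed
  ultimately show ?thesis
    unfolding is_wishart_def using prob by simp
qed

section \<open>Uniqueness of the Wishart density\<close>

text \<open>Indicators of closed sets are pointwise limits of continuous functions of the distance;
  closed sets are stable under intersection and generate the Borel sets.\<close>

lemma measure_eqI_continuous_integrals:
  fixes M N :: "'a::euclidean_space measure"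
  assumes "finite_measure M" "finite_measure N" and sets: "sets M = sets borel" "sets N = sets borel"
    and eq: "\<And>h::'a \<Rightarrow> real. continuous_on UNIV h \<Longrightarrow> (\<And>x. 0 \<le> h x \<and> h x \<le> 1) \<Longrightarrow> (\<integral>x. h x \<partial>M) = (\<integral>x. h x \<partial>N)"
  shows "M = N"
proof -
  interpret M: finite_measure M by fact
  interpret N: finite_measure N by fact
  \<comment> \<open>The empty set is treated apart because \<open>infdist\<close> to it is 0 by
    convention.\<close>
  have closed: "emeasure M C = emeasure N C" if "closed C" for C
  proof (cases "C = {}")
    case False
    define h where "h k x = max 0 (1 - real k * infdist x C)" for k x
    have cont: "continuous_on UNIV (h k)" for k
      unfolding h_def by (intro continuous_intros)
    have bound: "0 \<le> h k x \<and> h k x \<le> 1" for k x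
      by (auto simp: h_def infdist_nonneg)
    have lim: "(\<lambda>k. h k x) \<longlonglongrightarrow> indicator C x" for x
    proof (cases "x \<in> C")
      case True
      then show ?thesis by (simp add: h_def)
    next
      case notin: False
      then have "infdist x C \<noteq> 0"
        using in_closed_iff_infdist_zero[OF \<open>closed C\<close> False] by simp
      then have pos: "0 < infdist x C"
        using infdist_nonneg[of x C] by simp
      then obtain K where K: "1 < real K * infdist x C"
        using reals_Archimedean3 by blast
      have "h k x = 0" if "K \<le> k" for k
      proof -
        have "real K * infdist x C \<le> real k * infdist x C"
          using that pos by (intro mult_right_mono) auto
        then show ?thesis
          using K by (simp add: h_def)
      qed
      then have "eventually (\<lambda>k. h k x = 0) sequentially"
        by (auto simp: eventually_sequentially)
      then show ?thesis
        using notin by (simp add: tendsto_eventually)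
    qed
    have "(\<lambda>k. \<integral>x. h k x \<partial>L) \<longlonglongrightarrow> (\<integral>x. indicator C x \<partial>L)"
      if L: "finite_measure L" "sets L = sets borel" for L
    proof (rule integral_dominated_convergence[where w = "\<lambda>_. 1"])
      interpret finite_measure L by fact
      show "integrable L (\<lambda>_. 1::real)" by simp
      show "(\<lambda>x. indicator C x :: real) \<in> borel_measurable L"
        using \<open>closed C\<close> L(2) by (intro borel_measurable_indicator) auto
      show "h k \<in> borel_measurable L" for k
        using borel_measurable_continuous_onI[OF cont, of k] by (simp add: measurable_cong_sets[OF L(2) refl])
    qed (use lim bound in auto)
    from this[OF \<open>finite_measure M\<close> sets(1)] this[OF \<open>finite_measure N\<close> sets(2)]
    have "(\<integral>x. indicator C x \<partial>M) = (\<integral>x. indicator C x \<partial>N :: real)"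
      unfolding eq[OF cont bound] by (rule LIMSEQ_unique)
    moreover have "space M \<inter> C = C" "space N \<inter> C = C"
      using sets[THEN sets_eq_imp_space_eq] by auto
    ultimately have "measure M C = measure N C"
      by (simp add: Int_commute)
    then show ?thesis
      by (simp add: M.emeasure_eq_measure N.emeasure_eq_measure)
  qed simp
  show ?thesis
    by (rule measure_eqI_generator_eq[of "Collect closed" UNIV M N "\<lambda>_. UNIV"])
      (auto simp: Int_stable_def closed sets borel_eq_closed)
qed

text \<open>The cone is closed under addition, which makes this an algebra; 0 is adjoined for the
  constants. Integrals agree on it by the hypothesis on transforms for s in the cone and by total
  mass for s = 0.\<close>

inductive exp_comb :: "('n::finite symmat \<Rightarrow> real) \<Rightarrow> bool" where
  exp_comb_term: "s \<in> insert 0 pd_cone \<Longrightarrow> exp_comb (\<lambda>u. c * exp (- inner s u))"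
| exp_comb_add: "exp_comb f \<Longrightarrow> exp_comb g \<Longrightarrow> exp_comb (\<lambda>u. f u + g u)"

lemma exp_comb_const: "exp_comb (\<lambda>_. c)"
  using exp_comb_term[of 0 c] by simp

lemma exp_comb_sum: "finite I \<Longrightarrow> (\<And>i. i \<in> I \<Longrightarrow> exp_comb (f i)) \<Longrightarrow> exp_comb (\<lambda>u. \<Sum>i\<in>I. f i u)"
  by (induction I rule: finite_induct) (auto intro: exp_comb_const exp_comb_add)

lemma exp_comb_mult:
  assumes "exp_comb f" "exp_comb g"
  shows "exp_comb (\<lambda>u. f u * g u)"
  using assms(1)
proof induction
  case (exp_comb_term s c)
  note s = this
  show ?case
    using assms(2)
  proof induction
    case (exp_comb_term s' c')
    have "s + s' \<in> insert 0 pd_cone"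
      using s exp_comb_term by (auto intro: pd_add_pd)
    from exp_comb.exp_comb_term[OF this, of "c * c'"] show ?case
      by (simp add: inner_add_left exp_diff exp_minus field_simps exp_add)
  next
    case (exp_comb_add f g)
    then show ?case
      by (simp add: distrib_left exp_comb.exp_comb_add)
  qed
next
  case (exp_comb_add f g)
  then show ?case
    by (simp add: distrib_right exp_comb.exp_comb_add)
qed

text \<open>A matrix is recovered from these exponentials by taking logarithms, and they send the cone into a
  compact set, where polynomials in them are dense by the Stone-Weierstrass theorem.\<close>

definition shifted_id :: "'n::finite symmat \<Rightarrow> 'n symmat"
  where "shifted_id b = b + (real CARD('n) ^ 2 + 1) *\<^sub>R id_symmat"

definition exp_coords :: "'n::finite symmat \<Rightarrow> real \<times> 'n symmat"
  where "exp_coords u = (exp (- inner id_symmat u), \<Sum>b\<in>Basis. exp (- inner (shifted_id b) u) *\<^sub>R b)"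

definition log_coords :: "real \<times> 'n::finite symmat \<Rightarrow> 'n symmat"
  where "log_coords y = (\<Sum>b\<in>Basis. ((real CARD('n) ^ 2 + 1) * ln (fst y) - ln (snd y \<bullet> b)) *\<^sub>R b)"

text \<open>A basis element has norm 1, so its form is at most n^2 times the squared norm in
  absolute value; the shift by n^2 + 1 dominates it.\<close>

lemma shifted_id_pd:
  assumes "b \<in> Basis"
  shows "shifted_id b \<in> pd_cone"
  unfolding pd_cone_iff
proof safe
  fix x :: "real^'a" assume "x \<noteq> 0"
  have id: "quad_form id_symmat x = (norm x)\<^sup>2"
    by (simp add: quad_form_def power2_norm_eq_inner)
  have "\<bar>quad_form b x\<bar> \<le> real CARD('a) ^ 2 * (norm x)\<^sup>2"
    using abs_quad_form_le[of b x] assms by simp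
  moreover have "0 < (norm x)\<^sup>2"
    using \<open>x \<noteq> 0\<close> by simp
  ultimately show "0 < quad_form (shifted_id b) x"
    unfolding shifted_id_def quad_form_linear id distrib_right mult_1 by linarith
qed

text \<open>The first coordinate gives the trace of u, which cancels the shift in the logarithms of
  the others.\<close>

lemma log_coords_exp_coords: "log_coords (exp_coords u) = u"
proof -
  have "log_coords (exp_coords u) = (\<Sum>b\<in>Basis. (inner u b) *\<^sub>R b)"
    unfolding log_coords_def
  proof (rule sum.cong[OF refl])
    fix b :: "'a symmat" assume "b \<in> Basis"
    then have "snd (exp_coords u) \<bullet> b = exp (- inner (shifted_id b) u)"
      by (simp add: exp_coords_def inner_sum_left inner_Basis if_distrib sum.delta cong: if_cong)
    moreover have fst: "fst (exp_coords u) = exp (- inner id_symmat u)"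
      by (simp add: exp_coords_def)
    moreover have shifted: "inner (shifted_id b) u = inner u b + (real CARD('a) ^ 2 + 1) * inner id_symmat u"
      by (simp add: shifted_id_def inner_add_left inner_commute[of b u])
    ultimately show "((real CARD('a) ^ 2 + 1) * ln (fst (exp_coords u)) - ln (snd (exp_coords u) \<bullet> b)) *\<^sub>R b = inner u b *\<^sub>R b"
      by simp
  qed
  then show ?thesis
    by (simp add: euclidean_representation)
qed

lemma continuous_on_exp_coords: "continuous_on UNIV exp_coords"
  unfolding exp_coords_def by (intro continuous_intros)

lemma borel_measurable_exp_coords [measurable]: "exp_coords \<in> borel_measurable borel"
  by (rule borel_measurable_continuous_onI[OF continuous_on_exp_coords])

lemma borel_measurable_log_coords [measurable]: "log_coords \<in> borel_measurable borel"
  unfolding log_coords_def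
  by (intro borel_measurable_sum borel_measurable_scaleR borel_measurable_const borel_measurable_diff
      borel_measurable_times borel_measurable_ln borel_measurable_inner)
    (auto intro!: borel_measurable_continuous_onI continuous_intros)

lemma exp_comb_polynomial_exp_coords:
  fixes p :: "real \<times> 'n::finite symmat \<Rightarrow> real"
  assumes "real_polynomial_function p"
  shows "exp_comb (\<lambda>u. p (exp_coords u))"
  using assms
proof induction
  case (linear f)
  then interpret bounded_linear f .
  have "f (exp_coords u) = f (1, 0) * exp (- inner id_symmat u) + (\<Sum>b\<in>Basis. f (0, b) * exp (- inner (shifted_id b) u))" for u
  proof -
    have "exp_coords u = exp (- inner id_symmat u) *\<^sub>R (1, 0) + (\<Sum>b\<in>Basis. exp (- inner (shifted_id b) u) *\<^sub>R (0, b))"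
      by (simp add: exp_coords_def prod_eq_iff fst_sum snd_sum)
    then show ?thesis
      by (simp add: add sum scaleR mult.commute del: scaleR_Pair)
  qed
  moreover have "exp_comb (\<lambda>u. f (1, 0) * exp (- inner id_symmat u) + (\<Sum>b\<in>Basis. f (0, b) * exp (- inner (shifted_id b) u)))"
    by (intro exp_comb.intros exp_comb_sum) (auto intro: shifted_id_pd)
  ultimately show ?case
    by simp
qed (auto intro: exp_comb_const exp_comb_add exp_comb_mult)

lemma norm_exp_coords_le:
  fixes u :: "'n::finite symmat"
  assumes "u \<in> pd_cone"
  shows "norm (exp_coords u) \<le> 1 + DIM('n symmat)"
proof -
  have nonneg: "0 \<le> inner s u" if "s \<in> pd_cone" for s
    using that assms pd_cone_subset_psd_cone by (intro psd_inner_nonneg) auto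
  have 1: "norm (\<Sum>b\<in>Basis. exp (- inner (shifted_id b) u) *\<^sub>R b) \<le> DIM('n symmat)"
    using sum_norm_le[of Basis "\<lambda>b. exp (- inner (shifted_id b) u) *\<^sub>R b" "\<lambda>_. 1"] nonneg[OF shifted_id_pd] by simp
  have 2: "norm (exp (- inner id_symmat u)) \<le> 1"
    using nonneg[OF id_symmat_pd] by simp
  have "norm (exp_coords u) \<le> norm (exp (- inner id_symmat u)) + norm (\<Sum>b\<in>Basis. exp (- inner (shifted_id b) u) *\<^sub>R b)"
    unfolding exp_coords_def norm_prod_def by (simp add: sqrt_sum_squares_le_sum)
  with 1 2 show ?thesis
    by linarith
qed

text \<open>The images of the measures under \<open>exp_coords\<close> live on a ball, where
  continuous test functions are uniform limits of polynomials, and these pull back to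
  \<open>exp_comb\<close> functions. Equality of the images is carried back by the measurable left
  inverse \<open>log_coords\<close>.\<close>

lemma laplace_transform_unique:
  fixes M N :: "'n::finite symmat measure"
  assumes M: "prob_space M" "sets M = sets borel" "measure M pd_cone = 1"
    and N: "prob_space N" "sets N = sets borel" "measure N pd_cone = 1"
    and eq: "\<And>s. s \<in> pd_cone \<Longrightarrow> (\<integral>u. exp (- inner s u) \<partial>M) = (\<integral>u. exp (- inner s u) \<partial>N)"
  shows "M = N"
proof -
  have AE: "AE u in L. u \<in> pd_cone" if "prob_space L" "sets L = sets borel" "measure L pd_cone = 1" for L :: "'n symmat measure"
    using prob_space.AE_in_set_eq_1[of L pd_cone] that by auto
  have meas: "f \<in> borel_measurable L" if "f \<in> borel_measurable borel" "sets L = sets borel"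
    for L :: "'n symmat measure" and f :: "'n symmat \<Rightarrow> real"
    using that by (simp add: measurable_cong_sets[OF that(2) refl])
  have int: "integrable L f" if L: "prob_space L" "sets L = sets borel" "measure L pd_cone = 1"
    and f: "f \<in> borel_measurable borel" "\<And>u. u \<in> pd_cone \<Longrightarrow> \<bar>f u\<bar> \<le> B" for L :: "'n symmat measure" and f :: "'n symmat \<Rightarrow> real" and B
  proof -
    interpret prob_space L by fact
    show ?thesis
    proof (rule integrable_const_bound)
      show "AE u in L. norm (f u) \<le> B"
        using AE[OF L] by eventually_elim (simp add: f(2))
      show "f \<in> borel_measurable L"
        by (rule meas[OF f(1) L(2)])
    qed
  qed
  have nonneg: "0 \<le> inner s u" if "s \<in> insert 0 pd_cone" "u \<in> pd_cone" for s u :: "'n symmat"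
    using that pd_cone_subset_psd_cone by (cases "s = 0") (auto intro!: psd_inner_nonneg)
  interpret M: prob_space M by fact
  interpret N: prob_space N by fact
  have comb: "integrable M f \<and> integrable N f \<and> (\<integral>u. f u \<partial>M) = (\<integral>u. f u \<partial>N)" if "exp_comb f" for f
    using that
  proof induction
    case (exp_comb_term s c)
    have "integrable L (\<lambda>u. exp (- inner s u))" if L: "prob_space L" "sets L = sets borel" "measure L pd_cone = 1" for L
      by (rule int[OF L, of _ 1]) (use nonneg[OF exp_comb_term] in auto)
    moreover have "(\<integral>u. exp (- inner s u) \<partial>M) = (\<integral>u. exp (- inner s u) \<partial>N)"
      using exp_comb_term eq[of s] by (cases "s = 0") (auto simp: M.prob_space N.prob_space)
    ultimately show ?case
      using M N by simp
  qed auto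
  define R where "R = 1 + real DIM('n symmat)"
  have R: "exp_coords u \<in> cball 0 R" if "u \<in> pd_cone" for u :: "'n symmat"
    using norm_exp_coords_le[OF that] by (simp add: R_def)
  have h: "(\<integral>u. h (exp_coords u) \<partial>M) = (\<integral>u. h (exp_coords u) \<partial>N)"
    if h: "continuous_on UNIV h" "\<And>x. 0 \<le> h x \<and> h x \<le> 1" for h :: "real \<times> 'n symmat \<Rightarrow> real"
  proof -
    have mh: "(\<lambda>u. h (exp_coords u)) \<in> borel_measurable borel"
      by (intro borel_measurable_continuous_onI continuous_on_compose2[OF h(1) continuous_on_exp_coords]) auto
    have "\<bar>(\<integral>u. h (exp_coords u) \<partial>M) - (\<integral>u. h (exp_coords u) \<partial>N)\<bar> \<le> 0 + e" if e: "0 < e" for e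
    proof -
      obtain p where p: "real_polynomial_function p" "\<And>x. x \<in> cball 0 R \<Longrightarrow> \<bar>h x - p x\<bar> < e / 2"
        by (rule Stone_Weierstrass_real_polynomial_function[OF compact_cball continuous_on_subset[OF h(1)], of 0 R "e / 2"])
          (use e in auto)
      note comb_p = comb[OF exp_comb_polynomial_exp_coords[OF p(1)]]
      \<comment> \<open>The polynomial is close to h only on the ball, but almost every u lies in
        the cone and is sent there.\<close>
      have "\<bar>(\<integral>u. h (exp_coords u) \<partial>L) - (\<integral>u. p (exp_coords u) \<partial>L)\<bar> \<le> e / 2"
        if L: "prob_space L" "sets L = sets borel" "measure L pd_cone = 1" and p_int: "integrable L (\<lambda>u. p (exp_coords u))" for L
      proof -
        interpret prob_space L by fact
        have h_int: "integrable L (\<lambda>u. h (exp_coords u))"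
          by (rule int[OF L mh, of 1]) (use h(2) in auto)
        have "\<bar>\<integral>u. h (exp_coords u) - p (exp_coords u) \<partial>L\<bar> \<le> (\<integral>u. \<bar>h (exp_coords u) - p (exp_coords u)\<bar> \<partial>L)"
          by (rule integral_abs_bound)
        also have "\<dots> \<le> (\<integral>u. e / 2 \<partial>L)"
          by (rule integral_mono_AE) (use h_int p_int AE[OF L] p(2)[OF R] in \<open>auto elim!: eventually_mono intro: less_imp_le\<close>)
        finally show ?thesis
          using h_int p_int by (simp add: prob_space)
      qed
      from this[OF M] this[OF N] comb_p show ?thesis
        by linarith
    qed
    then have "\<bar>(\<integral>u. h (exp_coords u) \<partial>M) - (\<integral>u. h (exp_coords u) \<partial>N)\<bar> \<le> 0"
      by (rule field_le_epsilon)
    then show ?thesis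
      by simp
  qed
  have mc: "exp_coords \<in> measurable L borel" if "sets L = sets borel" for L :: "'n symmat measure"
    using that by (simp add: measurable_cong_sets[OF that refl])
  have "distr M borel exp_coords = distr N borel exp_coords"
  proof (rule measure_eqI_continuous_integrals)
    show "finite_measure (distr M borel exp_coords)"
      by (intro M.finite_measure_distr mc M)
    show "finite_measure (distr N borel exp_coords)"
      by (intro N.finite_measure_distr mc N)
    fix g :: "real \<times> 'n symmat \<Rightarrow> real"
    assume g: "continuous_on UNIV g" "\<And>x. 0 \<le> g x \<and> g x \<le> 1"
    show "(\<integral>x. g x \<partial>distr M borel exp_coords) = (\<integral>x. g x \<partial>distr N borel exp_coords)"
      using h[OF g] borel_measurable_continuous_onI[OF g(1)] by (simp add: integral_distr mc M N)
  qed simp_all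
  then have "distr (distr M borel exp_coords) borel log_coords = distr (distr N borel exp_coords) borel log_coords"
    by simp
  moreover have "distr (distr L borel exp_coords) borel log_coords = L" if "sets L = sets borel" for L :: "'n symmat measure"
  proof -
    have "distr (distr L borel exp_coords) borel log_coords = distr L borel (\<lambda>u. u)"
      by (subst distr_distr) (auto simp: mc that comp_def log_coords_exp_coords)
    then show ?thesis
      using that by (simp add: distr_id2)
  qed
  ultimately show ?thesis
    using M N by metis
qed

section \<open>The Wishart law and its continuous density\<close>

lemma wishart_eq:
  fixes \<sigma> :: "'n::finite symmat"
  assumes "q > (real CARD('n) + 3) / 2" "\<sigma> \<in> pd_cone"
  shows "wishart q \<sigma> = density lborel (\<lambda>u. ennreal (wishart_pdf q \<sigma> u))"
  unfolding wishart_def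
proof (rule the_equality)
  show W: "is_wishart q \<sigma> (density lborel (\<lambda>u. ennreal (wishart_pdf q \<sigma> u)))"
    using assms by (rule wishart_exists)
  fix \<gamma> assume "is_wishart q \<sigma> \<gamma>"
  with W show "\<gamma> = density lborel (\<lambda>u. ennreal (wishart_pdf q \<sigma> u))"
    unfolding is_wishart_def inner_symmat_def[symmetric] by (intro laplace_transform_unique) auto
qed

lemma continuous_on_wishart_pdf: "continuous_on pd_cone (wishart_pdf q \<sigma>)"
proof -
  have "continuous_on pd_cone (\<lambda>u::'a symmat. (det (mat_of u) powr (q - (real CARD('a) + 1) / 2) * exp (- inner (symmat_inv \<sigma>) u)) /
      weight_integral (q - (real CARD('a) + 1) / 2) (symmat_inv \<sigma>) (\<lambda>_. 1))"
    unfolding divide_inverse[of "_ * _"] by (intro continuous_intros) (use pd_det_nonzero in auto)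
  then show ?thesis
    by (rule continuous_on_eq) (simp add: wishart_pdf_def wishart_weight_def)
qed

text \<open>The set of disagreement is open, and a nonempty open set is not negligible. This makes
  the continuous version of the density unique on the cone.\<close>

lemma AE_eq_imp_eq_on_open:
  fixes f g :: "'a::euclidean_space \<Rightarrow> real"
  assumes "open S" "continuous_on S f" "continuous_on S g" "AE x in lborel. f x = g x" "x \<in> S"
  shows "f x = g x"
proof (rule ccontr)
  assume "f x \<noteq> g x"
  define U where "U = S \<inter> (\<lambda>x. f x - g x) -` (- {0})"
  have "open U"
    unfolding U_def by (rule continuous_open_preimage) (use assms in \<open>auto intro!: continuous_intros\<close>)
  moreover have "x \<in> U"
    using assms(5) \<open>f x \<noteq> g x\<close> by (simp add: U_def)
  moreover have "U \<in> null_sets lborel"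
    using assms(4) \<open>open U\<close> by (subst AE_iff_null_sets) (auto elim!: eventually_mono simp: U_def)
  then have "negligible U"
    by (simp add: negligible_iff_null_sets null_sets_completionI)
  ultimately show False
    using open_not_negligible by blast
qed

lemma wishart_density_eq:
  fixes \<sigma> :: "'n::finite symmat"
  assumes q: "q > (real CARD('n) + 3) / 2" and \<sigma>: "\<sigma> \<in> pd_cone"
  shows "wishart_density q \<sigma> = wishart_pdf q \<sigma>"
  unfolding wishart_density_def wishart_eq[OF assms]
proof (rule the_equality)
  have "0 < weight_integral (q - (real CARD('n) + 1) / 2) (symmat_inv \<sigma>) (\<lambda>_. 1)"
    by (rule weight_integral_pos) (use q \<sigma> in \<open>auto simp: field_simps symmat_inv_pd\<close>)
  then have nonneg: "0 \<le> wishart_pdf q \<sigma> u" for u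
    by (simp add: wishart_pdf_def wishart_weight_nonneg)
  have outside: "wishart_pdf q \<sigma> u = 0" if "u \<notin> pd_cone" for u
    using that by (simp add: wishart_pdf_def wishart_weight_outside)
  show "(\<forall>u. 0 \<le> wishart_pdf q \<sigma> u) \<and> (\<forall>u. u \<notin> pd_cone \<longrightarrow> wishart_pdf q \<sigma> u = 0) \<and>
      continuous_on pd_cone (wishart_pdf q \<sigma>) \<and>
      density lborel (\<lambda>u. ennreal (wishart_pdf q \<sigma> u)) = density lborel (\<lambda>u. ennreal (wishart_pdf q \<sigma> u))"
    using nonneg outside continuous_on_wishart_pdf by auto
  fix f :: "'n symmat \<Rightarrow> real"
  assume f: "(\<forall>u. 0 \<le> f u) \<and> (\<forall>u. u \<notin> pd_cone \<longrightarrow> f u = 0) \<and> continuous_on pd_cone f \<and>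
      density lborel (\<lambda>u. ennreal (wishart_pdf q \<sigma> u)) = density lborel (\<lambda>u. ennreal (f u))"
  \<comment> \<open>A competitor is assumed continuous on the cone only; being 0 elsewhere, it
    equals its product with the indicator of the cone.\<close>
  have meas: "g \<in> borel_measurable borel" if "continuous_on pd_cone g" "\<And>u. u \<notin> pd_cone \<Longrightarrow> g u = 0" for g :: "'n symmat \<Rightarrow> real"
  proof -
    have "(\<lambda>u. indicator pd_cone u *\<^sub>R g u) \<in> borel_measurable borel"
      using that(1) by (intro borel_measurable_continuous_on_indicator) auto
    also have "(\<lambda>u. indicator pd_cone u *\<^sub>R g u) = g"
      using that(2) by (auto simp: fun_eq_iff indicator_def)
    finally show ?thesis .
  qed
  have "f \<in> borel_measurable borel" "wishart_pdf q \<sigma> \<in> borel_measurable borel"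
    using f by (auto intro!: meas outside continuous_on_wishart_pdf)
  then have "AE u in lborel. ennreal (f u) = ennreal (wishart_pdf q \<sigma> u)"
    using f by (subst sigma_finite_measure.density_unique_iff[OF sigma_finite_lborel, symmetric]) auto
  then have AE: "AE u in lborel. f u = wishart_pdf q \<sigma> u"
    using f nonneg by simp
  show "f = wishart_pdf q \<sigma>"
  proof
    fix u
    show "f u = wishart_pdf q \<sigma> u"
      using AE_eq_imp_eq_on_open[OF open_pd_cone _ continuous_on_wishart_pdf AE, of u] f outside[of u]
      by (cases "u \<in> pd_cone") auto
  qed
qed

section \<open>Information\<close>

text \<open>The score is affine in the inverse of u, which is why first and second moments of the
  inverse determine the density information.\<close>

lemma gradient_ln_wishart_pdf:
  fixes u :: "'n::finite symmat"
  assumes q: "q > (real CARD('n) + 3) / 2" and \<sigma>: "\<sigma> \<in> pd_cone" and u: "u \<in> pd_cone"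
  shows "gradient (\<lambda>w. ln (wishart_pdf q \<sigma> w)) u =
    (q - (real CARD('n) + 1) / 2) *\<^sub>R symmat_inv u - symmat_inv \<sigma>"
proof -
  define a where "a = q - (real CARD('n) + 1) / 2"
  define Z where "Z = weight_integral a (symmat_inv \<sigma>) (\<lambda>_. 1)"
  have Z: "0 < Z"
    unfolding Z_def by (rule weight_integral_pos) (use q \<sigma> in \<open>auto simp: a_def field_simps symmat_inv_pd\<close>)
  let ?D = "a *\<^sub>R symmat_inv u - symmat_inv \<sigma>"
  have "((\<lambda>w. ln (det (mat_of w))) has_derivative (\<lambda>h. (det (mat_of u) * inner (symmat_inv u) h) * inverse (det (mat_of u)))) (at u)"
    using has_derivative_det_mat_of[OF u] pd_det_pos[OF u] has_derivative_ln by fast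
  then have "((\<lambda>w. ln (det (mat_of w))) has_derivative inner (symmat_inv u)) (at u)"
    by (rule has_derivative_eq_rhs) (use pd_det_nonzero[OF u] in \<open>simp add: fun_eq_iff\<close>)
  then have "((\<lambda>w. a * ln (det (mat_of w)) - inner (symmat_inv \<sigma>) w - ln Z) has_derivative
      (\<lambda>h. a * inner (symmat_inv u) h - inner (symmat_inv \<sigma>) h - 0)) (at u)"
    by (intro has_derivative_diff has_derivative_mult_right has_derivative_const
        bounded_linear_imp_has_derivative bounded_linear_inner_right)
  then have "((\<lambda>w. a * ln (det (mat_of w)) - inner (symmat_inv \<sigma>) w - ln Z) has_derivative (\<lambda>h. inner h ?D)) (at u)"
    by (rule has_derivative_eq_rhs) (simp add: fun_eq_iff inner_diff_right inner_commute)
  then have "((\<lambda>w. ln (wishart_pdf q \<sigma> w)) has_derivative (\<lambda>h. inner h ?D)) (at u)"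
  proof (rule has_derivative_transform_within_open[OF _ open_pd_cone u])
    fix w :: "'n symmat" assume w: "w \<in> pd_cone"
    have "wishart_pdf q \<sigma> w = det (mat_of w) powr a * exp (- inner (symmat_inv \<sigma>) w) / Z"
      using w by (simp add: wishart_pdf_def wishart_weight_def a_def Z_def)
    then show "a * ln (det (mat_of w)) - inner (symmat_inv \<sigma>) w - ln Z = ln (wishart_pdf q \<sigma> w)"
      using pd_det_pos[OF w] Z by (simp add: ln_div ln_mult ln_powr)
  qed
  then have D: "GDERIV (\<lambda>w. ln (wishart_pdf q \<sigma> w)) u :> ?D"
    by (simp add: gderiv_def)
  have "gradient (\<lambda>w. ln (wishart_pdf q \<sigma> w)) u = ?D"
    unfolding gradient_def
  proof (rule the_equality[where P = "\<lambda>D. GDERIV _ _ :> D"])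
    fix D' assume "GDERIV (\<lambda>w. ln (wishart_pdf q \<sigma> w)) u :> D'"
    with D have "(\<lambda>h. inner h ?D) = (\<lambda>h. inner h D')"
      unfolding gderiv_def by (rule has_derivative_unique)
    then show "D' = ?D"
      by (metis vector_eq_ldot)
  qed (rule D)
  then show ?thesis
    by (simp add: a_def)
qed

text \<open>An endomorphism is a finite combination of rank one operators whose coefficients are
  multiples of entries, so entrywise integration suffices.\<close>

lemma has_bochner_integral_blinfun_symmat:
  fixes F :: "'a \<Rightarrow> 'n::finite symmat \<Rightarrow>\<^sub>L 'm::finite symmat" and G :: "'n symmat \<Rightarrow>\<^sub>L 'm symmat"
  assumes "\<And>v k l. has_bochner_integral M (\<lambda>x. mat_of (F x v) $ k $ l) (mat_of (G v) $ k $ l)"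
  shows "has_bochner_integral M F G"
proof -
  have C: "blinfun_apply (Blinfun (\<lambda>v. inner v j *\<^sub>R i)) v = inner v j *\<^sub>R i" for i :: "'m symmat" and j v :: "'n symmat"
    by (subst bounded_linear_Blinfun_apply) (auto intro!: bounded_linear_intros)
  have rep: "H = (\<Sum>j\<in>Basis. \<Sum>i\<in>Basis. inner (H j) i *\<^sub>R Blinfun (\<lambda>v. inner v j *\<^sub>R i))" for H :: "'n symmat \<Rightarrow>\<^sub>L 'm symmat"
  proof (rule blinfun_euclidean_eqI)
    fix b :: "'n symmat" assume b: "b \<in> Basis"
    have "(\<Sum>j\<in>Basis. \<Sum>i\<in>Basis. inner (H j) i *\<^sub>R Blinfun (\<lambda>v. inner v j *\<^sub>R i)) b =
        (\<Sum>j\<in>Basis. inner b j *\<^sub>R (\<Sum>i\<in>Basis. inner (H j) i *\<^sub>R i))"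
      by (simp add: blinfun.sum_left blinfun.scaleR_left C scaleR_sum_right mult.commute)
    also have "\<dots> = (\<Sum>j\<in>Basis. if j = b then H j else 0)"
      by (rule sum.cong) (use b in \<open>auto simp: euclidean_representation inner_Basis\<close>)
    finally show "H b = (\<Sum>j\<in>Basis. \<Sum>i\<in>Basis. inner (H j) i *\<^sub>R Blinfun (\<lambda>v. inner v j *\<^sub>R i)) b"
      using b by simp
  qed
  have "has_bochner_integral M (\<lambda>x. inner (F x j) i) (inner (G j) i)" if i: "i \<in> Basis" for i j
  proof -
    obtain k l where "i = symmat_unit {k, l}"
      using i unfolding Basis_symmat_def by blast
    then show ?thesis
      using has_bochner_integral_mult_right[OF assms[of j k l]] by (simp add: inner_symmat_unit)
  qed
  then have "has_bochner_integral M (\<lambda>x. \<Sum>j\<in>Basis. \<Sum>i\<in>Basis. inner (F x j) i *\<^sub>R Blinfun (\<lambda>v. inner v j *\<^sub>R i))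
      (\<Sum>j\<in>Basis. \<Sum>i\<in>Basis. inner (G j) i *\<^sub>R Blinfun (\<lambda>v. inner v j *\<^sub>R i))"
    by (intro has_bochner_integral_sum has_bochner_integral_scaleR_left)
  then show ?thesis
    using rep by simp
qed

lemma quad_rep_nth:
  "mat_of (quad_rep u v) $ k $ l = (\<Sum>i\<in>UNIV. \<Sum>j\<in>UNIV. mat_of v $ i $ j * (mat_of u $ k $ i * mat_of u $ j $ l))"
proof -
  have "mat_of (quad_rep u v) $ k $ l = (\<Sum>j\<in>UNIV. \<Sum>i\<in>UNIV. mat_of v $ i $ j * (mat_of u $ k $ i * mat_of u $ j $ l))"
    unfolding mat_of_quad_rep_apply by (simp add: matrix_matrix_mult_def sum_distrib_left sum_distrib_right mult_ac)
  also have "\<dots> = (\<Sum>i\<in>UNIV. \<Sum>j\<in>UNIV. mat_of v $ i $ j * (mat_of u $ k $ i * mat_of u $ j $ l))"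
    by (rule sum.swap)
  finally show ?thesis .
qed

lemma tensor_sq_nth:
  "mat_of (tensor_sq u v) $ k $ l = (\<Sum>i\<in>UNIV. \<Sum>j\<in>UNIV. mat_of v $ i $ j * (mat_of u $ i $ j * mat_of u $ k $ l))"
  by (simp add: tensor_sq_apply inner_symmat_sum sum_distrib_left sum_distrib_right mult_ac)

text \<open>P(u) v is symmetric, so the crossed pairing u_il u_jk contracts with v to the same
  matrix as the straight one.\<close>

lemma quad_rep_nth_transposed:
  "mat_of (quad_rep u v) $ k $ l = (\<Sum>i\<in>UNIV. \<Sum>j\<in>UNIV. mat_of v $ i $ j * (mat_of u $ i $ l * mat_of u $ j $ k))"
proof -
  have "mat_of (quad_rep u v) $ k $ l = mat_of (quad_rep u v) $ l $ k"
    by (rule mat_of_nth_commute)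
  then show ?thesis
    unfolding quad_rep_nth by (simp add: mat_of_nth_commute[of u l])
qed

section \<open>Expected information under the Wishart law\<close>

context
  fixes q :: real and \<sigma> :: "'n::finite symmat" and a c :: real and t :: "'n symmat"
  assumes q: "q > (real CARD('n) + 3) / 2" and \<sigma>: "\<sigma> \<in> pd_cone"
  defines "a \<equiv> q - (real CARD('n) + 1) / 2" and "t \<equiv> symmat_inv \<sigma>"
    and "c \<equiv> (a - 1) * a * (a + 1 / 2)"
begin

lemma shape_gt_1: "1 < a"
  using q by (simp add: a_def field_simps)

lemma inv_scale_pd: "t \<in> pd_cone"
  using \<sigma> by (simp add: t_def symmat_inv_pd)

lemma wishart_pdf_eq: "wishart_pdf q \<sigma> u = wishart_weight a t u / weight_integral a t (\<lambda>_. 1)"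
  by (simp add: wishart_pdf_def a_def t_def)

lemma wishart_moment:
  assumes "integrable lborel (\<lambda>u. \<phi> u * wishart_weight a t u)"
    and "weight_integral a t \<phi> = x * weight_integral a t (\<lambda>_. 1)"
  shows "has_bochner_integral lborel (\<lambda>u. \<phi> u * wishart_pdf q \<sigma> u) x"
proof -
  have "weight_integral a t (\<lambda>_. 1) \<noteq> 0"
    using weight_integral_pos[OF shape_gt_1 inv_scale_pd] by simp
  then show ?thesis
    using assms by (simp add: has_bochner_integral_iff wishart_pdf_eq)
qed

lemma wishart_moment_0: "has_bochner_integral lborel (wishart_pdf q \<sigma>) 1"
  using wishart_moment[of "\<lambda>_. 1" 1] integrable_weight[OF shape_gt_1 inv_scale_pd] by simp

lemma wishart_moment_1: "has_bochner_integral lborel (\<lambda>u. inv_nth u i j * wishart_pdf q \<sigma> u) (mat_of t $ i $ j / a)"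
  using weight_integral_inv_nth[OF shape_gt_1 inv_scale_pd, of i j] shape_gt_1
  by (intro wishart_moment integrable_inv_nth_weight shape_gt_1 inv_scale_pd) (simp add: field_simps)

lemma wishart_moment_2: "has_bochner_integral lborel (\<lambda>u. inv_nth u i j * inv_nth u k l * wishart_pdf q \<sigma> u)
  (((a - 1 / 2) * (mat_of t $ i $ j * mat_of t $ k $ l) +
      (mat_of t $ i $ k * mat_of t $ j $ l + mat_of t $ i $ l * mat_of t $ j $ k) / 2) / c)"
  unfolding c_def
  by (intro wishart_moment integrable_inv_nth_mult_inv_nth_weight shape_gt_1 inv_scale_pd)
    (simp add: weight_integral_inv_nth_inv_nth_eq[OF shape_gt_1 inv_scale_pd])

text \<open>In the second moments the pairing ij, kl contracts with v to the tensor square of t, and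
  both permuted pairings contract to P(t).\<close>

lemma expectation_tensor_sq_inv:
  "has_bochner_integral lborel (\<lambda>u. wishart_pdf q \<sigma> u *\<^sub>R tensor_sq (symmat_inv u))
    (((a - 1 / 2) / c) *\<^sub>R tensor_sq t + (1 / c) *\<^sub>R quad_rep t)"
proof (rule has_bochner_integral_blinfun_symmat)
  fix v :: "'n symmat" and k l
  have "has_bochner_integral lborel
      (\<lambda>u. \<Sum>i\<in>UNIV. \<Sum>j\<in>UNIV. mat_of v $ i $ j * (inv_nth u i j * inv_nth u k l * wishart_pdf q \<sigma> u))
      (\<Sum>i\<in>UNIV. \<Sum>j\<in>UNIV. mat_of v $ i $ j * (((a - 1 / 2) * (mat_of t $ i $ j * mat_of t $ k $ l) +
      (mat_of t $ i $ k * mat_of t $ j $ l + mat_of t $ i $ l * mat_of t $ j $ k) / 2) / c))"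
    by (intro has_bochner_integral_sum has_bochner_integral_mult_right wishart_moment_2)
  also have "(\<lambda>u. \<Sum>i\<in>UNIV. \<Sum>j\<in>UNIV. mat_of v $ i $ j * (inv_nth u i j * inv_nth u k l * wishart_pdf q \<sigma> u)) =
      (\<lambda>u. mat_of ((wishart_pdf q \<sigma> u *\<^sub>R tensor_sq (symmat_inv u)) v) $ k $ l)"
    by (simp add: blinfun.scaleR_left tensor_sq_nth sum_distrib_left mult_ac)
  also have "(\<Sum>i\<in>UNIV. \<Sum>j\<in>UNIV. mat_of v $ i $ j * (((a - 1 / 2) * (mat_of t $ i $ j * mat_of t $ k $ l) +
      (mat_of t $ i $ k * mat_of t $ j $ l + mat_of t $ i $ l * mat_of t $ j $ k) / 2) / c)) =
      (a - 1 / 2) / c * (\<Sum>i\<in>UNIV. \<Sum>j\<in>UNIV. mat_of v $ i $ j * (mat_of t $ i $ j * mat_of t $ k $ l)) +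
      1 / (2 * c) * (\<Sum>i\<in>UNIV. \<Sum>j\<in>UNIV. mat_of v $ i $ j * (mat_of t $ k $ i * mat_of t $ j $ l)) +
      1 / (2 * c) * (\<Sum>i\<in>UNIV. \<Sum>j\<in>UNIV. mat_of v $ i $ j * (mat_of t $ i $ l * mat_of t $ j $ k))"
    unfolding sum_distrib_left sum.distrib[symmetric]
    by (intro sum.cong refl) (simp add: mat_of_nth_commute[of t k] algebra_simps add_divide_distrib diff_divide_distrib)
  also have "\<dots> = mat_of ((((a - 1 / 2) / c) *\<^sub>R tensor_sq t + (1 / c) *\<^sub>R quad_rep t) v) $ k $ l"
    unfolding tensor_sq_nth[symmetric] quad_rep_nth[symmetric] quad_rep_nth_transposed[symmetric]
    by (simp add: blinfun.add_left blinfun.scaleR_left)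
  finally show "has_bochner_integral lborel (\<lambda>u. mat_of ((wishart_pdf q \<sigma> u *\<^sub>R tensor_sq (symmat_inv u)) v) $ k $ l)
      (mat_of ((((a - 1 / 2) / c) *\<^sub>R tensor_sq t + (1 / c) *\<^sub>R quad_rep t) v) $ k $ l)" .
qed

text \<open>Contracted along ki, jl instead, one permuted pairing gives P(t) again, raising a - 1/2
  to a, and the other gives the tensor square.\<close>

lemma expectation_quad_rep_inv:
  "has_bochner_integral lborel (\<lambda>u. wishart_pdf q \<sigma> u *\<^sub>R quad_rep (symmat_inv u))
    ((a / c) *\<^sub>R quad_rep t + (1 / (2 * c)) *\<^sub>R tensor_sq t)"
proof (rule has_bochner_integral_blinfun_symmat)
  fix v :: "'n symmat" and k l
  have "has_bochner_integral lborel
      (\<lambda>u. \<Sum>i\<in>UNIV. \<Sum>j\<in>UNIV. mat_of v $ i $ j * (inv_nth u k i * inv_nth u j l * wishart_pdf q \<sigma> u))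
      (\<Sum>i\<in>UNIV. \<Sum>j\<in>UNIV. mat_of v $ i $ j * (((a - 1 / 2) * (mat_of t $ k $ i * mat_of t $ j $ l) +
      (mat_of t $ k $ j * mat_of t $ i $ l + mat_of t $ k $ l * mat_of t $ i $ j) / 2) / c))"
    by (intro has_bochner_integral_sum has_bochner_integral_mult_right wishart_moment_2)
  also have "(\<lambda>u. \<Sum>i\<in>UNIV. \<Sum>j\<in>UNIV. mat_of v $ i $ j * (inv_nth u k i * inv_nth u j l * wishart_pdf q \<sigma> u)) =
      (\<lambda>u. mat_of ((wishart_pdf q \<sigma> u *\<^sub>R quad_rep (symmat_inv u)) v) $ k $ l)"
    by (simp add: blinfun.scaleR_left quad_rep_nth sum_distrib_left mult_ac)
  also have "(\<Sum>i\<in>UNIV. \<Sum>j\<in>UNIV. mat_of v $ i $ j * (((a - 1 / 2) * (mat_of t $ k $ i * mat_of t $ j $ l) +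
      (mat_of t $ k $ j * mat_of t $ i $ l + mat_of t $ k $ l * mat_of t $ i $ j) / 2) / c)) =
      (a - 1 / 2) / c * (\<Sum>i\<in>UNIV. \<Sum>j\<in>UNIV. mat_of v $ i $ j * (mat_of t $ k $ i * mat_of t $ j $ l)) +
      1 / (2 * c) * (\<Sum>i\<in>UNIV. \<Sum>j\<in>UNIV. mat_of v $ i $ j * (mat_of t $ i $ l * mat_of t $ j $ k)) +
      1 / (2 * c) * (\<Sum>i\<in>UNIV. \<Sum>j\<in>UNIV. mat_of v $ i $ j * (mat_of t $ i $ j * mat_of t $ k $ l))"
    unfolding sum_distrib_left sum.distrib[symmetric]
    by (intro sum.cong refl) (simp add: mat_of_nth_commute[of t k] algebra_simps add_divide_distrib diff_divide_distrib)
  also have "\<dots> = ((a - 1 / 2) / c + 1 / (2 * c)) * mat_of (quad_rep t v) $ k $ l + 1 / (2 * c) * mat_of (tensor_sq t v) $ k $ l"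
    unfolding tensor_sq_nth[symmetric] quad_rep_nth[symmetric] quad_rep_nth_transposed[symmetric]
    by (simp only: distrib_right)
  also have "(a - 1 / 2) / c + 1 / (2 * c) = a / c"
    by (simp add: diff_divide_distrib)
  also have "a / c * mat_of (quad_rep t v) $ k $ l + 1 / (2 * c) * mat_of (tensor_sq t v) $ k $ l =
      mat_of (((a / c) *\<^sub>R quad_rep t + (1 / (2 * c)) *\<^sub>R tensor_sq t) v) $ k $ l"
    by (simp add: blinfun.add_left blinfun.scaleR_left)
  finally show "has_bochner_integral lborel (\<lambda>u. mat_of ((wishart_pdf q \<sigma> u *\<^sub>R quad_rep (symmat_inv u)) v) $ k $ l)
      (mat_of (((a / c) *\<^sub>R quad_rep t + (1 / (2 * c)) *\<^sub>R tensor_sq t) v) $ k $ l)" .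
qed

text \<open>As a u^-1 has mean t, the two cross terms of the expanded square each contribute minus
  the tensor square of t, and the constant term contributes it once; hence the - 1.\<close>

lemma expectation_tensor_sq_score:
  "has_bochner_integral lborel (\<lambda>u. wishart_pdf q \<sigma> u *\<^sub>R tensor_sq (a *\<^sub>R symmat_inv u - t))
    ((a\<^sup>2 * (a - 1 / 2) / c - 1) *\<^sub>R tensor_sq t + (a\<^sup>2 / c) *\<^sub>R quad_rep t)"
proof (rule has_bochner_integral_blinfun_symmat)
  fix v :: "'n symmat" and k l
  let ?G = "((a - 1 / 2) / c) *\<^sub>R tensor_sq t + (1 / c) *\<^sub>R quad_rep t"
  have entry: "bounded_linear (\<lambda>H::'n symmat \<Rightarrow>\<^sub>L 'n symmat. mat_of (H v) $ k $ l)"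
    by (rule bounded_linear_compose[OF bounded_linear_mat_of_nth blinfun.bounded_linear_left])
  have lin: "has_bochner_integral lborel (\<lambda>u. inner (symmat_inv u) v * wishart_pdf q \<sigma> u) (inner t v / a)"
  proof -
    have "has_bochner_integral lborel (\<lambda>u. \<Sum>i\<in>UNIV. \<Sum>j\<in>UNIV. mat_of v $ i $ j * (inv_nth u i j * wishart_pdf q \<sigma> u))
        (\<Sum>i\<in>UNIV. \<Sum>j\<in>UNIV. mat_of v $ i $ j * (mat_of t $ i $ j / a))"
      by (intro has_bochner_integral_sum has_bochner_integral_mult_right wishart_moment_1)
    then show ?thesis
      by (simp add: inner_symmat_sum sum_distrib_left sum_distrib_right sum_divide_distrib mult_ac)
  qed
  have "has_bochner_integral lborel
      (\<lambda>u. a\<^sup>2 * mat_of ((wishart_pdf q \<sigma> u *\<^sub>R tensor_sq (symmat_inv u)) v) $ k $ l -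
        a * mat_of t $ k $ l * (inner (symmat_inv u) v * wishart_pdf q \<sigma> u) -
        a * inner t v * (inv_nth u k l * wishart_pdf q \<sigma> u) + inner t v * mat_of t $ k $ l * wishart_pdf q \<sigma> u)
      (a\<^sup>2 * mat_of (?G v) $ k $ l - a * mat_of t $ k $ l * (inner t v / a) - a * inner t v * (mat_of t $ k $ l / a) +
        inner t v * mat_of t $ k $ l * 1)"
    by (intro has_bochner_integral_add has_bochner_integral_diff has_bochner_integral_mult_right lin
        wishart_moment_1 wishart_moment_0 has_bochner_integral_bounded_linear[OF entry expectation_tensor_sq_inv])
  also have "(\<lambda>u. a\<^sup>2 * mat_of ((wishart_pdf q \<sigma> u *\<^sub>R tensor_sq (symmat_inv u)) v) $ k $ l -
        a * mat_of t $ k $ l * (inner (symmat_inv u) v * wishart_pdf q \<sigma> u) -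
        a * inner t v * (inv_nth u k l * wishart_pdf q \<sigma> u) + inner t v * mat_of t $ k $ l * wishart_pdf q \<sigma> u) =
      (\<lambda>u. mat_of ((wishart_pdf q \<sigma> u *\<^sub>R tensor_sq (a *\<^sub>R symmat_inv u - t)) v) $ k $ l)"
    by (simp add: fun_eq_iff blinfun.scaleR_left tensor_sq_apply inner_diff_left power2_eq_square algebra_simps)
  also have "a\<^sup>2 * mat_of (?G v) $ k $ l - a * mat_of t $ k $ l * (inner t v / a) - a * inner t v * (mat_of t $ k $ l / a) +
        inner t v * mat_of t $ k $ l * 1 =
      mat_of (((a\<^sup>2 * (a - 1 / 2) / c - 1) *\<^sub>R tensor_sq t + (a\<^sup>2 / c) *\<^sub>R quad_rep t) v) $ k $ l"
    using shape_gt_1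
    by (simp add: blinfun.add_left blinfun.scaleR_left tensor_sq_apply)
      (simp add: algebra_simps add_divide_distrib diff_divide_distrib)
  finally show "has_bochner_integral lborel (\<lambda>u. mat_of ((wishart_pdf q \<sigma> u *\<^sub>R tensor_sq (a *\<^sub>R symmat_inv u - t)) v) $ k $ l)
      (mat_of (((a\<^sup>2 * (a - 1 / 2) / c - 1) *\<^sub>R tensor_sq t + (a\<^sup>2 / c) *\<^sub>R quad_rep t) v) $ k $ l)" .
qed

lemma has_bochner_integral_density_info:
  "has_bochner_integral lborel (\<lambda>u. indicator pd_cone u *\<^sub>R density_info_integrand (wishart_pdf q \<sigma>) u)
    ((a\<^sup>2 * (a - 1 / 2) / c - 1) *\<^sub>R tensor_sq t + (a\<^sup>2 / c) *\<^sub>R quad_rep t)"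
proof -
  have "indicator pd_cone u *\<^sub>R density_info_integrand (wishart_pdf q \<sigma>) u = wishart_pdf q \<sigma> u *\<^sub>R tensor_sq (a *\<^sub>R symmat_inv u - t)" for u
    using gradient_ln_wishart_pdf[OF q \<sigma>, of u]
    by (cases "u \<in> pd_cone") (simp_all add: density_info_integrand_def a_def t_def wishart_pdf_def wishart_weight_outside)
  then show ?thesis
    using expectation_tensor_sq_score by simp
qed

lemma has_bochner_integral_fisher_info:
  "has_bochner_integral lborel (\<lambda>u. indicator pd_cone u *\<^sub>R (wishart_pdf q \<sigma> u *\<^sub>R fisher_info p u))
    ((1 / (2 * (2 * p + 3))) *\<^sub>R ((2 * p + 1) *\<^sub>R ((a / c) *\<^sub>R quad_rep t + (1 / (2 * c)) *\<^sub>R tensor_sq t) -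
      (((a - 1 / 2) / c) *\<^sub>R tensor_sq t + (1 / c) *\<^sub>R quad_rep t)))"
proof -
  have "indicator pd_cone u *\<^sub>R (wishart_pdf q \<sigma> u *\<^sub>R fisher_info p u) =
      (1 / (2 * (2 * p + 3))) *\<^sub>R ((2 * p + 1) *\<^sub>R (wishart_pdf q \<sigma> u *\<^sub>R quad_rep (symmat_inv u)) -
        wishart_pdf q \<sigma> u *\<^sub>R tensor_sq (symmat_inv u))" for u
    by (cases "u \<in> pd_cone")
      (simp_all add: fisher_info_def scaleR_diff_right mult_ac wishart_pdf_def wishart_weight_outside)
  then show ?thesis
    using has_bochner_integral_scaleR_right[OF has_bochner_integral_diff[OF
          has_bochner_integral_scaleR_right[OF expectation_quad_rep_inv] expectation_tensor_sq_inv]]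
    by simp
qed

end

section \<open>Inverting combinations of the two endomorphisms\<close>

lemma quad_tensor_comp:
  fixes x y v :: "'n::finite symmat"
  assumes xy: "mat_of x ** mat_of y = mat 1"
  shows "(A *\<^sub>R quad_rep x + B *\<^sub>R tensor_sq x) ((A' *\<^sub>R quad_rep y + B' *\<^sub>R tensor_sq y) v) =
    (A * A') *\<^sub>R v + ((A * B' + B * A' + real CARD('n) * B * B') * inner y v) *\<^sub>R x"
proof -
  have yx: "mat_of y ** mat_of x = mat 1"
    using xy by (simp add: matrix_left_right_inverse)
  \<comment> \<open>The numbered identities reduce the composition to a multiple of the identity
    plus one rank one term; n enters as the trace of x y = I.\<close>
  have 1: "quad_rep x (quad_rep y v) = v"
  proof -
    have "mat_of (quad_rep x (quad_rep y v)) = (mat_of x ** mat_of y) ** mat_of v ** (mat_of y ** mat_of x)"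
      by (simp add: mat_of_quad_rep_apply matrix_mul_assoc)
    then show ?thesis
      by (simp add: xy yx mat_of_inject)
  qed
  have 2: "quad_rep x y = x"
  proof -
    have "mat_of (quad_rep x y) = mat_of x"
      by (simp add: mat_of_quad_rep_apply xy)
    then show ?thesis
      by (simp add: mat_of_inject)
  qed
  have 3: "inner x (quad_rep y v) = inner y v"
  proof -
    have "inner x (quad_rep y v) = trace ((mat_of x ** mat_of y) ** (mat_of v ** mat_of y))"
      by (simp add: inner_symmat_def mat_of_quad_rep_apply matrix_mul_assoc)
    also have "\<dots> = inner v y"
      by (simp add: xy inner_symmat_def)
    finally show ?thesis
      by (simp add: inner_commute)
  qed
  have 4: "inner x y = real CARD('n)"
    by (simp add: inner_symmat_def xy trace_I)
  show ?thesis
    by (simp add: blinfun.add_left blinfun.scaleR_left blinfun.add_right blinfun.scaleR_right tensor_sq_apply 1 2 3 4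
        inner_add_right algebra_simps)
qed

text \<open>The second coefficient of W makes the rank one term of \<open>quad_tensor_comp\<close>
  vanish, as in the Sherman-Morrison formula. M sends \<sigma> to (A + n B) times its inverse, so A
  + n B has to be nonzero.\<close>

lemma quad_tensor_inverse:
  fixes \<sigma> :: "'n::finite symmat"
  assumes \<sigma>: "\<sigma> \<in> pd_cone" and A: "A \<noteq> 0" "A + real CARD('n) * B \<noteq> 0"
  defines "M \<equiv> A *\<^sub>R quad_rep (symmat_inv \<sigma>) + B *\<^sub>R tensor_sq (symmat_inv \<sigma>)"
    and "W \<equiv> (1 / A) *\<^sub>R quad_rep \<sigma> + (- B / (A * (A + real CARD('n) * B))) *\<^sub>R tensor_sq \<sigma>"
  shows "bij (blinfun_apply M)" "inv (blinfun_apply M) = blinfun_apply W"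
proof -
  let ?B = "- B / (A * (A + real CARD('n) * B))"
  have "A * ?B + B * (1 / A) + real CARD('n) * B * ?B = (A + real CARD('n) * B) * ?B + B / A"
    unfolding distrib_right by simp
  also have "\<dots> = 0"
    using A by (simp add: divide_simps)
  finally have coef: "A * ?B + B * (1 / A) + real CARD('n) * B * ?B = 0" .
  then have coef': "1 / A * B + ?B * A + real CARD('n) * ?B * B = 0"
    by (simp add: mult_ac add_ac)
  have "M (W v) = v" for v
    unfolding M_def W_def quad_tensor_comp[OF symmat_inv_mult(2)[OF \<sigma>]] coef using A by simp
  moreover have "W (M v) = v" for v
    unfolding M_def W_def quad_tensor_comp[OF symmat_inv_mult(1)[OF \<sigma>]] coef' using A by simp
  ultimately have comp: "blinfun_apply M \<circ> blinfun_apply W = id" "blinfun_apply W \<circ> blinfun_apply M = id"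
    by (simp_all add: fun_eq_iff)
  show "bij (blinfun_apply M)"
    using comp(2,1) by (rule o_bij)
  show "inv (blinfun_apply M) = blinfun_apply W"
    using comp by (rule inv_unique_comp)
qed

theorem proposition6p1:
  fixes p p\<^sub>1 :: real
  assumes "p > (real CARD('n::finite) - 1) / 2"
    and "p\<^sub>1 > (real CARD('n) + 3) / 2"
  shows "\<exists>a b :: real. \<forall>\<sigma>\<^sub>1 \<in> (pd_cone :: 'n symmat set).
    (let dens = wishart_density p\<^sub>1 \<sigma>\<^sub>1;
         M = density_info dens + (LINT u:pd_cone|lborel. dens u *\<^sub>R fisher_info p u)
     in set_integrable lborel pd_cone (density_info_integrand dens) \<and>
        set_integrable lborel pd_cone (\<lambda>u. dens u *\<^sub>R fisher_info p u) \<and>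
        bij (blinfun_apply M) \<and>
        inv (blinfun_apply M) =
          blinfun_apply (a *\<^sub>R quad_rep \<sigma>\<^sub>1 + b *\<^sub>R tensor_sq \<sigma>\<^sub>1))"
proof -
  define n where "n = real CARD('n)"
  define \<alpha> where "\<alpha> = p\<^sub>1 - (n + 1) / 2"
  define c where "c = (\<alpha> - 1) * \<alpha> * (\<alpha> + 1 / 2)"
  define \<kappa> where "\<kappa> = 1 / (2 * (2 * p + 3))"
  \<comment> \<open>\<open>A\<close> and \<open>B\<close> are the coefficients of P(t) and of the
    tensor square of t in the total information. They do not involve \<sigma>, so the witnesses can
    be fixed before it.\<close>
  define A where "A = (\<alpha>\<^sup>2 + \<kappa> * ((2 * p + 1) * \<alpha> - 1)) / c"
  define B where "B = (\<alpha> / 2 + \<kappa> * (p + 1 - \<alpha>)) / c"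
  have n: "1 \<le> n"
    by (simp add: n_def Suc_leI)
  have p: "0 < p" "n < 2 * p + 1"
    using assms(1) n unfolding n_def[symmetric] by (simp_all add: field_simps)
  have \<alpha>: "1 < \<alpha>"
    using assms(2) by (simp add: \<alpha>_def n_def field_simps)
  have c: "0 < c"
    using \<alpha> by (simp add: c_def)
  have \<kappa>: "0 < \<kappa>"
    using p by (simp add: \<kappa>_def)
  have "1 * 1 < (2 * p + 1) * \<alpha>"
    using p \<alpha> by (intro mult_strict_mono) auto
  then have A: "0 < A"
    unfolding A_def using c \<kappa> by (intro divide_pos_pos add_nonneg_pos mult_pos_pos) auto
  have AB: "0 < A + n * B"
  proof -
    \<comment> \<open>Regrouped so that every bracket is visibly positive; 2p + 1 - n > 0 is the
      hypothesis on p.\<close>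
    have "A + n * B = (\<alpha>\<^sup>2 + n * \<alpha> / 2 + \<kappa> * ((2 * p + 1 - n) * \<alpha> + (n * (p + 1) - 1))) / c"
      by (simp add: A_def B_def add_divide_distrib[symmetric] algebra_simps)
    moreover have "0 < n * (p + 1) - 1"
      using mult_le_less_imp_less[of 1 n 1 "p + 1"] n p by simp
    then have "0 < (2 * p + 1 - n) * \<alpha> + (n * (p + 1) - 1)"
      using p \<alpha> by (intro add_pos_pos mult_pos_pos) auto
    ultimately show ?thesis
      using \<kappa> c n \<alpha> by (auto intro!: divide_pos_pos add_pos_pos mult_pos_pos)
  qed
  show ?thesis
  proof (intro exI ballI)
    fix \<sigma> :: "'n symmat" assume \<sigma>: "\<sigma> \<in> pd_cone"
    let ?f = "wishart_pdf p\<^sub>1 \<sigma>" and ?t = "symmat_inv \<sigma>"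
    note info = has_bochner_integral_density_info[OF assms(2) \<sigma>, folded n_def, folded \<alpha>_def, folded c_def]
    note fisher = has_bochner_integral_fisher_info[OF assms(2) \<sigma>, of p, folded n_def, folded \<alpha>_def, folded c_def, folded \<kappa>_def]
    \<comment> \<open>Expanded, c is \<alpha>^3 - \<alpha>^2 / 2 - \<alpha> / 2, so the - 1 from the
      score leaves only \<alpha> / (2c).\<close>
    have "\<alpha>\<^sup>2 * (\<alpha> - 1 / 2) - c = \<alpha> / 2"
      by (simp add: c_def field_simps power2_eq_square)
    then have score: "\<alpha>\<^sup>2 * (\<alpha> - 1 / 2) / c - 1 = \<alpha> / 2 / c"
      using c by (simp add: field_simps)
    have A_eq: "A = \<alpha>\<^sup>2 / c + \<kappa> * ((2 * p + 1) * (\<alpha> / c) - 1 / c)"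
      using c by (simp add: A_def field_simps)
    have B_eq: "B = \<alpha> / 2 / c + \<kappa> * ((2 * p + 1) * (1 / (2 * c)) - (\<alpha> - 1 / 2) / c)"
      using c by (simp add: B_def field_simps)
    have "density_info ?f + (LINT u:pd_cone|lborel. ?f u *\<^sub>R fisher_info p u) =
        A *\<^sub>R quad_rep ?t + B *\<^sub>R tensor_sq ?t"
      unfolding density_info_def set_lebesgue_integral_def
        has_bochner_integral_integral_eq[OF info] has_bochner_integral_integral_eq[OF fisher]
      unfolding A_eq B_eq score by (simp add: scaleR_add_left scaleR_add_right scaleR_diff_right scaleR_diff_left right_diff_distrib)
    then show "let dens = wishart_density p\<^sub>1 \<sigma>;
         M = density_info dens + (LINT u:pd_cone|lborel. dens u *\<^sub>R fisher_info p u)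
     in set_integrable lborel pd_cone (density_info_integrand dens) \<and>
        set_integrable lborel pd_cone (\<lambda>u. dens u *\<^sub>R fisher_info p u) \<and>
        bij (blinfun_apply M) \<and>
        inv (blinfun_apply M) =
          blinfun_apply ((1 / A) *\<^sub>R quad_rep \<sigma> + (- B / (A * (A + n * B))) *\<^sub>R tensor_sq \<sigma>)"
      using quad_tensor_inverse[OF \<sigma>, of A B] A AB integrable.intros[OF info] integrable.intros[OF fisher]
      unfolding Let_def wishart_density_eq[OF assms(2) \<sigma>] set_integrable_def n_def
      by simp
  qed
qed

end
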